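(* The tensor valuations $\widetilde\Phi_k^{r,s}$ on $\mathcal{K}^2$ ($k\in\{0,1\}$, $r,s\in\mathbb{N}_0$) satisfy the relations $$\widetilde\Phi_1^{r,0}=0,\qquad \widetilde\Phi_0^{0,s}=0\qquad\text{for } r,s\in\mathbb{N}_0,$$ $$r\,\widetilde\Phi_1^{r-1,s}+s\,\widetilde\Phi_0^{r,s-1}=0\qquad\text{for } r,s\in\mathbb{N}.$$ For $p\in\mathbb{N}_0$, a basis of $T^p_-(\mathcal{K}^2)$ is given by $$Q^m\widetilde\Phi_1^{r,s},\qquad m,r\in\mathbb{N}_0,\ s\in\mathbb{N},\ 2m+r+s+1=p.$$
   Context: $\mathbb{N}=\{1,2,\dots\}$, $\mathbb{N}_0=\mathbb{N}\cup\{0\}$. $\mathbb{R}^2$ carries its standard scalar product $\langle\cdot,\cdot\rangle$ and a fixed orientation; $\Sigma^2=\mathbb{R}^2\times\mathbb{S}^1$. For $u\in\mathbb{S}^1$, $\overline u\in\mathbb{S}^1$ is the unique vector such that $(u,\overline u)$ is a positively oriented orthonormal basis of $\mathbb{R}^2$. $\mathcal{K}^2$ is the set of convex bodies (nonempty compact convex subsets) of $\mathbb{R}^2$ with the Hausdorff metric. $\mathbb{T}^p$ is the space of symmetric rank $p$ tensors on $\mathbb{R}^2$, viewed as symmetric $p$-linear functionals; a vector $a$ is identified with $\langle a,\cdot\rangle$, products are symmetric tensor products, $x^r$ is the $r$-fold symmetric product, $x^0=1$, and $Q$ is the metric tensor, $Q(x,y)=\langle x,y\rangle$. $\Theta_0(K,\cdot),\Theta_1(K,\cdot)$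 are the support measures of $K\in\mathcal{K}^2$: the finite Borel measures on $\Sigma^2$, depending weakly continuously on $K$ (that is, $\int f\,d\Theta_k(K_i,\cdot)\to\int f\,d\Theta_k(K,\cdot)$ for all continuous $f:\Sigma^2\to\mathbb{R}$ whenever $K_i\to K$), which for a polytope $P$ are given by $\Theta_k(P,\eta)=\sum_{F\in\mathcal{F}_k(P)}\int_F\int_{\nu(P,F)}\mathbf{1}_\eta(x,u)\,\mathcal{H}^{1-k}(du)\,\mathcal{H}^k(dx)$, where $\mathcal{F}_k(P)$ is the set of $k$-dimensional faces of $P$, $\nu(P,F)$ is the set of outer unit normal vectors of $P$ at $F$, and $\mathcal{H}^k$ is $k$-dimensional Hausdorff measure. For $K\in\mathcal{K}^2$, $k\in\{0,1\}$ and $r,s\in\mathbb{N}_0$, $$\widetilde\Phi_k^{r,s}(K)=\int_{\Sigma^2}x^r\,u^s\,\overline u\;\Theta_k(K,d(x,u))\in\mathbb{T}^{r+s+1}.$$ For $p\in\mathbb{N}_0$, $T^p_-(\mathcal{K}^2)$ is the real vector space (of mappings $\mathcal{K}^2\to\mathbb{T}^p$) spanned by all $Q^m\widetilde\Phi_k^{r,s}$ with $k\in\{0,1\}$, $m,r,s\in\mathbb{N}_0$, $2m+r+s+1=p$. *)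

theory Defs
  imports "HOL-Analysis.Analysis" "HOL-Library.Function_Algebras"
begin

instantiation "fun" :: (type, real_vector) real_vector
begin

definition scaleR_fun :: "real \<Rightarrow> ('a \<Rightarrow> 'b) \<Rightarrow> 'a \<Rightarrow> 'b" where
  "scaleR_fun c f = (\<lambda>x. c *\<^sub>R f x)"

instance
  by standard (auto simp: scaleR_fun_def fun_eq_iff scaleR_add_right scaleR_add_left)

end

definition basis_family :: "('i \<Rightarrow> 'v::real_vector) \<Rightarrow> 'i set \<Rightarrow> 'v set \<Rightarrow> bool" where
  "basis_family b I V \<longleftrightarrow> inj_on b I \<and> independent (b ` I) \<and> span (b ` I) = V"

type_synonym plane = "real^2"

typedef convex_body = "{K :: plane set. K \<noteq> {} \<and> compact K \<and> convex K}"
  morphisms points Convex_Body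
  by (intro exI[of _ "{0}"]) simp

definition hausdorff_dist :: "'a::metric_space set \<Rightarrow> 'a set \<Rightarrow> real" where
  "hausdorff_dist S T = max (SUP x\<in>S. infdist x T) (SUP y\<in>T. infdist y S)"

lemma hausdorff_dist_commute: "hausdorff_dist S T = hausdorff_dist T S"
  by (simp add: hausdorff_dist_def max.commute)

lemma infdist_le_hausdorff_dist:
  assumes "compact S" "x \<in> S"
  shows "infdist x T \<le> hausdorff_dist S T"
proof -
  have "bdd_above ((\<lambda>x. infdist x T) ` S)"
    using assms(1)
    by (intro bounded_imp_bdd_above compact_imp_bounded compact_continuous_image
        continuous_intros)
  then have "infdist x T \<le> (SUP x\<in>S. infdist x T)"
    using assms(2) by (rule cSUP_upper2) auto
  then show ?thesis
    by (simp add: hausdorff_dist_def)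
qed

lemma hausdorff_dist_le:
  assumes "S \<noteq> {}" "T \<noteq> {}"
    and "\<And>x. x \<in> S \<Longrightarrow> infdist x T \<le> c" "\<And>y. y \<in> T \<Longrightarrow> infdist y S \<le> c"
  shows "hausdorff_dist S T \<le> c"
  using assms by (auto simp: hausdorff_dist_def intro!: cSUP_least)

lemma infdist_le_add_hausdorff_dist:
  fixes T :: "'a::heine_borel set"
  assumes "compact T" "T \<noteq> {}"
  shows "infdist x U \<le> infdist x T + hausdorff_dist T U"
proof -
  obtain y where y: "y \<in> T" "infdist x T = dist x y"
    using infdist_attains_inf[OF compact_imp_closed[OF assms(1)] assms(2)] by metis
  have "infdist x U \<le> infdist y U + dist x y"
    by (rule infdist_triangle)
  then show ?thesis
    using infdist_le_hausdorff_dist[OF assms(1) y(1), of U] y(2) by linarith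
qed

instantiation convex_body :: metric_space
begin

definition dist_convex_body :: "convex_body \<Rightarrow> convex_body \<Rightarrow> real" where
  "dist_convex_body K L = hausdorff_dist (points K) (points L)"

definition uniformity_convex_body :: "(convex_body \<times> convex_body) filter" where
  "uniformity_convex_body = (INF e\<in>{0<..}. principal {(x, y). dist x y < e})"

definition open_convex_body :: "convex_body set \<Rightarrow> bool" where
  "open_convex_body U \<longleftrightarrow> (\<forall>x\<in>U. \<forall>\<^sub>F (x', y) in uniformity. x' = x \<longrightarrow> y \<in> U)"

instance
proof
  fix K L M :: convex_body
  have body: "points N \<noteq> {}" "compact (points N)" for N
    using points[of N] by auto
  have sub: "points A \<subseteq> points B" if "dist A B = 0" for A B
  proof
    fix x assume "x \<in> points A"
    then have "infdist x (points B) \<le> 0"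
      using infdist_le_hausdorff_dist[OF body(2)[of A], of x "points B"] that
      by (simp add: dist_convex_body_def)
    then have "infdist x (points B) = 0"
      using infdist_nonneg[of x "points B"] by linarith
    then show "x \<in> points B"
      using in_closed_iff_infdist_zero[OF compact_imp_closed[OF body(2)] body(1)] by blast
  qed
  have comm: "dist A B = dist B A" for A B :: convex_body
    by (simp add: dist_convex_body_def hausdorff_dist_commute)
  show "dist K L = 0 \<longleftrightarrow> K = L"
  proof
    assume KL: "dist K L = 0"
    then have "dist L K = 0"
      by (subst comm)
    then show "K = L"
      using sub[of K L] sub[of L K] KL points_inject[of K L] by blast
  next
    have "hausdorff_dist (points L) (points L) \<le> 0"
      by (rule hausdorff_dist_le[OF body(1) body(1)]) simp_all
    moreover obtain x where "x \<in> points L"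
      using body(1) by blast
    then have "0 \<le> hausdorff_dist (points L) (points L)"
      using infdist_le_hausdorff_dist[OF body(2)[of L], of x "points L"]
        infdist_nonneg[of x "points L"] by linarith
    moreover assume "K = L"
    ultimately show "dist K L = 0"
      unfolding dist_convex_body_def by (simp only: order_antisym)
  qed
  have le: "infdist x (points B) \<le> dist A M + dist M B" if "x \<in> points A" for x A B
    using infdist_le_hausdorff_dist[OF body(2)[of A] that, of "points M"]
      infdist_le_add_hausdorff_dist[OF body(2,1), of x "points B" M]
    by (simp add: dist_convex_body_def)
  have "hausdorff_dist (points K) (points L) \<le> dist K M + dist M L"
  proof (rule hausdorff_dist_le[OF body(1) body(1)])
    show "infdist x (points L) \<le> dist K M + dist M L" if "x \<in> points K" for x
      by (rule le[OF that])
    show "infdist y (points K) \<le> dist K M + dist M L" if "y \<in> points L" for y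
      using le[OF that, of K] comm[of K M] comm[of M L] by linarith
  qed
  then show "dist K L \<le> dist K M + dist L M"
    using comm[of M L] by (simp add: dist_convex_body_def)
qed (simp_all only: uniformity_convex_body_def open_convex_body_def)

end

text \<open>
  For a unit vector u, the vector \<open>rot u\<close> completes u to a positively oriented orthonormal basis
  with respect to the standard orientation of the plane.
\<close>

definition rot :: "plane \<Rightarrow> plane" where
  "rot u = vector [- (u $ 2), u $ 1]"

lemma rot_characterization:
  fixes u v :: "plane"
  assumes "norm u = 1"
  shows "norm v = 1 \<and> u \<bullet> v = 0 \<and> det (vector [u, v] :: real^2^2) > 0 \<longleftrightarrow> v = rot u"
proof -
  have u: "(u $ 1)\<^sup>2 + (u $ 2)\<^sup>2 = 1"
    using assms by (simp add: norm_eq_1 inner_vec_def sum_2 power2_eq_square)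
  have norm_v: "norm v = 1 \<longleftrightarrow> (v $ 1)\<^sup>2 + (v $ 2)\<^sup>2 = 1"
    by (simp add: norm_eq_1 inner_vec_def sum_2 power2_eq_square)
  have inner: "u \<bullet> v = u $ 1 * v $ 1 + u $ 2 * v $ 2"
    by (simp add: inner_vec_def sum_2)
  have det: "det (vector [u, v] :: real^2^2) = u $ 1 * v $ 2 - u $ 2 * v $ 1"
    by (simp add: det_2)
  have eq: "v = rot u \<longleftrightarrow> v $ 1 = - (u $ 2) \<and> v $ 2 = u $ 1"
    by (simp add: rot_def vec_eq_iff forall_2)
  show ?thesis
  proof
    assume A: "norm v = 1 \<and> u \<bullet> v = 0 \<and> det (vector [u, v] :: real^2^2) > 0"
    define d where "d = u $ 1 * v $ 2 - u $ 2 * v $ 1"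
    have o: "u $ 1 * v $ 1 + u $ 2 * v $ 2 = 0" and "d > 0"
      using A by (simp_all add: inner det d_def)
    have "d\<^sup>2 + (u $ 1 * v $ 1 + u $ 2 * v $ 2)\<^sup>2
        = ((u $ 1)\<^sup>2 + (u $ 2)\<^sup>2) * ((v $ 1)\<^sup>2 + (v $ 2)\<^sup>2)"
      unfolding d_def by algebra
    then have "d\<^sup>2 = 1"
      using A o u by (simp add: norm_v)
    then have d: "d = 1"
      using \<open>d > 0\<close> by (simp add: power2_eq_1_iff)
    have "((u $ 1)\<^sup>2 + (u $ 2)\<^sup>2) * v $ 1
        = u $ 1 * (u $ 1 * v $ 1 + u $ 2 * v $ 2) - u $ 2 * d"
      "((u $ 1)\<^sup>2 + (u $ 2)\<^sup>2) * v $ 2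
        = u $ 2 * (u $ 1 * v $ 1 + u $ 2 * v $ 2) + u $ 1 * d"
      unfolding d_def by algebra+
    then show "v = rot u"
      unfolding u o d by (simp add: eq)
  next
    assume "v = rot u"
    then show "norm v = 1 \<and> u \<bullet> v = 0 \<and> det (vector [u, v] :: real^2^2) > 0"
      using u by (simp add: norm_v inner det eq power2_eq_square algebra_simps)
  qed
qed

text \<open>
  A tensor of rank p is a functional on sequences of vectors that depends only on the first p
  entries, its p arguments. Rank 0 tensors are thus the constants. The rank is not part of the
  type, so products and powers carry the ranks of their factors as parameters.
\<close>

type_synonym tensor = "(nat \<Rightarrow> plane) \<Rightarrow> real"

definition sym_tensors :: "nat \<Rightarrow> tensor set" where
  "sym_tensors p = {a.
     (\<forall>y z. (\<forall>i<p. y i = z i) \<longrightarrow> a y = a z) \<and>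
     (\<forall>y. \<forall>i<p. linear (\<lambda>v. a (y(i := v)))) \<and>
     (\<forall>y \<sigma>. \<sigma> permutes {..<p} \<longrightarrow> a (\<lambda>i. y (\<sigma> i)) = a y)}"

definition vec_tensor :: "plane \<Rightarrow> tensor" where
  "vec_tensor x = (\<lambda>y. x \<bullet> y 0)"

definition metric_tensor :: tensor where
  "metric_tensor = (\<lambda>y. y 0 \<bullet> y 1)"

definition sym_prod :: "nat \<Rightarrow> nat \<Rightarrow> tensor \<Rightarrow> tensor \<Rightarrow> tensor" where
  "sym_prod p q a b = (\<lambda>y.
     (\<Sum>\<sigma> | \<sigma> permutes {..<p + q}. a (\<lambda>i. y (\<sigma> i)) * b (\<lambda>i. y (\<sigma> (p + i)))) / fact (p + q))"

lemma vec_tensor_in_sym_tensors: "vec_tensor x \<in> sym_tensors 1"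
proof -
  have "x \<bullet> y (\<sigma> 0) = x \<bullet> y 0" if "\<sigma> permutes {..<1}"
    for y :: "nat \<Rightarrow> plane" and \<sigma>
    using permutes_in_image[OF that, of 0] by simp
  then show ?thesis
    unfolding sym_tensors_def vec_tensor_def
    by (auto simp del: One_nat_def
        simp: bounded_linear_inner_right[THEN bounded_linear.linear])
qed

lemma metric_tensor_in_sym_tensors: "metric_tensor \<in> sym_tensors 2"
proof -
  have perm: "metric_tensor (\<lambda>i. y (\<sigma> i)) = metric_tensor y" if \<sigma>: "\<sigma> permutes {..<2}" for y \<sigma>
  proof -
    have "\<sigma> 0 < 2" "\<sigma> 1 < 2" "\<sigma> 0 \<noteq> \<sigma> 1"
      using permutes_in_image[OF \<sigma>] permutes_inj[OF \<sigma>] by (auto dest: injD)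
    then have "\<sigma> 0 = 0 \<and> \<sigma> 1 = 1 \<or> \<sigma> 0 = 1 \<and> \<sigma> 1 = 0"
      by linarith
    then show ?thesis
      by (auto simp: metric_tensor_def inner_commute)
  qed
  moreover have "linear (\<lambda>v. metric_tensor (y(i := v)))" if "i < 2" for y i
    using that by (auto simp: metric_tensor_def less_2_cases_iff
        bounded_linear_inner_right[THEN bounded_linear.linear]
        bounded_linear_inner_left[THEN bounded_linear.linear])
  ultimately show ?thesis
    by (auto simp: sym_tensors_def metric_tensor_def)
qed

lemma sym_prod_in_sym_tensors:
  assumes a: "a \<in> sym_tensors p" and b: "b \<in> sym_tensors q"
  shows "sym_prod p q a b \<in> sym_tensors (p + q)"
proof -
  have a_dep: "a y = a z" if "\<And>i. i < p \<Longrightarrow> y i = z i" for y z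
    using a that unfolding sym_tensors_def by blast
  have b_dep: "b y = b z" if "\<And>i. i < q \<Longrightarrow> y i = z i" for y z
    using b that unfolding sym_tensors_def by blast
  have a_lin: "linear (\<lambda>v. a (y(i := v)))" if "i < p" for y i
    using a that unfolding sym_tensors_def by blast
  have b_lin: "linear (\<lambda>v. b (y(i := v)))" if "i < q" for y i
    using b that unfolding sym_tensors_def by blast
  let ?t = "\<lambda>y \<sigma>. a (\<lambda>i. y (\<sigma> i)) * b (\<lambda>i. y (\<sigma> (p + i)))"
  let ?P = "{\<sigma>. \<sigma> permutes {..<p + q}}"
  have "sym_prod p q a b y = sym_prod p q a b z" if "\<forall>i<p + q. y i = z i" for y z
  proof -
    have "?t y \<sigma> = ?t z \<sigma>" if \<sigma>: "\<sigma> permutes {..<p + q}" for \<sigma>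
    proof -
      have "\<sigma> i < p + q" if "i < p + q" for i
        using permutes_in_image[OF \<sigma>] that by auto
      then show ?thesis
        using \<open>\<forall>i<p + q. y i = z i\<close>
        by (intro arg_cong2[where f = "(*)"] a_dep b_dep) auto
    qed
    then show ?thesis
      by (auto simp: sym_prod_def intro!: sum.cong)
  qed
  moreover have "linear (\<lambda>v. sym_prod p q a b (y(j := v)))" if j: "j < p + q" for y j
  proof -
    have lin: "linear (\<lambda>v. ?t (y(j := v)) \<sigma>)" if \<sigma>: "\<sigma> permutes {..<p + q}" for \<sigma>
    proof -
      define k where "k = inv \<sigma> j"
      have k: "k < p + q"
        using permutes_in_image[OF permutes_inv[OF \<sigma>], of j] j by (simp add: k_def)
      have eq: "\<sigma> i = j \<longleftrightarrow> i = k" for i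
        using permutes_inv_eq[OF \<sigma>, of j i] by (auto simp: k_def)
      show ?thesis
      proof (cases "k < p")
        case True
        have "(\<lambda>i. (y(j := v)) (\<sigma> i)) = (\<lambda>i. y (\<sigma> i))(k := v)"
          "(\<lambda>i. (y(j := v)) (\<sigma> (p + i))) = (\<lambda>i. y (\<sigma> (p + i)))" for v
          using True eq by (auto simp: fun_eq_iff)
        then have "?t (y(j := v)) \<sigma>
            = b (\<lambda>i. y (\<sigma> (p + i))) *\<^sub>R a ((\<lambda>i. y (\<sigma> i))(k := v))" for v
          by simp
        then show ?thesis
          using linear_compose_scale_right[OF a_lin[OF True]] by simp
      next
        case False
        then have kq: "k - p < q"
          using k by simp
        have "b (\<lambda>i. (y(j := v)) (\<sigma> (p + i))) = b ((\<lambda>i. y (\<sigma> (p + i)))(k - p := v))" for v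
          using False eq by (intro b_dep) auto
        moreover have "a (\<lambda>i. (y(j := v)) (\<sigma> i)) = a (\<lambda>i. y (\<sigma> i))" for v
          using False eq by (intro a_dep) auto
        ultimately have "?t (y(j := v)) \<sigma>
            = a (\<lambda>i. y (\<sigma> i)) *\<^sub>R b ((\<lambda>i. y (\<sigma> (p + i)))(k - p := v))" for v
          by simp
        then show ?thesis
          using linear_compose_scale_right[OF b_lin[OF kq]] by simp
      qed
    qed
    have "linear (\<lambda>v. (1 / fact (p + q)) *\<^sub>R (\<Sum>\<sigma>\<in>?P. ?t (y(j := v)) \<sigma>))"
      using lin by (intro linear_compose_scale_right linear_compose_sum) auto
    then show ?thesis
      by (simp add: sym_prod_def)
  qed
  moreover have "sym_prod p q a b (\<lambda>i. y (\<tau> i)) = sym_prod p q a b y"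
    if \<tau>: "\<tau> permutes {..<p + q}" for y \<tau>
    using setum_permutations_compose_left[OF \<tau>, of "?t y"] by (simp add: sym_prod_def o_def)
  ultimately show ?thesis
    unfolding sym_tensors_def by blast
qed

primrec sym_power :: "nat \<Rightarrow> tensor \<Rightarrow> nat \<Rightarrow> tensor" where
  "sym_power p a 0 = (\<lambda>y. 1)"
| "sym_power p a (Suc n) = sym_prod p (p * n) a (sym_power p a n)"

lemma sym_power_in_sym_tensors: "a \<in> sym_tensors p \<Longrightarrow> sym_power p a n \<in> sym_tensors (p * n)"
proof (induction n)
  case 0
  then show ?case
    by (simp add: sym_tensors_def)
next
  case (Suc n)
  then show ?case
    using sym_prod_in_sym_tensors[of a p "sym_power p a n" "p * n"] by simp
qed

text \<open>
  The normalization makes the n-dimensional Hausdorff measure on an n-dimensional Euclidean space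
  the Lebesgue measure. The library function \<open>diameter\<close> is meaningful on bounded sets only. An
  empty covering set contributes 0 also in dimension 0, where a nonempty one contributes 1.
\<close>

definition hausdorff_premeasure :: "nat \<Rightarrow> real \<Rightarrow> 'a::metric_space set \<Rightarrow> ennreal" where
  "hausdorff_premeasure n \<delta> A =
     (INF U \<in> {U :: nat \<Rightarrow> 'a set. (\<forall>i. bounded (U i) \<and> diameter (U i) \<le> \<delta>) \<and> A \<subseteq> (\<Union>i. U i)}.
        \<Sum>i. if U i = {} then 0
            else ennreal (unit_ball_vol (real n) * (diameter (U i) / 2) ^ n))"

definition hausdorff_outer_measure :: "nat \<Rightarrow> 'a::metric_space set \<Rightarrow> ennreal" where
  "hausdorff_outer_measure n A = (SUP \<delta>\<in>{0<..}. hausdorff_premeasure n \<delta> A)"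

definition hausdorff_measure :: "nat \<Rightarrow> 'a::metric_space measure" where
  "hausdorff_measure n = measure_of UNIV (sets borel) (hausdorff_outer_measure n)"

definition Sigma2 :: "(plane \<times> plane) set" where
  "Sigma2 = UNIV \<times> sphere 0 1"

definition faces_of_dim :: "nat \<Rightarrow> plane set \<Rightarrow> plane set set" where
  "faces_of_dim k P = {F. F face_of P \<and> aff_dim F = int k}"

definition outer_unit_normals :: "plane set \<Rightarrow> plane set \<Rightarrow> plane set" where
  "outer_unit_normals P F = {u \<in> sphere 0 1. \<forall>x\<in>F. \<forall>y\<in>P. u \<bullet> y \<le> u \<bullet> x}"

text \<open>
  The defining properties of the support measures: \<open>\<Theta> k K\<close> is the k-th support measure of the
  convex body K. They determine \<open>\<Theta> k K\<close> uniquely, since polytopes are dense in the space of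
  convex bodies.
\<close>

definition support_measures :: "(nat \<Rightarrow> convex_body \<Rightarrow> (plane \<times> plane) measure) \<Rightarrow> bool" where
  "support_measures \<Theta> \<longleftrightarrow> (\<forall>k\<in>{0, 1}.
     (\<forall>K. finite_measure (\<Theta> k K) \<and> sets (\<Theta> k K) = sets (restrict_space borel Sigma2)) \<and>
     (\<forall>K L f. K \<longlonglongrightarrow> L \<longrightarrow> continuous_on Sigma2 (f :: _ \<Rightarrow> real) \<longrightarrow>
        (\<lambda>i. \<integral>z. f z \<partial>\<Theta> k (K i)) \<longlonglongrightarrow> (\<integral>z. f z \<partial>\<Theta> k L)) \<and>
     (\<forall>P. polytope (points P) \<longrightarrow> (\<forall>\<eta> \<in> sets (\<Theta> k P).
        emeasure (\<Theta> k P) \<eta> =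
          (\<Sum>F\<in>faces_of_dim k (points P).
             \<integral>\<^sup>+x\<in>F. (\<integral>\<^sup>+u\<in>outer_unit_normals (points P) F.
               indicator \<eta> (x, u) \<partial>hausdorff_measure (1 - k)) \<partial>hausdorff_measure k))))"

text \<open>Tensor-valued integrals are taken argumentwise.\<close>

definition Phi ::
  "(nat \<Rightarrow> convex_body \<Rightarrow> (plane \<times> plane) measure) \<Rightarrow> nat \<Rightarrow> nat \<Rightarrow> nat \<Rightarrow> convex_body \<Rightarrow> tensor" where
  "Phi \<Theta> k r s K = (\<lambda>y. \<integral>(x, u).
     sym_prod (r + s) 1
       (sym_prod r s (sym_power 1 (vec_tensor x) r) (sym_power 1 (vec_tensor u) s))
       (vec_tensor (rot u)) y \<partial>\<Theta> k K)"

definition Q_Phi ::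
  "(nat \<Rightarrow> convex_body \<Rightarrow> (plane \<times> plane) measure) \<Rightarrow>
     nat \<Rightarrow> nat \<Rightarrow> nat \<Rightarrow> nat \<Rightarrow> convex_body \<Rightarrow> tensor" where
  "Q_Phi \<Theta> m k r s = (\<lambda>K.
     sym_prod (2 * m) (r + s + 1) (sym_power 2 metric_tensor m) (Phi \<Theta> k r s K))"

definition T_minus ::
  "(nat \<Rightarrow> convex_body \<Rightarrow> (plane \<times> plane) measure) \<Rightarrow> nat \<Rightarrow> (convex_body \<Rightarrow> tensor) set" where
  "T_minus \<Theta> p = span {Q_Phi \<Theta> m k r s | m k r s. k \<in> {0, 1} \<and> 2 * m + r + s + 1 = p}"

end

theory Submission
  imports Defs
begin

text \<open>
  For a polygon, the support measures are sums of line integrals. The measure \<open>\<Theta> 1\<close> integrates along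
  the edges: there the outer unit normal u is constant, and the boundary point x moves with velocity
  \<open>rot u\<close>. The measure \<open>\<Theta> 0\<close> integrates along the arcs of unit normals at the vertices: there x is
  constant, and u moves with velocity \<open>rot u\<close>. So r times the integrand of \<open>Phi \<Theta> 1 (r - 1) s\<close> on an
  edge and s times the integrand of \<open>Phi \<Theta> 0 r (s - 1)\<close> on an arc are both derivatives of the tensor
  \<open>x\<^sup>r u\<^sup>s\<close>. Edges and arcs alternate and together form a closed curve, the normal bundle of the polygon,
  so the boundary values of \<open>x\<^sup>r u\<^sup>s\<close> cancel (\<open>polygon_diagonal_relation\<close>). This gives
  \<open>r Phi \<Theta> 1 (r - 1) s + s Phi \<Theta> 0 r (s - 1) = 0\<close> for all r and s, and the cases s = 0 and r = 0 are
  the two vanishing statements. The calculation needs only equal arguments, where symmetric products are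
  products of numbers, since a symmetric tensor is determined by its values on the diagonal
  (\<open>sym_tensor_eq_0_if_diagonal_0\<close>). Polygons are dense in the space of convex bodies, and the weak
  continuity of the support measures carries the relation over to all of them (\<open>Phi_relation\<close>).

  The support measures of polytopes are defined by Hausdorff measures, so two facts from measure theory
  enter: Hausdorff outer measures are measures on the Borel sets, by Caratheodory's criterion for metric
  outer measures (\<open>metric_outer_measure_space_borel\<close>), and the one-dimensional Hausdorff measure is the
  length on segments and on circular arcs (\<open>nn_integral_hausdorff_trace\<close>).

  By the relations, the tensor valuations \<open>Q_Phi \<Theta> m 1 r s\<close> with \<open>s \<ge> 1\<close> span \<open>T_minus \<Theta> p\<close>. For their
  linear independence, evaluate at the first basis vector of the plane and on the right triangle
  with vertices 0, (a, 0) and (0, c). After trading \<open>Phi \<Theta> 1 r s\<close> for \<open>Phi \<Theta> 0 (r + 1) (s - 1)\<close>, only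
  the vertex (a, 0) contributes, and \<open>Q_Phi \<Theta> m 1 r s\<close> takes the value \<open>- a\<^sup>r\<^sup>+\<^sup>1 \<xi>\<^sup>s / (r + 1)\<close>, where
  \<open>\<xi>\<close> is the first coordinate of the normal of the hypotenuse (\<open>right_triangle\<close>). Since p and (r, s)
  determine m, a vanishing linear combination is a polynomial in the two independent parameters
  a and \<open>\<xi>\<close> that vanishes on the unit square, and all its coefficients are 0.
\<close>

section \<open>Symmetric tensors\<close>

lemma sym_prod_diagonal [simp]:
  "sym_prod p q a b (\<lambda>_. v) = a (\<lambda>_. v) * b (\<lambda>_. v)"
  by (simp add: sym_prod_def card_permutations)

lemma sym_power_diagonal [simp]: "sym_power p a n (\<lambda>_. v) = a (\<lambda>_. v) ^ n"
  by (induction n) auto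

lemma sym_prod_scaleR_right: "sym_prod p q a (c *\<^sub>R b) = c *\<^sub>R sym_prod p q a b"
  by (simp add: sym_prod_def fun_eq_iff scaleR_fun_def sum_distrib_left algebra_simps)

lemma sym_prod_zero_right: "sym_prod p q a 0 = 0"
  by (simp add: sym_prod_def fun_eq_iff)

lemma continuous_on_sym_prod:
  assumes "\<And>y. continuous_on S (\<lambda>z. A z y)" "\<And>y. continuous_on S (\<lambda>z. B z y)"
  shows "continuous_on S (\<lambda>z. sym_prod p q (A z) (B z) y)"
  unfolding sym_prod_def using assms by (intro continuous_intros) auto

lemma continuous_on_sym_power:
  assumes "\<And>y. continuous_on S (\<lambda>z. A z y)"
  shows "continuous_on S (\<lambda>z. sym_power p (A z) n y)"
proof (induction n arbitrary: y)
  case (Suc n)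
  then show ?case using assms by (simp add: continuous_on_sym_prod)
qed simp

text \<open>
  The first m arguments move along straight lines. Each of them contributes one term to the derivative,
  by linearity in that argument; taking them up one at a time makes this an induction.
\<close>

lemma multilinear_has_derivative:
  fixes a :: tensor and w z :: "nat \<Rightarrow> plane"
  assumes lin: "\<And>y i. i < p \<Longrightarrow> linear (\<lambda>v. a (y(i := v)))" and "m \<le> p"
  shows "((\<lambda>t. a (\<lambda>i. if i < m then z i + t *\<^sub>R w i else z i))
           has_real_derivative (\<Sum>i<m. a (z(i := w i)))) (at 0)"
  using \<open>m \<le> p\<close>
proof (induction m arbitrary: z)
  case 0
  then show ?case by simp
next
  case (Suc m)
  have m: "m < p" using Suc.prems by simp
  let ?f = "\<lambda>z t. a (\<lambda>i. if i < m then z i + t *\<^sub>R w i else z i)"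
  have split: "a (\<lambda>i. if i < Suc m then z i + t *\<^sub>R w i else z i) = ?f z t + t * ?f (z(m := w m)) t"
    for t
  proof -
    let ?y = "\<lambda>i. if i < m then z i + t *\<^sub>R w i else z i"
    interpret linear "\<lambda>v. a (?y(m := v))" by (rule lin[OF m])
    have "(\<lambda>i. if i < Suc m then z i + t *\<^sub>R w i else z i) = ?y(m := z m + t *\<^sub>R w m)"
      by (auto simp: fun_eq_iff less_Suc_eq)
    moreover have "a (?y(m := z m + t *\<^sub>R w m)) = a (?y(m := z m)) + t * a (?y(m := w m))"
      by (simp only: add scale) simp
    moreover have "?y(m := z m) = ?y"
      "?y(m := w m) = (\<lambda>i. if i < m then (z(m := w m)) i + t *\<^sub>R w i else (z(m := w m)) i)"
      by (auto simp: fun_eq_iff)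
    ultimately show ?thesis by simp
  qed
  have "((\<lambda>t. ?f z t + t * ?f (z(m := w m)) t) has_real_derivative
      (\<Sum>i<m. a (z(i := w i))) + (1 * ?f (z(m := w m)) 0 +
         (\<Sum>i<m. a ((z(m := w m))(i := w i))) * 0)) (at 0)"
    using Suc.prems by (intro DERIV_add DERIV_mult DERIV_ident Suc.IH) auto
  moreover have "?f (z(m := w m)) 0 = a (z(m := w m))"
    by (rule arg_cong[where f = a]) (auto simp: fun_eq_iff)
  ultimately have "((\<lambda>t. ?f z t + t * ?f (z(m := w m)) t) has_real_derivative
      (\<Sum>i<Suc m. a (z(i := w i)))) (at 0)"
    by simp
  then show ?case
    unfolding split .
qed

text \<open>
  Polarization. Suppose a vanishes whenever all arguments from position k on are equal, say to
  \<open>v + t *\<^sub>R w\<close>. The derivative at t = 0 is the sum of the values with w in one of the positions from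
  k on and v in the others, and these values agree by symmetry. So a also vanishes with an arbitrary w in
  position k.
\<close>

lemma sym_tensor_eq_0_if_diagonal_0:
  assumes a: "a \<in> sym_tensors p" and diag: "\<And>v. a (\<lambda>_. v) = 0"
  shows "a = 0"
proof -
  have dep: "a y = a z" if "\<And>i. i < p \<Longrightarrow> y i = z i" for y z
    using a that unfolding sym_tensors_def by blast
  have lin: "linear (\<lambda>v. a (y(i := v)))" if "i < p" for y i
    using a that unfolding sym_tensors_def by blast
  have sym: "a (\<lambda>i. y (\<sigma> i)) = a y" if "\<sigma> permutes {..<p}" for y \<sigma>
    using a that unfolding sym_tensors_def by blast
  have "k \<le> p \<Longrightarrow> a (\<lambda>i. if i < k then y i else v) = 0" for k y v
  proof (induction k arbitrary: y v)
    case 0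
    then show ?case using diag by simp
  next
    case (Suc k)
    let ?z = "\<lambda>i. if i < k then y i else v"
    let ?w = "\<lambda>i. if i < k then 0 else y k"
    have const: "(\<lambda>t. a (\<lambda>i. if i < p then ?z i + t *\<^sub>R ?w i else ?z i)) = (\<lambda>t. 0)"
    proof
      fix t
      have "a (\<lambda>i. if i < p then ?z i + t *\<^sub>R ?w i else ?z i)
          = a (\<lambda>i. if i < k then y i else v + t *\<^sub>R y k)"
        by (rule dep) auto
      then show "a (\<lambda>i. if i < p then ?z i + t *\<^sub>R ?w i else ?z i) = 0"
        using Suc by simp
    qed
    have "((\<lambda>t. a (\<lambda>i. if i < p then ?z i + t *\<^sub>R ?w i else ?z i))
        has_real_derivative (\<Sum>i<p. a (?z(i := ?w i)))) (at 0)"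
      by (rule multilinear_has_derivative[OF lin order_refl])
    then have "((\<lambda>t. 0) has_real_derivative (\<Sum>i<p. a (?z(i := ?w i)))) (at 0)"
      unfolding const .
    then have "0 = (\<Sum>i<p. a (?z(i := ?w i)))"
      by (rule DERIV_unique[OF DERIV_const])
    also have "\<dots> = (\<Sum>i<p. if k \<le> i then a (?z(k := y k)) else 0)"
    proof (rule sum.cong)
      fix i assume i: "i \<in> {..<p}"
      show "a (?z(i := ?w i)) = (if k \<le> i then a (?z(k := y k)) else 0)"
      proof (cases "k \<le> i")
        case True
        have "Transposition.transpose k i permutes {..<p}"
          using i Suc.prems by (intro permutes_swap_id) auto
        from sym[OF this, of "?z(k := y k)"] have
          "a (\<lambda>j. (?z(k := y k)) (Transposition.transpose k i j)) = a (?z(k := y k))" .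
        moreover have "(\<lambda>j. (?z(k := y k)) (Transposition.transpose k i j)) = ?z(i := y k)"
          using True by (auto simp: fun_eq_iff Transposition.transpose_def)
        ultimately show ?thesis
          using True by simp
      next
        case False
        then show ?thesis
          using linear_0[OF lin[of i]] i by simp
      qed
    qed simp
    also have "\<dots> = real (card {k..<p}) * a (?z(k := y k))"
    proof -
      have "{..<p} \<inter> {i. k \<le> i} = {k..<p}" by auto
      then show ?thesis by (simp add: sum.If_cases)
    qed
    finally have "a (?z(k := y k)) = 0"
      using Suc.prems by simp
    moreover have "?z(k := y k) = (\<lambda>i. if i < Suc k then y i else v)"
      by (auto simp: fun_eq_iff less_Suc_eq)
    ultimately show ?case by simp
  qed
  from this[of p] have "a (\<lambda>i. if i < p then y i else 0) = 0" for y
    by simp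
  moreover have "a (\<lambda>i. if i < p then y i else 0) = a y" for y
    by (rule dep) auto
  ultimately show ?thesis by (simp add: fun_eq_iff)
qed

lemma sym_tensors_0: "0 \<in> sym_tensors p"
  by (simp add: sym_tensors_def module_hom_zero)

lemma sym_tensors_add: "a \<in> sym_tensors p \<Longrightarrow> b \<in> sym_tensors p \<Longrightarrow> a + b \<in> sym_tensors p"
  by (auto simp: sym_tensors_def intro: linear_compose_add) metis

lemma sym_tensors_scaleR: "a \<in> sym_tensors p \<Longrightarrow> c *\<^sub>R a \<in> sym_tensors p"
  by (auto simp: sym_tensors_def scaleR_fun_def intro: linear_compose_scale_right[where 'b = real, simplified])

lemma integral_in_sym_tensors:
  assumes T: "\<And>z. T z \<in> sym_tensors p" and int: "\<And>y. integrable M (\<lambda>z. T z y)"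
  shows "(\<lambda>y. \<integral>z. T z y \<partial>M) \<in> sym_tensors p"
proof -
  have dep: "T z x = T z y" if "\<forall>i<p. x i = y i" for x y z
    using T[of z] that unfolding sym_tensors_def by blast
  have sym: "T z (\<lambda>i. y (\<sigma> i)) = T z y" if "\<sigma> permutes {..<p}" for y z \<sigma>
    using T[of z] that unfolding sym_tensors_def by blast
  have "linear (\<lambda>v. \<integral>z. T z (y(i := v)) \<partial>M)" if i: "i < p" for y i
  proof -
    have lin: "linear (\<lambda>v. T z (y(i := v)))" for z
      using T[of z] i unfolding sym_tensors_def by blast
    show ?thesis
    proof (rule linearI)
      fix v w
      show "(\<integral>z. T z (y(i := v + w)) \<partial>M) = (\<integral>z. T z (y(i := v)) \<partial>M) + (\<integral>z. T z (y(i := w)) \<partial>M)"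
        by (simp only: linear_add[OF lin] Bochner_Integration.integral_add[OF int int])
    next
      fix c v
      show "(\<integral>z. T z (y(i := c *\<^sub>R v)) \<partial>M) = c *\<^sub>R (\<integral>z. T z (y(i := v)) \<partial>M)"
        by (simp only: linear_scale[OF lin] integral_scaleR_right)
    qed
  qed
  moreover have "(\<integral>z. T z x \<partial>M) = (\<integral>z. T z y \<partial>M)" if "\<forall>i<p. x i = y i" for x y
    by (simp only: dep[OF that])
  moreover have "(\<integral>z. T z (\<lambda>i. y (\<sigma> i)) \<partial>M) = (\<integral>z. T z y \<partial>M)" if "\<sigma> permutes {..<p}" for y \<sigma>
    by (simp only: sym[OF that])
  ultimately show ?thesis
    unfolding sym_tensors_def by blast
qed

section \<open>Metric outer measures\<close>

text \<open>
  Caratheodory's criterion. Let \<open>B n\<close> be the points of X at distance more than \<open>1 / (n + 1)\<close> from C, which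
  increase to \<open>X - C\<close>. As \<open>B n\<close> is separated from C, the value on X is at least the sum of the values
  on \<open>X \<inter> C\<close> and \<open>B n\<close>. It remains to see that the values on \<open>B n\<close> approach the value on \<open>X - C\<close>, which
  holds because the layers \<open>B (n + 1) - B n\<close> have a finite total: every second layer is separated from the
  ones before it, so the layers with even index, and those with odd index, have a total of at most the
  value on X.
\<close>

lemma closed_in_lambda_system:
  fixes f :: "'a::metric_space set \<Rightarrow> ennreal"
  assumes empty: "f {} = 0"
    and mono: "\<And>A B. A \<subseteq> B \<Longrightarrow> f A \<le> f B"
    and csub: "\<And>A :: nat \<Rightarrow> 'a set. f (\<Union>i. A i) \<le> (\<Sum>i. f (A i))"
    and sep: "\<And>A B d. 0 < d \<Longrightarrow> \<forall>x\<in>A. \<forall>y\<in>B. d \<le> dist x y \<Longrightarrow>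
      f A + f B \<le> f (A \<union> B)"
    and C: "closed C"
  shows "C \<in> lambda_system UNIV (Pow UNIV) f"
proof -
  have sub: "f (A \<union> B) \<le> f A + f B" for A B
  proof -
    have "f (A \<union> B) = f (\<Union>i. binaryset A B i)"
      by (simp add: UN_binaryset_eq)
    also have "\<dots> \<le> (\<Sum>i. f (binaryset A B i))"
      by (rule csub)
    also have "\<dots> = f A + f B"
      by (rule suminf_binaryset_eq) (rule empty)
    finally show ?thesis .
  qed
  have "f (X \<inter> C) + f (X - C) = f X" for X
  proof (rule antisym)
    have "f X = f ((X \<inter> C) \<union> (X - C))"
      by (simp add: Int_Diff_Un)
    also have "\<dots> \<le> f (X \<inter> C) + f (X - C)"
      by (rule sub)
    finally show "f X \<le> f (X \<inter> C) + f (X - C)" .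
    show "f (X \<inter> C) + f (X - C) \<le> f X"
    proof (cases "f X = top \<or> C = {}")
      case True
      then show ?thesis by (elim disjE) (simp_all add: empty)
    next
      case False
      then have fin: "f X < top" and ne: "C \<noteq> {}"
        by (auto simp: less_top)
      define e where "e j = inverse (real (Suc j))" for j
      have e_mono: "e j \<le> e i" if "i \<le> j" for i j
        using that by (simp add: e_def field_simps)
      have e_less: "e (Suc j) < e j" for j
        by (simp add: e_def field_simps)
      have e_pos: "0 < e j" for j
        by (simp add: e_def)
      define B where "B n = {x \<in> X. e n < infdist x C}" for n
      define D where "D n = B (Suc n) - B n" for n
      have far: "infdist x C - infdist y C \<le> dist x y" for x y
        using infdist_triangle[of x C y] by linarith
      have part: "(\<Sum>k<n. f (D (2 * k + i))) \<le> f (\<Union>k<n. D (2 * k + i))" for n i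
      proof (induction n)
        case (Suc n)
        let ?U = "\<Union>k<n. D (2 * k + i)"
        \<comment> \<open>The layers up to index 2n - 2 + i lie in B (2n + i - 1). For n = 0 there are none, and any distance will do.\<close>
        define d where "d = (if n = 0 then 1 else e (2 * n + i - 1) - e (2 * n + i))"
        have d: "0 < d"
          using e_less[of "2 * n + i - 1"] by (cases n) (simp_all add: d_def)
        have "d \<le> dist x y" if x: "x \<in> ?U" and y: "y \<in> D (2 * n + i)" for x y
        proof -
          obtain k where k: "k < n" "x \<in> D (2 * k + i)"
            using x by auto
          then have "e (Suc (2 * k + i)) < infdist x C"
            by (auto simp: D_def B_def)
          moreover have "e (2 * n + i - 1) \<le> e (Suc (2 * k + i))"
            using k by (intro e_mono) auto
          moreover have "infdist y C \<le> e (2 * n + i)"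
            using y by (auto simp: D_def B_def)
          ultimately show ?thesis
            using far[of x y] k by (simp add: d_def)
        qed
        then have "f ?U + f (D (2 * n + i)) \<le> f (?U \<union> D (2 * n + i))"
          by (intro sep[OF d]) blast
        moreover have "?U \<union> D (2 * n + i) = (\<Union>k<Suc n. D (2 * k + i))"
          by (auto simp: less_Suc_eq)
        ultimately show ?case
          using Suc.IH by (simp add: add_right_mono order_trans[rotated])
      qed (simp add: empty)
      have bound: "(\<Sum>k<n. f (D k)) \<le> f X + f X" for n
      proof -
        have "(\<Sum>k<n. f (D k)) \<le> (\<Sum>k<2 * n. f (D k))"
          by (rule sum_mono2) auto
        also have "\<dots> = (\<Sum>k<n. f (D (2 * k + 0))) + (\<Sum>k<n. f (D (2 * k + 1)))"
          by (induction n) (auto simp: ac_simps)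
        also have "\<dots> \<le> f X + f X"
          by (intro add_mono order_trans[OF part] mono) (auto simp: D_def B_def)
        finally show ?thesis .
      qed
      define S where "S = (\<Sum>k. f (D k))"
      have S: "S < top"
      proof -
        have "S \<le> f X + f X"
          unfolding S_def suminf_eq_SUP by (rule SUP_least) (rule bound)
        also have "\<dots> < top"
          using fin by simp
        finally show ?thesis .
      qed
      \<comment> \<open>The total S of all layers is added on both sides, which avoids subtraction in the extended reals.\<close>
  have tail: "f (X - C) + f (X \<inter> C) + (\<Sum>k<n. f (D k)) \<le> f X + S" for n
      proof -
        have "X - C \<subseteq> B n \<union> (\<Union>k. D (k + n))"
        proof
          fix x assume x: "x \<in> X - C"
          then have "0 < infdist x C"
            using in_closed_iff_infdist_zero[OF C ne, of x] infdist_nonneg[of x C] by force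
          then obtain j where j: "e j < infdist x C"
            using reals_Archimedean unfolding e_def by blast
          define m where "m = (LEAST j. e j < infdist x C)"
          have m: "e m < infdist x C"
            unfolding m_def using j by (rule LeastI)
          show "x \<in> B n \<union> (\<Union>k. D (k + n))"
          proof (cases "m \<le> n")
            case True
            then show ?thesis
              using m x e_mono[OF True] by (auto simp: B_def)
          next
            case False
            then obtain l where l: "m = Suc l" "n \<le> l"
              by (cases m) auto
            then have "\<not> e l < infdist x C"
              unfolding m_def by (metis not_less_Least lessI m_def)
            then have "x \<in> D l"
              using m x l by (auto simp: D_def B_def)
            then show ?thesis
              using l by (metis UN_I UNIV_I UnI2 le_add_diff_inverse2)
          qed
        qed
        then have "f (X - C) \<le> f (B n \<union> (\<Union>k. D (k + n)))"
          by (rule mono)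
        also have "\<dots> \<le> f (B n) + (\<Sum>k. f (D (k + n)))"
          by (rule order_trans[OF sub]) (intro add_left_mono csub)
        finally have 1: "f (X - C) \<le> f (B n) + (\<Sum>k. f (D (k + n)))" .
        have "f (B n) + f (X \<inter> C) \<le> f (B n \<union> (X \<inter> C))"
        proof (rule sep[OF e_pos[of n]], intro ballI)
          fix x y assume "x \<in> B n" "y \<in> X \<inter> C"
          then show "e n \<le> dist x y"
            using infdist_le[of y C x] by (auto simp: B_def)
        qed
        also have "\<dots> \<le> f X"
          by (rule mono) (auto simp: B_def)
        finally have 2: "f (B n) + f (X \<inter> C) \<le> f X" .
        have S: "S = (\<Sum>k. f (D (k + n))) + (\<Sum>k<n. f (D k))"
          unfolding S_def by (rule suminf_offset) simp
        have "f (X - C) + f (X \<inter> C) + (\<Sum>k<n. f (D k))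
            \<le> f (B n) + (\<Sum>k. f (D (k + n))) + f (X \<inter> C) + (\<Sum>k<n. f (D k))"
          by (intro add_right_mono 1)
        also have "\<dots> = (f (B n) + f (X \<inter> C)) + ((\<Sum>k. f (D (k + n))) + (\<Sum>k<n. f (D k)))"
          by (simp only: ac_simps)
        also have "\<dots> \<le> f X + S"
          unfolding S by (intro add_right_mono 2)
        finally show ?thesis .
      qed
      have "f (X - C) + f (X \<inter> C) + S \<le> f X + S"
      proof (rule LIMSEQ_le_const2)
        show "(\<lambda>n. f (X - C) + f (X \<inter> C) + (\<Sum>k<n. f (D k)))
            \<longlonglongrightarrow> f (X - C) + f (X \<inter> C) + S"
          unfolding S_def by (rule tendsto_add[OF tendsto_const summable_LIMSEQ]) simp
      qed (use tail in blast)
      then show ?thesis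
        using S by (simp add: add.commute[of _ S] add.commute[of "f (X \<inter> C)"] less_top[symmetric])
    qed
  qed
  then show ?thesis
    using algebra.lambda_system_eq[OF algebra_Pow, of UNIV f] by simp
qed

lemma metric_outer_measure_space_borel:
  fixes f :: "'a::metric_space set \<Rightarrow> ennreal"
  assumes empty: "f {} = 0"
    and mono: "\<And>A B. A \<subseteq> B \<Longrightarrow> f A \<le> f B"
    and csub: "\<And>A :: nat \<Rightarrow> 'a set. f (\<Union>i. A i) \<le> (\<Sum>i. f (A i))"
    and sep: "\<And>A B d. 0 < d \<Longrightarrow> \<forall>x\<in>A. \<forall>y\<in>B. d \<le> dist x y \<Longrightarrow>
      f A + f B \<le> f (A \<union> B)"
  shows "measure_space UNIV (sets borel) f"
proof -
  let ?L = "lambda_system UNIV (Pow UNIV) f"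
  have oms: "outer_measure_space (Pow UNIV) f"
    by (simp add: outer_measure_space_def positive_def increasing_def countably_subadditive_def
        assms(1-3))
  have L: "measure_space UNIV ?L f"
    by (rule sigma_algebra.caratheodory_lemma[OF sigma_algebra_Pow oms])
  then have "sigma_algebra UNIV ?L"
    by (simp add: measure_space_def)
  moreover have "Collect closed \<subseteq> ?L"
  proof
    fix C :: "'a set" assume C: "C \<in> Collect closed"
    show "C \<in> ?L"
    proof (rule closed_in_lambda_system)
      show "f {} = 0" by (rule empty)
      show "f A \<le> f B" if "A \<subseteq> B" for A B by (rule mono[OF that])
      show "f (\<Union>i. A i) \<le> (\<Sum>i. f (A i))" for A :: "nat \<Rightarrow> 'a set" by (rule csub)
      show "f A + f B \<le> f (A \<union> B)" if "0 < d" "\<forall>x\<in>A. \<forall>y\<in>B. d \<le> dist x y" for A B d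
        by (rule sep[OF that])
      show "closed C" using C by simp
    qed
  qed
  ultimately have "sigma_sets UNIV (Collect closed) \<subseteq> ?L"
    by (rule sigma_algebra.sigma_sets_subset)
  then have "sets borel \<subseteq> ?L"
    unfolding borel_eq_closed by simp
  moreover have "sigma_algebra UNIV (sets (borel :: 'a measure))"
    using sets.sigma_algebra_axioms[of "borel :: 'a measure"] by simp
  ultimately show ?thesis
    using measure_down[OF L] by blast
qed

section \<open>Hausdorff measures\<close>

definition hausdorff_weight :: "nat \<Rightarrow> 'a::metric_space set \<Rightarrow> ennreal" where
  "hausdorff_weight n U =
    (if U = {} then 0 else ennreal (unit_ball_vol (real n) * (diameter U / 2) ^ n))"

lemma hausdorff_weight_empty [simp]: "hausdorff_weight n {} = 0"
  by (simp add: hausdorff_weight_def)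

definition small_covers :: "real \<Rightarrow> 'a::metric_space set \<Rightarrow> (nat \<Rightarrow> 'a set) set" where
  "small_covers \<delta> A = {U. (\<forall>i. bounded (U i) \<and> diameter (U i) \<le> \<delta>) \<and> A \<subseteq> (\<Union>i. U i)}"

lemma hausdorff_premeasure_eq:
  "hausdorff_premeasure n \<delta> A = (INF U\<in>small_covers \<delta> A. \<Sum>i. hausdorff_weight n (U i))"
  by (simp add: hausdorff_premeasure_def small_covers_def hausdorff_weight_def)

lemma hausdorff_premeasure_le:
  "U \<in> small_covers \<delta> A \<Longrightarrow> hausdorff_premeasure n \<delta> A \<le> (\<Sum>i. hausdorff_weight n (U i))"
  unfolding hausdorff_premeasure_eq by (rule INF_lower)

lemma hausdorff_premeasure_mono: "A \<subseteq> B \<Longrightarrow> hausdorff_premeasure n \<delta> A \<le> hausdorff_premeasure n \<delta> B"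
  unfolding hausdorff_premeasure_eq by (rule INF_superset_mono) (auto simp: small_covers_def)

lemma hausdorff_premeasure_antimono:
  "\<delta> \<le> \<epsilon> \<Longrightarrow> hausdorff_premeasure n \<epsilon> A \<le> hausdorff_premeasure n \<delta> A"
  unfolding hausdorff_premeasure_eq
  by (rule INF_superset_mono) (auto simp: small_covers_def intro: order_trans)

lemma hausdorff_premeasure_le_outer:
  "0 < \<delta> \<Longrightarrow> hausdorff_premeasure n \<delta> A \<le> hausdorff_outer_measure n A"
  unfolding hausdorff_outer_measure_def by (rule SUP_upper) simp

lemma hausdorff_premeasure_countably_subadditive:
  assumes "0 < \<delta>"
  shows "hausdorff_premeasure n \<delta> (\<Union>i. A i) \<le> (\<Sum>i. hausdorff_premeasure n \<delta> (A i))"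
proof (rule ennreal_le_epsilon)
  fix e :: real assume e: "0 < e" and "(\<Sum>i. hausdorff_premeasure n \<delta> (A i)) < top"
  then have less: "hausdorff_premeasure n \<delta> (A i) < hausdorff_premeasure n \<delta> (A i) + e * (1/2)^Suc i" for i
    by (auto simp add: less_top dest!: ennreal_suminf_lessD)
  have "\<exists>U\<in>small_covers \<delta> (A i). (\<Sum>j. hausdorff_weight n (U j))
      < hausdorff_premeasure n \<delta> (A i) + e * (1/2)^Suc i" for i
    using less[of i] unfolding hausdorff_premeasure_eq by (simp only: INF_less_iff)
  then have "\<forall>i. \<exists>U. U \<in> small_covers \<delta> (A i) \<and>
      (\<Sum>j. hausdorff_weight n (U j)) < hausdorff_premeasure n \<delta> (A i) + e * (1/2)^Suc i"
    by blast
  from choice[OF this] obtain U where U: "U i \<in> small_covers \<delta> (A i)"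
    and Ule: "(\<Sum>j. hausdorff_weight n (U i j)) < hausdorff_premeasure n \<delta> (A i) + e * (1/2)^Suc i" for i
    by blast
  define C where "C = case_prod U o prod_decode"
  have bdC: "bounded (C k) \<and> diameter (C k) \<le> \<delta>" for k
    using U by (simp add: C_def small_covers_def split_beta)
  have "A i \<subseteq> (\<Union>k. C k)" for i
  proof
    fix x assume "x \<in> A i"
    then obtain j where "x \<in> U i j"
      using U[of i] by (auto simp: small_covers_def)
    then have "x \<in> C (prod_encode (i, j))"
      by (simp add: C_def)
    then show "x \<in> (\<Union>k. C k)" by blast
  qed
  then have "C \<in> small_covers \<delta> (\<Union>i. A i)"
    using bdC by (auto simp: small_covers_def)
  then have "hausdorff_premeasure n \<delta> (\<Union>i. A i) \<le> (\<Sum>k. hausdorff_weight n (C k))"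
    by (rule hausdorff_premeasure_le)
  also have "\<dots> = (\<Sum>i. \<Sum>j. hausdorff_weight n (U i j))"
    using suminf_ennreal_2dimen[of "\<lambda>i. \<Sum>j. hausdorff_weight n (U i j)"
        "\<lambda>p. hausdorff_weight n (case_prod U p)"]
    by (simp add: C_def)
  also have "\<dots> \<le> (\<Sum>i. hausdorff_premeasure n \<delta> (A i) + e * (1/2) ^ Suc i)"
    using less_imp_le[OF Ule] by (intro suminf_le) auto
  also have "... = (\<Sum>i. hausdorff_premeasure n \<delta> (A i)) + (\<Sum>i. ennreal e * ennreal ((1/2) ^ Suc i))"
    using e by (subst suminf_add[symmetric])
               (auto simp del: ennreal_suminf_cmult simp add: ennreal_mult[symmetric])
  also have "\<dots> = (\<Sum>i. hausdorff_premeasure n \<delta> (A i)) + e"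
    unfolding ennreal_suminf_cmult
    by (subst suminf_ennreal_eq[OF zero_le_power power_half_series]) auto
  finally show "hausdorff_premeasure n \<delta> (\<Union>i. A i) \<le> (\<Sum>i. hausdorff_premeasure n \<delta> (A i)) + e" .
qed

lemma hausdorff_outer_measure_empty [simp]: "hausdorff_outer_measure n ({} :: 'a::metric_space set) = 0"
proof -
  have "hausdorff_premeasure n \<delta> ({} :: 'a set) = 0" if "0 < \<delta>" for \<delta>
    using hausdorff_premeasure_le[of "\<lambda>_. {}" \<delta> "{} :: 'a set" n] that
    by (simp add: small_covers_def)
  then show ?thesis
    by (simp add: hausdorff_outer_measure_def)
qed

lemma hausdorff_outer_measure_mono:
  "A \<subseteq> B \<Longrightarrow> hausdorff_outer_measure n A \<le> hausdorff_outer_measure n B"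
  unfolding hausdorff_outer_measure_def
  by (intro SUP_mono) (auto intro: hausdorff_premeasure_mono)

lemma hausdorff_outer_measure_countably_subadditive:
  "hausdorff_outer_measure n (\<Union>i. A i) \<le> (\<Sum>i. hausdorff_outer_measure n (A i))"
  unfolding hausdorff_outer_measure_def[of n "\<Union>i. A i"]
proof (rule SUP_least)
  fix \<delta> :: real assume "\<delta> \<in> {0<..}"
  then have "0 < \<delta>" by simp
  then show "hausdorff_premeasure n \<delta> (\<Union>i. A i) \<le> (\<Sum>i. hausdorff_outer_measure n (A i))"
    by (intro order_trans[OF hausdorff_premeasure_countably_subadditive] suminf_le
        hausdorff_premeasure_le_outer) auto
qed

text \<open>
  A covering set of diameter at most \<open>\<delta> < d\<close> cannot meet both A and B, so a cover of the union splits
  into covers of A and of B.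
\<close>

lemma hausdorff_premeasure_separated:
  assumes "\<delta> < d" and sep: "\<forall>x\<in>A. \<forall>y\<in>B. d \<le> dist x y"
  shows "hausdorff_premeasure n \<delta> A + hausdorff_premeasure n \<delta> B \<le> hausdorff_premeasure n \<delta> (A \<union> B)"
  unfolding hausdorff_premeasure_eq[of n \<delta> "A \<union> B"]
proof (rule INF_greatest)
  fix U assume U: "U \<in> small_covers \<delta> (A \<union> B)"
  have \<delta>: "0 \<le> \<delta>"
    using U diameter_ge_0[of "U 0"] order_trans unfolding small_covers_def by blast
  define V where "V S i = (if U i \<inter> S = {} then {} else U i)" for S i
  have V: "V S \<in> small_covers \<delta> S" if sub: "S \<subseteq> A \<union> B" for S
  proof -
    have "bounded (V S i) \<and> diameter (V S i) \<le> \<delta>" for i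
      using U \<delta> by (simp add: small_covers_def V_def)
    moreover have "S \<subseteq> (\<Union>i. V S i)"
    proof
      fix x assume x: "x \<in> S"
      have "x \<in> (\<Union>i. U i)"
        using U sub x unfolding small_covers_def by blast
      then obtain i where "x \<in> U i" by blast
      then have "x \<in> V S i"
        using x by (auto simp: V_def)
      then show "x \<in> (\<Union>i. V S i)" by blast
    qed
    ultimately show ?thesis
      by (simp add: small_covers_def)
  qed
  have "hausdorff_weight n (V A i) + hausdorff_weight n (V B i) \<le> hausdorff_weight n (U i)" for i
  proof -
    have "U i \<inter> A = {} \<or> U i \<inter> B = {}"
    proof (rule ccontr)
      assume "\<not> ?thesis"
      then obtain x y where xy: "x \<in> U i" "x \<in> A" "y \<in> U i" "y \<in> B" by auto
      then have "dist x y \<le> \<delta>"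
        using diameter_bounded_bound[of "U i" x y] U unfolding small_covers_def
        by (metis (mono_tags, lifting) mem_Collect_eq order_trans)
      moreover have "d \<le> dist x y"
        using sep xy(2,4) by blast
      ultimately show False
        using \<open>\<delta> < d\<close> by linarith
    qed
    then have "V A i = {} \<or> V B i = {}"
      by (auto simp: V_def)
    moreover have "V S i = {} \<or> V S i = U i" for S
      by (simp add: V_def)
    ultimately show ?thesis
      by (metis add.left_neutral add.right_neutral hausdorff_weight_empty order_refl zero_le)
  qed
  then have "(\<Sum>i. hausdorff_weight n (V A i)) + (\<Sum>i. hausdorff_weight n (V B i))
      \<le> (\<Sum>i. hausdorff_weight n (U i))"
    by (simp add: suminf_add suminf_le)
  moreover have "hausdorff_premeasure n \<delta> A + hausdorff_premeasure n \<delta> B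
      \<le> (\<Sum>i. hausdorff_weight n (V A i)) + (\<Sum>i. hausdorff_weight n (V B i))"
    by (intro add_mono hausdorff_premeasure_le V) auto
  ultimately show "hausdorff_premeasure n \<delta> A + hausdorff_premeasure n \<delta> B
      \<le> (\<Sum>i. hausdorff_weight n (U i))"
    by (rule order_trans[rotated])
qed

lemma hausdorff_outer_measure_separated:
  assumes d: "0 < d" and sep: "\<forall>x\<in>A. \<forall>y\<in>B. d \<le> dist x y"
  shows "hausdorff_outer_measure n A + hausdorff_outer_measure n B \<le> hausdorff_outer_measure n (A \<union> B)"
proof -
  have "hausdorff_outer_measure n A + hausdorff_outer_measure n B
     = (SUP \<delta>\<in>{0<..}. hausdorff_premeasure n \<delta> A + hausdorff_premeasure n \<delta> B)"
    unfolding hausdorff_outer_measure_def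
  proof (rule SUP_add_directed_ennreal[symmetric])
    fix i j :: real assume "i \<in> {0<..}" "j \<in> {0<..}"
    then show "\<exists>k\<in>{0<..}. hausdorff_premeasure n i A + hausdorff_premeasure n j B
        \<le> hausdorff_premeasure n k A + hausdorff_premeasure n k B"
      by (intro bexI[of _ "min i j"] add_mono hausdorff_premeasure_antimono) auto
  qed
  also have "\<dots> \<le> hausdorff_outer_measure n (A \<union> B)"
  proof (rule SUP_least)
    fix \<delta> :: real assume "\<delta> \<in> {0<..}"
    then have \<delta>: "0 < min \<delta> (d / 2)" "min \<delta> (d / 2) < d" "min \<delta> (d / 2) \<le> \<delta>"
      using d by auto
    have "hausdorff_premeasure n \<delta> A + hausdorff_premeasure n \<delta> B
        \<le> hausdorff_premeasure n (min \<delta> (d / 2)) A + hausdorff_premeasure n (min \<delta> (d / 2)) B"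
      by (intro add_mono hausdorff_premeasure_antimono \<delta>(3))
    also have "\<dots> \<le> hausdorff_premeasure n (min \<delta> (d / 2)) (A \<union> B)"
      by (rule hausdorff_premeasure_separated[OF \<delta>(2) sep])
    also have "\<dots> \<le> hausdorff_outer_measure n (A \<union> B)"
      by (rule hausdorff_premeasure_le_outer[OF \<delta>(1)])
    finally show "hausdorff_premeasure n \<delta> A + hausdorff_premeasure n \<delta> B
        \<le> hausdorff_outer_measure n (A \<union> B)" .
  qed
  finally show ?thesis .
qed

lemma sets_hausdorff_measure [simp]: "sets (hausdorff_measure n) = sets borel"
  unfolding hausdorff_measure_def using sets.sigma_sets_eq[of borel] by simp

text \<open>
  This identity needs an argument because \<open>measure_of\<close> yields the zero measure unless the given
  function is a measure on the given sets.
\<close>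

lemma emeasure_hausdorff_measure:
  fixes A :: "'a::metric_space set"
  assumes "A \<in> sets borel"
  shows "emeasure (hausdorff_measure n) A = hausdorff_outer_measure n A"
proof -
  have "measure_space UNIV (sets borel) (hausdorff_outer_measure n :: 'a set \<Rightarrow> ennreal)"
  proof (rule metric_outer_measure_space_borel)
    fix A B :: "'a set" and d :: real
    assume "0 < d" "\<forall>x\<in>A. \<forall>y\<in>B. d \<le> dist x y"
    then show "hausdorff_outer_measure n A + hausdorff_outer_measure n B \<le> hausdorff_outer_measure n (A \<union> B)"
      by (rule hausdorff_outer_measure_separated)
  qed (simp_all add: hausdorff_outer_measure_mono hausdorff_outer_measure_countably_subadditive)
  then show ?thesis
    using assms unfolding hausdorff_measure_def
    by (intro emeasure_measure_of_sigma) (auto simp: measure_space_def)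
qed

lemma emeasure_hausdorff_measure_0_singleton: "emeasure (hausdorff_measure 0) {x :: 'a::metric_space} = 1"
proof -
  have "hausdorff_premeasure 0 \<delta> {x} = 1" if "0 < \<delta>" for \<delta>
  proof (rule antisym)
    have "hausdorff_premeasure 0 \<delta> {x}
        \<le> (\<Sum>i. hausdorff_weight 0 (if i = 0 then {x} else ({} :: 'a set)))"
      using that by (intro hausdorff_premeasure_le) (auto simp: small_covers_def)
    also have "\<dots> = (\<Sum>i\<in>{0::nat}. hausdorff_weight 0 (if i = 0 then {x} else ({} :: 'a set)))"
      by (rule suminf_finite) auto
    finally show "hausdorff_premeasure 0 \<delta> {x} \<le> 1" by (simp add: hausdorff_weight_def)
    show "1 \<le> hausdorff_premeasure 0 \<delta> {x}"
      unfolding hausdorff_premeasure_eq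
    proof (rule INF_greatest)
      fix U :: "nat \<Rightarrow> 'a set" assume "U \<in> small_covers \<delta> {x}"
      then obtain i where "x \<in> U i" by (auto simp: small_covers_def)
      then have "1 \<le> (\<Sum>j\<in>{i}. hausdorff_weight 0 (U j))" by (auto simp: hausdorff_weight_def)
      also have "\<dots> \<le> (\<Sum>j. hausdorff_weight 0 (U j))"
        by (rule sum_le_suminf) auto
      finally show "1 \<le> (\<Sum>j. hausdorff_weight 0 (U j))" .
    qed
  qed
  then have "hausdorff_outer_measure 0 {x} = (SUP \<delta>\<in>{0::real<..}. 1)"
    unfolding hausdorff_outer_measure_def by (intro SUP_cong) auto
  then have "hausdorff_outer_measure 0 {x} = 1"
    by simp
  then show ?thesis
    by (simp add: emeasure_hausdorff_measure)
qed

section \<open>Hausdorff measure along curves\<close>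

text \<open>
  A curve without self-intersections that is parametrized by arc length, in the metric form that
  Hausdorff measure sees: it is 1-Lipschitz, and for points that are close in space the chord is
  almost as long as the parameter interval. The last condition also makes the curve injective.
\<close>

locale arc_length_parametrization =
  fixes \<gamma> :: "real \<Rightarrow> 'a::metric_space" and a b :: real
  assumes le: "a \<le> b"
    and cont: "continuous_on UNIV \<gamma>"
    and dist_le: "\<And>s t. s \<in> {a..b} \<Longrightarrow> t \<in> {a..b} \<Longrightarrow> dist (\<gamma> s) (\<gamma> t) \<le> \<bar>s - t\<bar>"
    and dist_ge: "\<And>c. 0 < c \<Longrightarrow> c < 1 \<Longrightarrow> \<exists>\<delta>>0. \<forall>s\<in>{a..b}. \<forall>t\<in>{a..b}.
      dist (\<gamma> s) (\<gamma> t) \<le> \<delta> \<longrightarrow> c * \<bar>s - t\<bar> \<le> dist (\<gamma> s) (\<gamma> t)"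
begin

text \<open>
  If \<open>\<gamma> ` A\<close> is covered by small sets, then A is covered by their preimages, and the preimage of a set
  of diameter d lies in an interval of length \<open>d / c\<close>, where c < 1 is arbitrary.
\<close>

lemma hausdorff_ge:
  assumes A: "A \<in> sets borel" "A \<subseteq> {a..b}"
  shows "emeasure lborel A \<le> hausdorff_outer_measure 1 (\<gamma> ` A)"
proof -
  have "emeasure lborel A \<le> emeasure lborel {a..b}"
    using A by (intro emeasure_mono) auto
  then obtain m where m: "0 \<le> m" "emeasure lborel A = ennreal m"
    using le by (cases "emeasure lborel A") (auto simp: top_unique)
  have le_outer: "ennreal (c * m) \<le> hausdorff_outer_measure 1 (\<gamma> ` A)" if c: "0 < c" "c < 1" for c
  proof -
    obtain \<delta> where \<delta>: "0 < \<delta>" "\<And>s t. s \<in> {a..b} \<Longrightarrow> t \<in> {a..b} \<Longrightarrow>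
        dist (\<gamma> s) (\<gamma> t) \<le> \<delta> \<Longrightarrow> c * \<bar>s - t\<bar> \<le> dist (\<gamma> s) (\<gamma> t)"
      using dist_ge[OF c] by auto
    have "ennreal (c * m) \<le> hausdorff_premeasure 1 \<delta> (\<gamma> ` A)"
      unfolding hausdorff_premeasure_eq
    proof (rule INF_greatest)
      fix U assume "U \<in> small_covers \<delta> (\<gamma> ` A)"
      then have U: "bounded (U i)" "diameter (U i) \<le> \<delta>" and cover: "\<gamma> ` A \<subseteq> (\<Union>i. U i)" for i
        by (auto simp: small_covers_def)
      define V where "V i = {t \<in> {a..b}. \<gamma> t \<in> U i}" for i
      define I where "I i = (if V i = {} then {} else {Inf (V i)..Sup (V i)})" for i
      have bdd: "bdd_above (V i)" "bdd_below (V i)" for i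
        by (auto simp: V_def intro: bdd_aboveI[of _ b] bdd_belowI[of _ a])
      have VI: "V i \<subseteq> I i" for i
        by (auto simp: I_def intro!: cInf_lower cSup_upper bdd)
      have "A \<subseteq> (\<Union>i. V i)"
      proof
        fix t assume t: "t \<in> A"
        then obtain i where "\<gamma> t \<in> U i"
          using cover by blast
        then show "t \<in> (\<Union>i. V i)"
          using t A(2) unfolding V_def by blast
      qed
      also have "\<dots> \<subseteq> (\<Union>i. I i)"
        by (rule UN_mono[OF subset_refl VI])
      finally have AI: "A \<subseteq> (\<Union>i. I i)" .
      have weight: "ennreal c * emeasure lborel (I i) \<le> hausdorff_weight 1 (U i)" for i
      proof (cases "V i = {}")
        case True
        then show ?thesis by (simp add: I_def)
      next
        case False
        then have ne: "U i \<noteq> {}" by (auto simp: V_def)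
        have close: "c * (s - t) \<le> diameter (U i)" if "s \<in> V i" "t \<in> V i" for s t
        proof -
          have "dist (\<gamma> s) (\<gamma> t) \<le> diameter (U i)"
            using that by (intro diameter_bounded_bound U) (auto simp: V_def)
          moreover from this have "c * \<bar>s - t\<bar> \<le> dist (\<gamma> s) (\<gamma> t)"
            using that U(2)[of i] by (intro \<delta>(2)) (auto simp: V_def)
          moreover have "c * (s - t) \<le> c * \<bar>s - t\<bar>"
            using c by (intro mult_left_mono) auto
          ultimately show ?thesis by linarith
        qed
        have "Sup (V i) \<le> t + diameter (U i) / c" if "t \<in> V i" for t
          using close[OF _ that] c False by (intro cSup_least) (auto simp: field_simps)
        then have "Sup (V i) - diameter (U i) / c \<le> Inf (V i)"
          using False by (intro cInf_greatest) (auto simp: algebra_simps)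
        then have "c * (Sup (V i) - Inf (V i)) \<le> diameter (U i)"
          using c by (simp add: field_simps)
        moreover obtain t where t: "t \<in> V i" using False by auto
        have "Inf (V i) \<le> Sup (V i)"
          using cInf_lower[OF t bdd(2)] cSup_upper[OF t bdd(1)] by linarith
        ultimately show ?thesis
          using False ne c by (simp add: I_def hausdorff_weight_def ennreal_mult[symmetric] ennreal_leI)
      qed
      have "ennreal (c * m) = ennreal c * emeasure lborel A"
        using c m by (simp add: ennreal_mult)
      also have "\<dots> \<le> ennreal c * (\<Sum>i. emeasure lborel (I i))"
      proof (rule mult_left_mono)
        have "emeasure lborel A \<le> emeasure lborel (\<Union>i. I i)"
          using AI by (intro emeasure_mono sets.countable_UN) (auto simp: I_def)
        also have "\<dots> \<le> (\<Sum>i. emeasure lborel (I i))"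
          by (rule emeasure_subadditive_countably) (auto simp: I_def)
        finally show "emeasure lborel A \<le> (\<Sum>i. emeasure lborel (I i))" .
      qed simp
      also have "\<dots> = (\<Sum>i. ennreal c * emeasure lborel (I i))"
        by simp
      also have "\<dots> \<le> (\<Sum>i. hausdorff_weight 1 (U i))"
        by (rule suminf_le[OF weight]) simp_all
      finally show "ennreal (c * m) \<le> (\<Sum>i. hausdorff_weight 1 (U i))" .
    qed
    also have "\<dots> \<le> hausdorff_outer_measure 1 (\<gamma> ` A)"
      using \<delta>(1) by (rule hausdorff_premeasure_le_outer)
    finally show ?thesis .
  qed
  show ?thesis
  proof (cases "hausdorff_outer_measure 1 (\<gamma> ` A)")
    case (real h)
    have "c * m \<le> h" if "0 < c" "c < 1" for c
      using le_outer[OF that] real that m by simp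
    then have "m \<le> h"
      by (rule field_le_mult_one_interval)
    then show ?thesis
      unfolding real m by (rule ennreal_leI)
  qed simp
qed

text \<open>
  Cut the parameter interval into n equal pieces: their images have diameter at most \<open>(b - a) / n\<close>.
\<close>

lemma hausdorff_total_le: "hausdorff_outer_measure 1 (\<gamma> ` {a..b}) \<le> ennreal (b - a)"
  unfolding hausdorff_outer_measure_def
proof (rule SUP_least)
  fix \<delta> :: real assume "\<delta> \<in> {0<..}"
  then have \<delta>: "0 < \<delta>" by simp
  obtain n where n: "(b - a) / \<delta> < real n"
    using reals_Archimedean2 by blast
  moreover have "0 \<le> (b - a) / \<delta>"
    using le \<delta> by simp
  ultimately have n0: "0 < real n" by linarith
  define h where "h = (b - a) / real n"
  have h: "0 \<le> h" "h \<le> \<delta>" "real n * h = b - a"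
    using le n n0 \<delta> by (auto simp: h_def field_simps)
  define J where "J i = {a + real i * h..a + real (Suc i) * h}" for i
  define U where "U i = (if i < n then \<gamma> ` J i else {})" for i
  have J: "J i \<subseteq> {a..b}" if "i < n" for i
  proof -
    have "real (Suc i) * h \<le> real n * h"
      using that h by (intro mult_right_mono) auto
    then show ?thesis
      using h by (auto simp: J_def)
  qed
  have dist: "dist (\<gamma> s) (\<gamma> t) \<le> h" if "i < n" "s \<in> J i" "t \<in> J i" for i s t
  proof -
    have "dist (\<gamma> s) (\<gamma> t) \<le> \<bar>s - t\<bar>"
      using J[OF that(1)] that by (intro dist_le) auto
    also have "\<dots> \<le> h"
      using that by (auto simp: J_def algebra_simps)
    finally show ?thesis .
  qed
  have U: "bounded (U i)" "diameter (U i) \<le> h" for i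
  proof -
    have le_h: "dist x y \<le> h" if "x \<in> U i" "y \<in> U i" for x y
      using that dist by (auto simp: U_def split: if_splits)
    then show "diameter (U i) \<le> h"
      using h(1) by (auto simp: diameter_def intro!: cSUP_least)
    show "bounded (U i)"
      using le_h
      by (meson bounded_def bounded_empty equals0I)
  qed
  have "{a..b} \<subseteq> (\<Union>i<n. J i)"
  proof
    fix t assume t: "t \<in> {a..b}"
    show "t \<in> (\<Union>i<n. J i)"
    proof (cases "h = 0 \<or> t = a")
      case True
      then have "t \<in> J 0" using t h by (auto simp: J_def)
      then show ?thesis using n0 by auto
    next
      case False
      then have h0: "0 < h" using h by simp
      define i where "i = nat \<lceil>(t - a) / h\<rceil> - 1"
      have "0 < (t - a) / h"
        using False t h0 by simp
      then have i: "real i < (t - a) / h" "(t - a) / h \<le> real (Suc i)"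
        unfolding i_def by linarith+
      have "(t - a) / h \<le> real n"
        using t h0 h by (simp add: field_simps)
      then have "i < n" using i by linarith
      moreover have "t \<in> J i"
        using i h0 by (auto simp: J_def field_simps)
      ultimately show ?thesis by auto
    qed
  qed
  have "U \<in> small_covers \<delta> (\<gamma> ` {a..b})"
  proof -
    have "bounded (U i) \<and> diameter (U i) \<le> \<delta>" for i
      using U[of i] h(2) by linarith
    moreover have "\<gamma> ` {a..b} \<subseteq> (\<Union>i. U i)"
      using \<open>{a..b} \<subseteq> (\<Union>i<n. J i)\<close> unfolding U_def by fastforce
    ultimately show ?thesis
      by (simp add: small_covers_def)
  qed
  then have "hausdorff_premeasure 1 \<delta> (\<gamma> ` {a..b}) \<le> (\<Sum>i. hausdorff_weight 1 (U i))"
    by (rule hausdorff_premeasure_le)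
  also have "\<dots> = (\<Sum>i<n. hausdorff_weight 1 (U i))"
    by (rule suminf_finite) (auto simp: U_def)
  also have "\<dots> \<le> (\<Sum>i<n. ennreal h)"
    by (intro sum_mono) (use U in \<open>auto simp: hausdorff_weight_def intro: ennreal_leI\<close>)
  also have "\<dots> = ennreal (b - a)"
    using h by (simp add: ennreal_mult[symmetric] ennreal_of_nat_eq_real_of_nat)
  finally show "hausdorff_premeasure 1 \<delta> (\<gamma> ` {a..b}) \<le> ennreal (b - a)" .
qed

lemma compact_trace: "compact (\<gamma> ` {a..b})"
  by (intro compact_continuous_image continuous_on_subset[OF cont]) auto

text \<open>
  Hausdorff measure is at least Lebesgue measure of the preimage, for B and for its complement, and the
  two lower bounds add up to the upper bound for the whole curve. So both are equalities.
\<close>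

lemma emeasure_hausdorff_trace:
  assumes B: "B \<in> sets borel"
  shows "emeasure (hausdorff_measure 1) (B \<inter> \<gamma> ` {a..b}) = emeasure lborel (\<gamma> -` B \<inter> {a..b})"
proof -
  let ?C = "\<gamma> ` {a..b}"
  have C: "?C \<in> sets borel"
    using compact_trace by (simp add: borel_compact)
  have meas: "\<gamma> -` B \<in> sets borel" if "B \<in> sets borel" for B
    using measurable_sets[OF borel_measurable_continuous_onI[OF cont] that] by simp
  have ge: "emeasure lborel (\<gamma> -` B \<inter> {a..b}) \<le> emeasure (hausdorff_measure 1) (B \<inter> ?C)"
    if B: "B \<in> sets borel" for B
  proof -
    have "emeasure lborel (\<gamma> -` B \<inter> {a..b}) \<le> hausdorff_outer_measure 1 (\<gamma> ` (\<gamma> -` B \<inter> {a..b}))"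
      using meas[OF B] by (intro hausdorff_ge) auto
    also have "\<gamma> ` (\<gamma> -` B \<inter> {a..b}) = B \<inter> ?C"
      by auto
    finally show ?thesis
      using B C by (simp add: emeasure_hausdorff_measure)
  qed
  have "emeasure (hausdorff_measure 1) (B \<inter> ?C) + emeasure (hausdorff_measure 1) (- B \<inter> ?C)
      = emeasure (hausdorff_measure 1) ((B \<inter> ?C) \<union> (- B \<inter> ?C))"
    using B C by (intro plus_emeasure) auto
  also have "(B \<inter> ?C) \<union> (- B \<inter> ?C) = ?C" by auto
  also have "emeasure (hausdorff_measure 1) ?C \<le> ennreal (b - a)"
    using hausdorff_total_le C by (simp add: emeasure_hausdorff_measure)
  also have "ennreal (b - a) = emeasure lborel ((\<gamma> -` B \<inter> {a..b}) \<union> (\<gamma> -` (- B) \<inter> {a..b}))"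
  proof -
    have "(\<gamma> -` B \<inter> {a..b}) \<union> (\<gamma> -` (- B) \<inter> {a..b}) = {a..b}" by auto
    then show ?thesis using le by simp
  qed
  also have "\<dots> = emeasure lborel (\<gamma> -` B \<inter> {a..b}) + emeasure lborel (\<gamma> -` (- B) \<inter> {a..b})"
    using meas[OF B] meas[of "- B"] B by (intro plus_emeasure[symmetric]) auto
  also have "\<dots> \<le> emeasure lborel (\<gamma> -` B \<inter> {a..b}) + emeasure (hausdorff_measure 1) (- B \<inter> ?C)"
    using B by (intro add_left_mono ge) auto
  finally have "emeasure (hausdorff_measure 1) (B \<inter> ?C) + emeasure (hausdorff_measure 1) (- B \<inter> ?C)
     \<le> emeasure lborel (\<gamma> -` B \<inter> {a..b}) + emeasure (hausdorff_measure 1) (- B \<inter> ?C)" .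
  moreover have "emeasure (hausdorff_measure 1) (- B \<inter> ?C) \<noteq> top"
  proof -
    have "emeasure (hausdorff_measure 1) (- B \<inter> ?C) \<le> emeasure (hausdorff_measure 1) ?C"
      using C by (intro emeasure_mono) auto
    also have "\<dots> \<le> ennreal (b - a)"
      using hausdorff_total_le C by (simp add: emeasure_hausdorff_measure)
    finally have "emeasure (hausdorff_measure 1) (- B \<inter> ?C) < top"
      by (rule le_less_trans) simp
    then show ?thesis by simp
  qed
  ultimately have "emeasure (hausdorff_measure 1) (B \<inter> ?C) \<le> emeasure lborel (\<gamma> -` B \<inter> {a..b})"
    by (simp add: add.commute[of _ "emeasure (hausdorff_measure 1) (- B \<inter> ?C)"]
        del: One_nat_def)
  then show ?thesis
    using ge[OF B] by (rule antisym)
qed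

lemma nn_integral_hausdorff_trace:
  assumes f: "f \<in> borel_measurable borel"
  shows "(\<integral>\<^sup>+x\<in>\<gamma> ` {a..b}. f x \<partial>hausdorff_measure 1) = (\<integral>\<^sup>+t\<in>{a..b}. f (\<gamma> t) \<partial>lborel)"
proof -
  let ?C = "\<gamma> ` {a..b}"
  have C: "?C \<in> sets borel"
    using compact_trace by (simp add: borel_compact)
  have \<gamma>: "\<gamma> \<in> borel_measurable borel"
    by (rule borel_measurable_continuous_onI[OF cont])
  have "density (hausdorff_measure 1) (indicator ?C)
      = distr (density lborel (indicator {a..b})) borel \<gamma>"
  proof (rule measure_eqI)
    fix B assume "B \<in> sets (density (hausdorff_measure 1) (indicator ?C))"
    then have B: "B \<in> sets borel" by simp
    have "emeasure (density (hausdorff_measure 1) (indicator ?C)) B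
        = emeasure (hausdorff_measure 1) (B \<inter> ?C)"
      using B C by (simp add: emeasure_restricted Int_commute)
    also have "\<dots> = emeasure lborel (\<gamma> -` B \<inter> {a..b})"
      by (rule emeasure_hausdorff_trace[OF B])
    also have "\<dots> = emeasure (distr (density lborel (indicator {a..b})) borel \<gamma>) B"
      using B \<gamma> measurable_sets[OF \<gamma> B]
      by (simp add: emeasure_distr emeasure_restricted Int_commute)
    finally show "emeasure (density (hausdorff_measure 1) (indicator ?C)) B
        = emeasure (distr (density lborel (indicator {a..b})) borel \<gamma>) B" .
  qed simp
  then have "(\<integral>\<^sup>+x. f x \<partial>density (hausdorff_measure 1) (indicator ?C))
      = (\<integral>\<^sup>+x. f x \<partial>distr (density lborel (indicator {a..b})) borel \<gamma>)"
    by simp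
  moreover have "(\<integral>\<^sup>+x. f x \<partial>density (hausdorff_measure 1) (indicator ?C))
      = (\<integral>\<^sup>+x. indicator ?C x * f x \<partial>hausdorff_measure 1)"
  proof (rule nn_integral_density)
    show "indicator ?C \<in> borel_measurable (hausdorff_measure 1)"
      by (rule borel_measurable_indicator) (use C in simp)
    show "f \<in> borel_measurable (hausdorff_measure 1)"
      unfolding measurable_cong_sets[OF sets_hausdorff_measure refl] by (rule f)
  qed
  moreover have "(\<integral>\<^sup>+x. f x \<partial>distr (density lborel (indicator {a..b})) borel \<gamma>)
      = (\<integral>\<^sup>+t. indicator {a..b} t * f (\<gamma> t) \<partial>lborel)"
    using \<gamma> f by (subst nn_integral_distr, simp_all) (subst nn_integral_density, simp_all)
  ultimately show ?thesis
    by (simp only: mult.commute)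
qed

end

section \<open>The oriented plane\<close>

lemma inner_plane: "u \<bullet> v = u $ 1 * v $ 1 + u $ 2 * v $ 2" for u v :: plane
  by (simp add: inner_vec_def sum_2)

lemma plane_eq_iff: "u = v \<longleftrightarrow> u $ 1 = v $ 1 \<and> u $ 2 = v $ 2" for u v :: plane
  by (simp add: vec_eq_iff forall_2)

lemma rot_nth [simp]: "rot u $ 1 = - (u $ 2)" "rot u $ 2 = u $ 1"
  by (simp_all add: rot_def)

lemma rot_inner_rot [simp]: "rot u \<bullet> rot v = u \<bullet> v"
  by (simp add: inner_plane)

lemma norm_rot [simp]: "norm (rot u) = norm u"
  by (simp add: norm_eq_sqrt_inner)

lemma inner_rot_self [simp]: "u \<bullet> rot u = 0" "rot u \<bullet> u = 0"
  by (simp_all add: inner_plane)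

lemma inner_rot_swap: "v \<bullet> rot u = - (u \<bullet> rot v)"
  by (simp add: inner_plane)

lemma rot_rot [simp]: "rot (rot u) = - u"
  by (simp add: plane_eq_iff)

lemma rot_eq_0_iff [simp]: "rot u = 0 \<longleftrightarrow> u = 0"
  by (metis norm_eq_zero norm_rot)

lemma rot_scaleR [simp]: "rot (c *\<^sub>R u) = c *\<^sub>R rot u"
  by (simp add: plane_eq_iff)

lemma rot_minus [simp]: "rot (- u) = - rot u"
  by (simp add: plane_eq_iff)

lemma norm_1_plane: "norm u = 1 \<longleftrightarrow> (u $ 1)\<^sup>2 + (u $ 2)\<^sup>2 = 1" for u :: plane
  by (simp add: norm_eq_1 inner_plane power2_eq_square)

lemma unit_frame_decomposition:
  assumes "norm u = 1"
  shows "x = (u \<bullet> x) *\<^sub>R u + (rot u \<bullet> x) *\<^sub>R rot u"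
proof -
  have u: "(u $ 1)\<^sup>2 + (u $ 2)\<^sup>2 = 1"
    using assms by (simp add: norm_1_plane)
  have "x $ 1 = ((u $ 1)\<^sup>2 + (u $ 2)\<^sup>2) * x $ 1" "x $ 2 = ((u $ 1)\<^sup>2 + (u $ 2)\<^sup>2) * x $ 2"
    by (simp_all add: u)
  then show ?thesis
    by (simp add: plane_eq_iff inner_plane power2_eq_square algebra_simps)
qed

lemma unit_parallel_cases:
  assumes "norm u = 1" "norm v = 1" "v \<bullet> rot u = 0"
  shows "v = u \<or> v = - u"
proof -
  have v: "v = (u \<bullet> v) *\<^sub>R u"
    using unit_frame_decomposition[OF assms(1), of v] assms(3) by (simp add: inner_commute)
  then have "\<bar>u \<bullet> v\<bar> = 1"
    using assms by (metis mult.right_neutral norm_scaleR real_norm_def)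
  then have "u \<bullet> v = 1 \<or> u \<bullet> v = -1" by linarith
  then show ?thesis using v by auto
qed

definition unit_vec :: "real \<Rightarrow> plane" where
  "unit_vec \<theta> = vector [cos \<theta>, sin \<theta>]"

lemma unit_vec_nth [simp]: "unit_vec \<theta> $ 1 = cos \<theta>" "unit_vec \<theta> $ 2 = sin \<theta>"
  by (simp_all add: unit_vec_def)

lemma norm_unit_vec [simp]: "norm (unit_vec \<theta>) = 1"
  by (simp add: norm_1_plane)

lemma unit_vec_inner_rot: "unit_vec \<theta> \<bullet> rot (unit_vec \<phi>) = sin (\<theta> - \<phi>)"
  by (simp add: inner_plane sin_diff)

lemma continuous_on_unit_vec: "continuous_on S unit_vec"
proof -
  have "continuous_on S (\<lambda>\<theta>. \<chi> i. unit_vec \<theta> $ i)"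
  proof (rule continuous_on_vec_lambda)
    fix i :: 2
    show "continuous_on S (\<lambda>\<theta>. unit_vec \<theta> $ i)"
      using exhaust_2[of i]
      by (elim disjE) (simp_all add: continuous_on_cos continuous_on_sin continuous_on_id)
  qed
  then show ?thesis by simp
qed

lemma unit_vec_from:
  assumes "norm u = 1"
  obtains \<theta> where "0 \<le> \<theta>" "\<theta> < 2 * pi" "u = unit_vec (\<alpha> + \<theta>)"
proof -
  let ?e = "unit_vec \<alpha>"
  have u: "u = (?e \<bullet> u) *\<^sub>R ?e + (rot ?e \<bullet> u) *\<^sub>R rot ?e"
    by (rule unit_frame_decomposition) simp
  have "u \<bullet> u = (?e \<bullet> u)\<^sup>2 + (rot ?e \<bullet> u)\<^sup>2"
    by (subst (1) u) (simp add: inner_add_left power2_eq_square)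
  moreover have "u \<bullet> u = 1"
    using assms by (simp add: norm_eq_1)
  ultimately have "(?e \<bullet> u)\<^sup>2 + (rot ?e \<bullet> u)\<^sup>2 = 1" by simp
  then obtain \<theta> where "0 \<le> \<theta>" "\<theta> < 2 * pi" "?e \<bullet> u = cos \<theta>" "rot ?e \<bullet> u = sin \<theta>"
    using sincos_total_2pi by metis
  moreover from this have "u = unit_vec (\<alpha> + \<theta>)"
    using u by (simp add: plane_eq_iff cos_add sin_add algebra_simps)
  ultimately show ?thesis using that by blast
qed

lemma linear_rot: "linear rot"
  by (intro linearI) (simp_all add: plane_eq_iff)

lemma continuous_on_rot: "continuous_on S f \<Longrightarrow> continuous_on S (\<lambda>z. rot (f z))"
  using linear_rot
  by (auto simp: linear_conv_bounded_linear intro: bounded_linear.continuous_on)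

section \<open>Segments and circular arcs\<close>

lemma arc_length_parametrization_line:
  fixes p w :: "'a::real_normed_vector"
  assumes "norm w = 1" "a \<le> b"
  shows "arc_length_parametrization (\<lambda>t. p + t *\<^sub>R w) a b"
proof -
  have dist: "dist (p + s *\<^sub>R w) (p + t *\<^sub>R w) = \<bar>s - t\<bar>" for s t
    using assms(1) by (simp add: dist_norm scaleR_left_diff_distrib[symmetric])
  show ?thesis
  proof
    show "continuous_on UNIV (\<lambda>t. p + t *\<^sub>R w)" by (intro continuous_intros)
    show "\<exists>\<delta>>0. \<forall>s\<in>{a..b}. \<forall>t\<in>{a..b}. dist (p + s *\<^sub>R w) (p + t *\<^sub>R w) \<le> \<delta> \<longrightarrow>
        c * \<bar>s - t\<bar> \<le> dist (p + s *\<^sub>R w) (p + t *\<^sub>R w)" if "0 < c" "c < 1" for c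
      using that assms(1) by (intro exI[of _ 1]) (simp add: dist mult_left_le_one_le)
  qed (use assms dist in auto)
qed

lemma dist_unit_vec: "dist (unit_vec s) (unit_vec t) = 2 * \<bar>sin ((s - t) / 2)\<bar>"
proof (rule power2_eq_imp_eq)
  have "(dist (unit_vec s) (unit_vec t))\<^sup>2 = (cos s - cos t)\<^sup>2 + (sin s - sin t)\<^sup>2"
    by (simp only: dist_norm power2_norm_eq_inner inner_plane) (simp add: power2_eq_square)
  also have "\<dots> = 2 - 2 * cos (s - t)"
  proof -
    have "(cos s)\<^sup>2 + (sin s)\<^sup>2 = 1" "(cos t)\<^sup>2 + (sin t)\<^sup>2 = 1" by simp_all
    then show ?thesis by (simp add: power2_diff cos_diff algebra_simps)
  qed
  also have "\<dots> = 4 * (sin ((s - t) / 2))\<^sup>2"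
  proof -
    have "cos (2 * ((s - t) / 2)) = 1 - 2 * (sin ((s - t) / 2))\<^sup>2"
      by (rule cos_double_sin)
    moreover have "2 * ((s - t) / 2) = s - t" by simp
    ultimately have "cos (s - t) = 1 - 2 * (sin ((s - t) / 2))\<^sup>2" by (simp only:)
    then show ?thesis by linarith
  qed
  finally show "(dist (unit_vec s) (unit_vec t))\<^sup>2 = (2 * \<bar>sin ((s - t) / 2)\<bar>)\<^sup>2"
    by (simp add: power_mult_distrib)
qed auto

text \<open>
  This bounds a circular arc by its chord in \<open>arc_length_parametrization_circle\<close>.
\<close>

lemma x_cos_le_sin:
  fixes x :: real
  assumes "0 \<le> x" "x \<le> pi"
  shows "x * cos x \<le> sin x"
proof -
  have "sin 0 - 0 * cos 0 \<le> sin x - x * cos x"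
  proof (rule DERIV_nonneg_imp_nondecreasing[OF assms(1)])
    fix t assume t: "0 \<le> t" "t \<le> x"
    have "((\<lambda>t. sin t - t * cos t) has_real_derivative t * sin t) (at t)"
      by (auto intro!: derivative_eq_intros)
    moreover have "0 \<le> t * sin t"
      using t assms by (intro mult_nonneg_nonneg sin_ge_zero) auto
    ultimately show "\<exists>y. ((\<lambda>t. sin t - t * cos t) has_real_derivative y) (at t) \<and> 0 \<le> y"
      by blast
  qed
  then show ?thesis by simp
qed

text \<open>
  The chord of an arc of length 2x has length \<open>2 sin x\<close>, and \<open>x cos x \<le> sin x\<close>. For short chords,
  \<open>cos x\<close> is close to 1. The bound \<open>\<pi>\<close> on the arc length keeps x within \<open>\<pi> / 2\<close>, where the
  chord determines the arc.
\<close>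

lemma arc_length_parametrization_circle:
  assumes "a \<le> b" "b \<le> a + pi"
  shows "arc_length_parametrization unit_vec a b"
proof
  show "dist (unit_vec s) (unit_vec t) \<le> \<bar>s - t\<bar>" for s t
    using abs_sin_x_le_abs_x[of "(s - t) / 2"] by (simp add: dist_unit_vec)
  fix c :: real assume c: "0 < c" "c < 1"
  \<comment> \<open>A chord of length at most this has sin x at most this, and hence cos x at least c.\<close>
  define \<delta> where "\<delta> = sqrt (1 - c\<^sup>2)"
  have c2: "c\<^sup>2 < 1"
    using c by (simp add: abs_square_less_1)
  have "c * \<bar>s - t\<bar> \<le> dist (unit_vec s) (unit_vec t)"
    if st: "s \<in> {a..b}" "t \<in> {a..b}" and d: "dist (unit_vec s) (unit_vec t) \<le> \<delta>" for s t
  proof -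
    define x where "x = \<bar>s - t\<bar> / 2"
    have x: "0 \<le> x" "x \<le> pi / 2"
      using st assms by (auto simp: x_def)
    have sin: "0 \<le> sin x"
      using x by (intro sin_ge_zero) auto
    have cos: "0 \<le> cos x"
      using x by (intro cos_ge_zero) auto
    have "\<bar>sin ((s - t) / 2)\<bar> = sin x"
    proof -
      have "(s - t) / 2 = x \<or> (s - t) / 2 = - x"
        unfolding x_def by linarith
      then show ?thesis using sin by auto
    qed
    then have dist: "dist (unit_vec s) (unit_vec t) = 2 * sin x"
      by (simp add: dist_unit_vec)
    then have "sin x \<le> \<delta>" using d sin by linarith
    then have "(sin x)\<^sup>2 \<le> \<delta>\<^sup>2"
      using sin by (rule power_mono)
    then have "c\<^sup>2 \<le> (cos x)\<^sup>2"
      using c2 by (simp add: \<delta>_def cos_squared_eq)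
    then have "c \<le> cos x"
      using cos by (rule power2_le_imp_le)
    then have "x * c \<le> x * cos x"
      using x by (intro mult_left_mono) auto
    also have "\<dots> \<le> sin x"
      using x by (intro x_cos_le_sin) auto
    finally show ?thesis
      by (simp add: dist x_def mult.commute)
  qed
  moreover have "0 < \<delta>"
    using c2 by (simp add: \<delta>_def)
  ultimately show "\<exists>\<delta>>0. \<forall>s\<in>{a..b}. \<forall>t\<in>{a..b}. dist (unit_vec s) (unit_vec t) \<le> \<delta> \<longrightarrow>
      c * \<bar>s - t\<bar> \<le> dist (unit_vec s) (unit_vec t)"
    by blast
qed (use assms continuous_on_unit_vec in auto)

section \<open>Polygons and their normal bundle\<close>

text \<open>
  The edge with outer unit normal u, traversed from a to b with the polygon on the left.
\<close>

definition oriented_edge :: "plane set \<Rightarrow> plane \<Rightarrow> plane \<Rightarrow> plane \<Rightarrow> bool" where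
  "oriented_edge P u a b \<longleftrightarrow> norm u = 1 \<and> (\<exists>L>0. b = a + L *\<^sub>R rot u) \<and>
     (\<forall>x\<in>P. u \<bullet> x \<le> u \<bullet> a) \<and> P \<inter> {x. u \<bullet> x = u \<bullet> a} = closed_segment a b"

lemma oriented_edgeI:
  assumes "norm u = 1" "0 < L" "\<forall>x\<in>P. u \<bullet> x \<le> u \<bullet> a"
    "P \<inter> {x. u \<bullet> x = u \<bullet> a} = closed_segment a (a + L *\<^sub>R rot u)"
  shows "oriented_edge P u a (a + L *\<^sub>R rot u)"
  unfolding oriented_edge_def using assms(2)
  by (intro conjI assms exI[of _ L]) simp_all

text \<open>
  Nondegenerate polygons: a polytope on which no nonzero linear functional is constant, that is, one
  that is not contained in a line. This gives each edge a single unit normal, and each vertex one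
  incoming and one outgoing edge.
\<close>

locale polygon =
  fixes P :: "plane set"
  assumes polytope: "polytope P"
    and not_collinear: "\<And>u. u \<noteq> 0 \<Longrightarrow> \<exists>x\<in>P. \<exists>y\<in>P. u \<bullet> x \<noteq> u \<bullet> y"
begin

definition vertices :: "plane set" where
  "vertices = {V. {V} face_of P}"

lemma convex: "convex P" and compact: "compact P"
  using polytope by (auto intro: polytope_imp_convex polytope_imp_compact)

lemma finite_vertices: "finite vertices"
proof -
  have "finite ((\<lambda>V. {V}) ` vertices)"
    by (rule finite_subset[OF _ finite_polytope_faces[OF polytope]]) (auto simp: vertices_def)
  then show ?thesis
    by (rule finite_imageD) (auto intro: inj_onI)
qed

lemma faces_of_dim_0: "faces_of_dim 0 P = (\<lambda>V. {V}) ` vertices"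
  by (auto simp: faces_of_dim_def vertices_def aff_dim_eq_0)

lemma vertex_in: "V \<in> vertices \<Longrightarrow> V \<in> P"
  by (auto simp: vertices_def dest: face_of_imp_subset)

lemma convex_hull_vertices: "convex hull vertices = P"
  using Krein_Milman_Minkowski[OF compact convex] by (simp add: vertices_def face_of_singleton)

text \<open>
  The end points are those points of P on the supporting line that are extreme in the directions
  \<open>- rot u\<close> and \<open>rot u\<close>.
\<close>

lemma supporting_line_segment:
  assumes u: "norm u = 1" and V: "V \<in> P" and max: "\<forall>x\<in>P. u \<bullet> x \<le> u \<bullet> V"
  obtains a L where "0 \<le> L" "P \<inter> {x. u \<bullet> x = u \<bullet> V} = closed_segment a (a + L *\<^sub>R rot u)"
proof -
  let ?F = "P \<inter> {x. u \<bullet> x = u \<bullet> V}"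
  have F: "compact ?F" "?F \<noteq> {}" "convex ?F"
    using V compact convex
    by (auto intro!: compact_Int_closed closed_hyperplane convex_Int convex_hyperplane)
  have c: "continuous_on ?F (\<lambda>x. rot u \<bullet> x)" by (intro continuous_intros)
  obtain a where a: "a \<in> ?F" "\<And>x. x \<in> ?F \<Longrightarrow> rot u \<bullet> a \<le> rot u \<bullet> x"
    using continuous_attains_inf[OF F(1,2) c] by blast
  obtain b where b: "b \<in> ?F" "\<And>x. x \<in> ?F \<Longrightarrow> rot u \<bullet> x \<le> rot u \<bullet> b"
    using continuous_attains_sup[OF F(1,2) c] by blast
  have on_line: "x = a + (rot u \<bullet> (x - a)) *\<^sub>R rot u" if "x \<in> ?F" for x
    using unit_frame_decomposition[OF u, of "x - a"] that a by (simp add: inner_diff_right algebra_simps)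
  define L where "L = rot u \<bullet> (b - a)"
  have L: "0 \<le> L" using a(2)[OF b(1)] by (simp add: L_def inner_diff_right)
  have b_eq: "b = a + L *\<^sub>R rot u"
    using on_line[OF b(1)] by (simp add: L_def)
  have "?F = closed_segment a (a + L *\<^sub>R rot u)"
  proof
    show "closed_segment a (a + L *\<^sub>R rot u) \<subseteq> ?F"
      using closed_segment_subset[OF a(1) b(1) F(3)] b_eq by simp
    show "?F \<subseteq> closed_segment a (a + L *\<^sub>R rot u)"
    proof
      fix x assume x: "x \<in> ?F"
      define t where "t = rot u \<bullet> (x - a)"
      have t: "0 \<le> t" "t \<le> L"
        using a(2)[OF x] b(2)[OF x] by (auto simp: t_def L_def inner_diff_right)
      show "x \<in> closed_segment a (a + L *\<^sub>R rot u)"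
      proof (cases "L = 0")
        case True
        then show ?thesis using t on_line[OF x] by (simp add: t_def)
      next
        case False
        have "(1 - t / L) *\<^sub>R a + (t / L) *\<^sub>R (a + L *\<^sub>R rot u) = a + (t / L * L) *\<^sub>R rot u"
          by (simp only: scaleR_add_right scaleR_diff_left scaleR_scaleR scaleR_one) simp
        then have "x = (1 - t / L) *\<^sub>R a + (t / L) *\<^sub>R (a + L *\<^sub>R rot u)"
          using on_line[OF x] False by (simp add: t_def)
        then show ?thesis
          unfolding in_segment using t L False by (intro exI[of _ "t / L"]) auto
      qed
    qed
  qed
  then show ?thesis using that L by blast
qed

lemma oriented_edge_face:
  assumes "oriented_edge P u a b"
  shows "closed_segment a b face_of P"
proof -
  have "P \<inter> {x. u \<bullet> x = u \<bullet> a} face_of P"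
    using assms convex by (intro face_of_Int_supporting_hyperplane_le) (auto simp: oriented_edge_def)
  then show ?thesis using assms by (simp add: oriented_edge_def)
qed

lemma oriented_edge_neq: "oriented_edge P u a b \<Longrightarrow> a \<noteq> b"
  by (auto simp: oriented_edge_def)

lemma faces_of_dim_1: "faces_of_dim 1 P = {closed_segment a b | u a b. oriented_edge P u a b}"
proof (intro equalityI subsetI)
  fix F assume "F \<in> faces_of_dim 1 P"
  then have F: "F face_of P" "aff_dim F = 1"
    by (auto simp: faces_of_dim_def)
  then have "F exposed_face_of P"
    using exposed_face_of_polyhedron[OF polytope_imp_polyhedron[OF polytope]] by blast
  then obtain v c where v: "P \<subseteq> {x. v \<bullet> x \<le> c}" "F = P \<inter> {x. v \<bullet> x = c}"
    by (auto simp: exposed_face_of_def)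
  have "F \<noteq> {}" using F by auto
  then obtain V where V: "V \<in> F" by blast
  have "v \<noteq> 0"
  proof
    assume "v = 0"
    then have "F = P" using v V by auto
    moreover have "aff_dim P \<noteq> 1"
    proof
      assume "aff_dim P = 1"
      then have "aff_dim P = int (DIM(plane)) - 1" by simp
      then obtain w c where w: "w \<noteq> 0" "affine hull P = {x. w \<bullet> x = c}"
        using aff_dim_eq_hyperplane[of P] by auto
      then have "P \<subseteq> {x. w \<bullet> x = c}" using hull_subset[of P affine] by simp
      then have "w \<bullet> x = c" if "x \<in> P" for x using that by auto
      then show False using not_collinear[OF w(1)] by metis
    qed
    ultimately show False using F by simp
  qed
  define u where "u = (1 / norm v) *\<^sub>R v"
  have u: "norm u = 1" using \<open>v \<noteq> 0\<close> by (simp add: u_def)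
  have vu: "v = norm v *\<^sub>R u" using \<open>v \<noteq> 0\<close> by (simp add: u_def)
  have nv: "0 < norm v" using \<open>v \<noteq> 0\<close> by simp
  have c: "c = norm v * (u \<bullet> V)"
    using V v(2) vu by (metis (mono_tags, lifting) Int_Collect inner_scaleR_left)
  have le: "u \<bullet> x \<le> u \<bullet> V" if "x \<in> P" for x
  proof -
    have "norm v * (u \<bullet> x) \<le> norm v * (u \<bullet> V)"
      using that v(1) c vu by (metis inner_scaleR_left mem_Collect_eq subset_iff)
    then show ?thesis using nv by simp
  qed
  have F_eq: "F = P \<inter> {x. u \<bullet> x = u \<bullet> V}"
  proof -
    have "v \<bullet> x = c \<longleftrightarrow> u \<bullet> x = u \<bullet> V" for x
      using nv unfolding c by (subst vu) simp
    then show ?thesis using v(2) by simp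
  qed
  have "V \<in> P" using V v(2) by simp
  then obtain a L where aL: "0 \<le> L" "F = closed_segment a (a + L *\<^sub>R rot u)"
    using supporting_line_segment[OF u] le F_eq by metis
  have "L \<noteq> 0" using F(2) aL(2) by auto
  have "a \<in> F" using aL by simp
  then have "u \<bullet> a = u \<bullet> V" using F_eq by simp
  then have "oriented_edge P u a (a + L *\<^sub>R rot u)"
    using u aL \<open>L \<noteq> 0\<close> le F_eq by (intro oriented_edgeI) simp_all
  then show "F \<in> {closed_segment a b | u a b. oriented_edge P u a b}"
    using aL by blast
next
  fix F assume "F \<in> {closed_segment a b | u a b. oriented_edge P u a b}"
  then obtain u a b where e: "oriented_edge P u a b" "F = closed_segment a b" by blast
  have "aff_dim (closed_segment a b) = 1"
    using oriented_edge_neq[OF e(1)] by (simp add: segment_convex_hull aff_dim_convex_hull)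
  then show "F \<in> faces_of_dim 1 P"
    using oriented_edge_face[OF e(1)] e(2) by (simp add: faces_of_dim_def)
qed

text \<open>
  Otherwise P would lie on the line through V orthogonal to u.
\<close>

lemma no_opposite_normals:
  assumes "norm u = 1" "\<forall>x\<in>P. u \<bullet> x \<le> u \<bullet> V" "\<forall>x\<in>P. (- u) \<bullet> x \<le> (- u) \<bullet> V"
  shows False
proof -
  have "u \<bullet> x = u \<bullet> V" if "x \<in> P" for x
    using assms(2,3) that by force
  then show False
    using not_collinear[of u] assms(1) by force
qed

lemma oriented_edge_le:
  assumes "oriented_edge P u a b" "x \<in> P"
  shows "u \<bullet> x \<le> u \<bullet> a" "u \<bullet> x \<le> u \<bullet> b"
proof -
  obtain L where L: "b = a + L *\<^sub>R rot u" and le: "\<forall>x\<in>P. u \<bullet> x \<le> u \<bullet> a"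
    using assms(1) unfolding oriented_edge_def by (elim conjE exE)
  show "u \<bullet> x \<le> u \<bullet> a"
    using le assms(2) by (rule bspec)
  then show "u \<bullet> x \<le> u \<bullet> b"
    by (simp add: L inner_add_right)
qed

lemma outer_unit_normals_edge:
  assumes e: "oriented_edge P u a b"
  shows "outer_unit_normals P (closed_segment a b) = {u}"
proof (intro equalityI subsetI)
  fix v assume "v \<in> outer_unit_normals P (closed_segment a b)"
  then have v: "norm v = 1" "\<And>x y. x \<in> closed_segment a b \<Longrightarrow> y \<in> P \<Longrightarrow> v \<bullet> y \<le> v \<bullet> x"
    by (auto simp: outer_unit_normals_def)
  obtain L where L: "0 < L" "b = a + L *\<^sub>R rot u"
    using e by (auto simp: oriented_edge_def)
  have "closed_segment a b \<subseteq> P"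
    using oriented_edge_face[OF e] by (rule face_of_imp_subset)
  then have ab: "a \<in> P" "b \<in> P" by auto
  have "v \<bullet> a = v \<bullet> b"
    using v(2)[OF _ ab(1), of b] v(2)[OF _ ab(2), of a] by simp
  then have "v \<bullet> rot u = 0"
    using L by (simp add: inner_add_right)
  then have "v = u \<or> v = - u"
    using e v(1) by (intro unit_parallel_cases) (auto simp: oriented_edge_def)
  moreover have "v \<noteq> - u"
    using no_opposite_normals[of u a] e v(2)[of a] by (auto simp: oriented_edge_def)
  ultimately show "v \<in> {u}" by simp
next
  fix v assume "v \<in> {u}"
  then have [simp]: "v = u" by simp
  have le: "u \<bullet> y \<le> u \<bullet> x" if "x \<in> closed_segment a b" "y \<in> P" for x y
  proof -
    have "x \<in> P \<inter> {x. u \<bullet> x = u \<bullet> a}"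
      using e that(1) unfolding oriented_edge_def by blast
    then show ?thesis using oriented_edge_le(1)[OF e that(2)] by simp
  qed
  have "norm u = 1" using e unfolding oriented_edge_def by (elim conjE)
  then show "v \<in> outer_unit_normals P (closed_segment a b)"
    using le by (simp add: outer_unit_normals_def)
qed

lemma oriented_edge_vertices:
  assumes e: "oriented_edge P u a b"
  shows "a \<in> vertices" "b \<in> vertices"
proof -
  have "{a} face_of closed_segment a b" "{b} face_of closed_segment a b"
    by (simp_all add: face_of_singleton extreme_point_of_segment)
  then show "a \<in> vertices" "b \<in> vertices"
    using oriented_edge_face[OF e] face_of_trans by (auto simp: vertices_def)
qed

text \<open>
  If two edges leave (or enter) the same vertex, then the convexity of P makes the two products
  \<open>v \<bullet> rot u\<close> and \<open>u \<bullet> rot v\<close> have the same sign. But they are negatives of each other, so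
  \<open>v = u\<close> or \<open>v = - u\<close>, and \<open>no_opposite_normals\<close> excludes the latter.
\<close>

lemma oriented_edge_unique_normal:
  assumes e: "oriented_edge P u a b" "oriented_edge P v c d" and "a = c \<or> b = d"
  shows "u = v"
proof -
  obtain L M where LM: "0 < L" "b = a + L *\<^sub>R rot u" "0 < M" "d = c + M *\<^sub>R rot v"
    using e by (auto simp: oriented_edge_def)
  have in_P: "a \<in> P" "b \<in> P" "c \<in> P" "d \<in> P"
    using oriented_edge_vertices e vertex_in by blast+
  have unit: "norm u = 1" "norm v = 1"
    using e by (auto simp: oriented_edge_def)
  have 1: "0 \<le> L * (v \<bullet> rot u) \<and> 0 \<le> M * (u \<bullet> rot v) \<or> L * (v \<bullet> rot u) \<le> 0 \<and> M * (u \<bullet> rot v) \<le> 0"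
    using assms(3)
  proof
    assume "a = c"
    then show ?thesis
      using oriented_edge_le[OF e(2) in_P(2)] oriented_edge_le[OF e(1) in_P(4)] LM
      by (simp add: inner_add_right)
  next
    assume bd: "b = d"
    have "v \<bullet> a = v \<bullet> b - L * (v \<bullet> rot u)" "u \<bullet> c = u \<bullet> d - M * (u \<bullet> rot v)"
      by (simp_all add: LM(2,4) inner_add_right)
    then show ?thesis
      using oriented_edge_le[OF e(2) in_P(1)] oriented_edge_le[OF e(1) in_P(3)] bd by simp
  qed
  have "u \<bullet> rot v = - (v \<bullet> rot u)" by (rule inner_rot_swap)
  then have "v \<bullet> rot u = 0"
    using 1 LM by (auto simp: zero_le_mult_iff mult_le_0_iff)
  then have "v = u \<or> v = - u" by (intro unit_parallel_cases unit)
  moreover have "v \<noteq> - u"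
  proof
    assume vu: "v = - u"
    obtain V where V: "\<forall>x\<in>P. u \<bullet> x \<le> u \<bullet> V" "\<forall>x\<in>P. v \<bullet> x \<le> v \<bullet> V"
      using assms(3) oriented_edge_le[OF e(1)] oriented_edge_le[OF e(2)] by blast
    then show False using no_opposite_normals[OF unit(1) V(1)] vu by simp
  qed
  ultimately show ?thesis by simp
qed

lemma oriented_edge_unique:
  assumes e: "oriented_edge P u a b" "oriented_edge P v c d" and "a = c \<or> b = d"
  shows "u = v" "a = c" "b = d"
proof -
  show "u = v" by (rule oriented_edge_unique_normal[OF assms])
  moreover have "u \<bullet> b = u \<bullet> a" "v \<bullet> d = v \<bullet> c"
    using e by (auto simp: oriented_edge_def inner_add_right)
  ultimately have "u \<bullet> a = u \<bullet> c"
    using assms(3) by auto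
  then have "closed_segment a b = closed_segment c d"
    using e \<open>u = v\<close> by (auto simp: oriented_edge_def)
  then have "{a, b} = {c, d}" by (simp add: closed_segment_eq)
  then show "a = c" "b = d"
    using assms(3) by (auto simp: doubleton_eq_iff)
qed

text \<open>
  Seen from the vertex V, all other vertices lie in an open half plane, which is bounded by the line
  through V orthogonal to u0. So their directions are ordered by slope, and an extreme direction spans an
  edge. The sign \<open>\<epsilon>\<close> chooses between the edge that leaves V (\<open>\<epsilon> = 1\<close>) and the one that enters it
  (\<open>\<epsilon> = - 1\<close>).
\<close>

lemma vertex_extreme_neighbour:
  assumes V: "V \<in> vertices" and \<epsilon>: "\<epsilon> = 1 \<or> \<epsilon> = - 1"
  obtains u W where "norm u = 1" "W \<in> P" "W \<noteq> V" "\<forall>x\<in>P. u \<bullet> x \<le> u \<bullet> V" "u \<bullet> W = u \<bullet> V"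
    "\<forall>x\<in>P. u \<bullet> x = u \<bullet> V \<longrightarrow> 0 \<le> \<epsilon> * (rot u \<bullet> (x - V))"
proof -
  have "{V} exposed_face_of P"
    using V exposed_face_of_polyhedron[OF polytope_imp_polyhedron[OF polytope]]
    by (auto simp: vertices_def)
  then obtain u0 c where u0: "P \<subseteq> {x. u0 \<bullet> x \<le> c}" "{V} = P \<inter> {x. u0 \<bullet> x = c}"
    by (auto simp: exposed_face_of_def)
  have c: "c = u0 \<bullet> V" using u0(2) by auto
  have below: "u0 \<bullet> (x - V) < 0" if "x \<in> P" "x \<noteq> V" for x
  proof -
    have "u0 \<bullet> x \<le> c" "u0 \<bullet> x \<noteq> c" using u0 that by auto
    then show ?thesis by (simp add: c inner_diff_right)
  qed
  have "vertices \<noteq> {V}"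
  proof
    assume "vertices = {V}"
    then have "P = {V}" using convex_hull_vertices by simp
    then show False using not_collinear[of "axis 1 1"] by (simp add: axis_eq_0_iff)
  qed
  then have "vertices - {V} \<noteq> {}" using V by auto
  then have ne: "finite (vertices - {V})" "vertices - {V} \<noteq> {}" using finite_vertices by auto
  \<comment> \<open>Up to the sign, this is the slope of W - V in the frame of - u0 and rot u0.\<close>
  let ?m = "\<lambda>W. \<epsilon> * (rot u0 \<bullet> (W - V)) / (- (u0 \<bullet> (W - V)))"
  obtain W where W: "W \<in> vertices - {V}" "\<And>x. x \<in> vertices - {V} \<Longrightarrow> ?m x \<le> ?m W"
  proof -
    let ?A = "vertices - {V}"
    have "Max (?m ` ?A) \<in> ?m ` ?A"
      by (rule Max_in) (use ne in simp_all)
    then obtain W where W: "W \<in> ?A" "Max (?m ` ?A) = ?m W"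
      by (rule imageE)
    have "?m x \<le> ?m W" if "x \<in> ?A" for x
      unfolding W(2)[symmetric] by (rule Max_ge) (use ne that in simp_all)
    with W(1) show ?thesis by (rule that)
  qed
  define d where "d = W - V"
  have d0: "d \<noteq> 0" using W by (simp add: d_def)
  have u0d: "u0 \<bullet> d < 0" using below[of W] W vertex_in by (auto simp: d_def)
  define n where "n = norm u0 ^ 2"
  have n: "0 < n" using u0d by (auto simp: n_def)
  have det: "n * (rot d \<bullet> y) = (u0 \<bullet> d) * (rot u0 \<bullet> y) - (rot u0 \<bullet> d) * (u0 \<bullet> y)" for y
    unfolding n_def power2_norm_eq_inner by (simp add: inner_plane algebra_simps)
  have vertex_side: "0 \<le> \<epsilon> * (rot d \<bullet> (x - V))" if "x \<in> vertices" for x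
  proof (cases "x = V")
    case False
    let ?y = "x - V"
    have y: "u0 \<bullet> ?y < 0" using below[of x] that vertex_in False by auto
    have "\<epsilon> * (rot u0 \<bullet> ?y) / (- (u0 \<bullet> ?y)) \<le> \<epsilon> * (rot u0 \<bullet> d) / (- (u0 \<bullet> d))"
      using W(2)[of x] that False by (simp add: d_def)
    then have "\<epsilon> * (rot u0 \<bullet> ?y) * (- (u0 \<bullet> d)) \<le> \<epsilon> * (rot u0 \<bullet> d) * (- (u0 \<bullet> ?y))"
      using y u0d by (simp add: divide_le_eq pos_le_divide_eq mult.commute field_simps)
    moreover have "n * (\<epsilon> * (rot d \<bullet> ?y))
        = \<epsilon> * (rot u0 \<bullet> d) * (- (u0 \<bullet> ?y)) - \<epsilon> * (rot u0 \<bullet> ?y) * (- (u0 \<bullet> d))"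
      using det[of ?y] by algebra
    ultimately have "0 \<le> n * (\<epsilon> * (rot d \<bullet> ?y))"
      by linarith
    then show ?thesis using n by (simp add: zero_le_mult_iff)
  qed simp
  have side: "0 \<le> \<epsilon> * (rot d \<bullet> (x - V))" if "x \<in> P" for x
  proof -
    let ?H = "{x. (\<epsilon> *\<^sub>R rot d) \<bullet> x \<ge> (\<epsilon> *\<^sub>R rot d) \<bullet> V}"
    have H: "x \<in> ?H \<longleftrightarrow> 0 \<le> \<epsilon> * (rot d \<bullet> (x - V))" for x
      by (simp add: inner_diff_right right_diff_distrib)
    have "vertices \<subseteq> ?H" using vertex_side H by blast
    then have "convex hull vertices \<subseteq> ?H" by (rule hull_minimal) (rule convex_halfspace_ge)
    then have "x \<in> ?H" using that convex_hull_vertices by blast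
    then show ?thesis using H by blast
  qed
  define u where "u = (- \<epsilon> / norm d) *\<^sub>R rot d"
  have \<epsilon>2: "\<bar>\<epsilon>\<bar> = 1" "\<epsilon> * \<epsilon> = 1" using \<epsilon> by auto
  have nd: "0 < norm d" using d0 by simp
  have u_inner: "u \<bullet> (x - V) = - (\<epsilon> * (rot d \<bullet> (x - V))) / norm d" for x
    by (simp add: u_def)
  show ?thesis
  proof
    show "norm u = 1" using \<epsilon>2 nd by (simp add: u_def)
    show "W \<in> P" "W \<noteq> V" using W vertex_in by auto
    show "\<forall>x\<in>P. u \<bullet> x \<le> u \<bullet> V"
    proof
      fix x assume "x \<in> P"
      then have "u \<bullet> (x - V) \<le> 0"
        using side[of x] nd by (simp add: u_inner divide_nonpos_pos)
      then show "u \<bullet> x \<le> u \<bullet> V" by (simp add: inner_diff_right)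
    qed
    have "u \<bullet> (W - V) = 0" using u_inner[of W] by (simp add: d_def[symmetric])
    then show "u \<bullet> W = u \<bullet> V" by (simp add: inner_diff_right)
    show "\<forall>x\<in>P. u \<bullet> x = u \<bullet> V \<longrightarrow> 0 \<le> \<epsilon> * (rot u \<bullet> (x - V))"
    proof (intro ballI impI)
      fix x assume x: "x \<in> P" "u \<bullet> x = u \<bullet> V"
      let ?y = "x - V"
      have "u \<bullet> ?y = 0" using x by (simp add: inner_diff_right)
      then have 0: "rot d \<bullet> ?y = 0" using u_inner[of x] \<epsilon> nd by auto
      have "(d \<bullet> d) * (u0 \<bullet> ?y) = (u0 \<bullet> d) * (d \<bullet> ?y) + (u0 \<bullet> rot d) * (rot d \<bullet> ?y)"
        by (simp add: inner_plane algebra_simps)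
      then have eq: "(d \<bullet> d) * (u0 \<bullet> ?y) = (u0 \<bullet> d) * (d \<bullet> ?y)" using 0 by simp
      have "u0 \<bullet> ?y \<le> 0" using below[of x] x by (cases "x = V") auto
      then have "(u0 \<bullet> d) * (d \<bullet> ?y) \<le> 0"
        unfolding eq[symmetric] by (simp add: mult_nonneg_nonpos)
      then have "0 \<le> d \<bullet> ?y" using u0d by (simp add: mult_le_0_iff)
      moreover have "rot u = (\<epsilon> / norm d) *\<^sub>R d" by (simp add: u_def)
      ultimately show "0 \<le> \<epsilon> * (rot u \<bullet> ?y)"
        using nd \<epsilon>2 by (simp add: mult.assoc[symmetric])
    qed
  qed
qed

lemma outgoing_edge:
  assumes V: "V \<in> vertices"
  obtains u b where "oriented_edge P u V b"
proof -
  obtain u W where u: "norm u = 1" "W \<in> P" "W \<noteq> V" "\<forall>x\<in>P. u \<bullet> x \<le> u \<bullet> V" "u \<bullet> W = u \<bullet> V"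
    and side: "\<forall>x\<in>P. u \<bullet> x = u \<bullet> V \<longrightarrow> 0 \<le> 1 * (rot u \<bullet> (x - V))"
    using vertex_extreme_neighbour[OF V, of 1] by blast
  obtain a L where aL: "0 \<le> L" "P \<inter> {x. u \<bullet> x = u \<bullet> V} = closed_segment a (a + L *\<^sub>R rot u)"
    using supporting_line_segment[OF u(1) vertex_in[OF V] u(4)] .
  have "V \<in> P \<inter> {x. u \<bullet> x = u \<bullet> V}" "W \<in> P \<inter> {x. u \<bullet> x = u \<bullet> V}"
    using u V vertex_in by auto
  then have L: "L \<noteq> 0" unfolding aL(2) using u(3) by auto
  have "V \<in> closed_segment a (a + L *\<^sub>R rot u)" using aL(2) V vertex_in by blast
  then obtain t where t: "0 \<le> t" "V = a + (t * L) *\<^sub>R rot u"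
    unfolding in_segment by (auto simp: algebra_simps)
  have "a \<in> P \<inter> {x. u \<bullet> x = u \<bullet> V}" unfolding aL(2) by simp
  then have "0 \<le> rot u \<bullet> (a - V)" using side by simp
  then have "t * L \<le> 0" using t u(1) by (simp add: norm_eq_1)
  then have "t = 0" using t L aL by (auto simp: mult_le_0_iff)
  then have "a = V" using t by simp
  then have "oriented_edge P u V (V + L *\<^sub>R rot u)"
    using u aL L by (intro oriented_edgeI) simp_all
  then show ?thesis by (rule that)
qed

lemma incoming_edge:
  assumes V: "V \<in> vertices"
  obtains u a where "oriented_edge P u a V"
proof -
  obtain u W where u: "norm u = 1" "W \<in> P" "W \<noteq> V" "\<forall>x\<in>P. u \<bullet> x \<le> u \<bullet> V" "u \<bullet> W = u \<bullet> V"
    and side: "\<forall>x\<in>P. u \<bullet> x = u \<bullet> V \<longrightarrow> 0 \<le> (- 1) * (rot u \<bullet> (x - V))"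
    using vertex_extreme_neighbour[OF V, of "- 1"] by blast
  obtain a L where aL: "0 \<le> L" "P \<inter> {x. u \<bullet> x = u \<bullet> V} = closed_segment a (a + L *\<^sub>R rot u)"
    using supporting_line_segment[OF u(1) vertex_in[OF V] u(4)] .
  have "V \<in> P \<inter> {x. u \<bullet> x = u \<bullet> V}" "W \<in> P \<inter> {x. u \<bullet> x = u \<bullet> V}"
    using u V vertex_in by auto
  then have L: "L \<noteq> 0" unfolding aL(2) using u(3) by auto
  have "V \<in> closed_segment a (a + L *\<^sub>R rot u)" using aL(2) V vertex_in by blast
  then obtain t where t: "t \<le> 1" "V = a + (t * L) *\<^sub>R rot u"
    unfolding in_segment by (auto simp: algebra_simps)
  have "a + L *\<^sub>R rot u \<in> P \<inter> {x. u \<bullet> x = u \<bullet> V}" unfolding aL(2) by simp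
  then have "rot u \<bullet> (a + L *\<^sub>R rot u - V) \<le> 0" using side by simp
  then have "(1 - t) * L \<le> 0"
    using t u(1) by (simp add: norm_eq_1 inner_add_right inner_diff_right algebra_simps)
  then have "t = 1" using t L aL by (auto simp: mult_le_0_iff)
  then have V_eq: "V = a + L *\<^sub>R rot u" using t by simp
  have "u \<bullet> a = u \<bullet> V" by (simp add: V_eq inner_add_right)
  moreover from this have "oriented_edge P u a (a + L *\<^sub>R rot u)"
    using u aL L by (intro oriented_edgeI) simp_all
  ultimately have "oriented_edge P u a V"
    using V_eq by simp
  then show ?thesis by (rule that)
qed

text \<open>
  The two edges at V cut the normal cone down to the arc from the incoming to the outgoing normal.
  Conversely, each u on this arc is a nonnegative combination of these two normals, both of
  which attain their maximum over P at V.
\<close>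

lemma normal_arc:
  assumes e: "oriented_edge P um a V" "oriented_edge P up V b"
  obtains \<alpha> \<beta> where "\<alpha> \<le> \<beta>" "\<beta> \<le> \<alpha> + pi" "um = unit_vec \<alpha>" "up = unit_vec \<beta>"
    "outer_unit_normals P {V} = unit_vec ` {\<alpha>..\<beta>}"
proof -
  obtain L M where LM: "0 < L" "V = a + L *\<^sub>R rot um" "0 < M" "b = V + M *\<^sub>R rot up"
    using e by (auto simp: oriented_edge_def)
  have in_P: "a \<in> P" "b \<in> P" "V \<in> P"
    using oriented_edge_vertices e vertex_in by blast+
  have unit: "norm um = 1" "norm up = 1"
    using e by (auto simp: oriented_edge_def)
  obtain \<alpha> where \<alpha>: "um = unit_vec \<alpha>"
    using unit_vec_from[OF unit(1), of 0] by auto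
  obtain \<phi> where \<phi>: "0 \<le> \<phi>" "\<phi> < 2 * pi" "up = unit_vec (\<alpha> + \<phi>)"
    using unit_vec_from[OF unit(2), of \<alpha>] by auto
  have "um \<bullet> b \<le> um \<bullet> V" by (rule oriented_edge_le(2)[OF e(1) in_P(2)])
  then have "M * (um \<bullet> rot up) \<le> 0" by (simp add: LM(4) inner_add_right)
  then have "um \<bullet> rot up \<le> 0" using LM by (simp add: mult_le_0_iff)
  moreover have "um \<bullet> rot up \<noteq> 0"
  proof
    assume "um \<bullet> rot up = 0"
    then have "um = up \<or> um = - up" by (intro unit_parallel_cases unit)
    moreover have "um \<noteq> - up"
    proof
      assume "um = - up"
      then have "\<forall>x\<in>P. (- up) \<bullet> x \<le> (- up) \<bullet> V" using oriented_edge_le(2)[OF e(1)] by simp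
      moreover have "\<forall>x\<in>P. up \<bullet> x \<le> up \<bullet> V" using oriented_edge_le(1)[OF e(2)] by simp
      ultimately show False using no_opposite_normals unit(2) by blast
    qed
    ultimately have eq: "um = up" by simp
    then have "up \<bullet> a = up \<bullet> V" by (simp add: LM(2) inner_add_right)
    then have "closed_segment a V = closed_segment V b"
      using e eq by (simp add: oriented_edge_def)
    then have "a = b" by (auto simp: closed_segment_eq doubleton_eq_iff)
    then have "(L + M) *\<^sub>R rot up = 0" using LM eq by (simp add: scaleR_add_left)
    then show False using LM unit(2) by auto
  qed
  ultimately have sin: "0 < sin \<phi>"
    by (simp add: \<alpha> \<phi>(3) unit_vec_inner_rot)
  then have \<phi>_pi: "\<phi> < pi"
    using \<phi>(2) sin_le_zero[of \<phi>] by force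
  have \<phi>_pos: "0 < \<phi>" using sin \<phi>(1) by (cases "\<phi> = 0") auto
  have "outer_unit_normals P {V} = unit_vec ` {\<alpha>..\<alpha> + \<phi>}"
  proof (intro equalityI subsetI)
    fix u assume "u \<in> outer_unit_normals P {V}"
    then have u: "norm u = 1" "\<And>y. y \<in> P \<Longrightarrow> u \<bullet> y \<le> u \<bullet> V"
      by (auto simp: outer_unit_normals_def)
    obtain \<theta> where \<theta>: "0 \<le> \<theta>" "\<theta> < 2 * pi" "u = unit_vec (\<alpha> + \<theta>)"
      using unit_vec_from[OF u(1), of \<alpha>] by auto
    have "0 \<le> L * (u \<bullet> rot um)" using u(2)[OF in_P(1)] by (simp add: LM(2) inner_add_right)
    then have "0 \<le> sin \<theta>"
      using LM by (simp add: \<alpha> \<theta>(3) unit_vec_inner_rot zero_le_mult_iff)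
    then have \<theta>_pi: "\<theta> \<le> pi" using \<theta>(2) sin_lt_zero[of \<theta>] by force
    have "M * (u \<bullet> rot up) \<le> 0" using u(2)[OF in_P(2)] by (simp add: LM(4) inner_add_right)
    then have "sin (\<theta> - \<phi>) \<le> 0"
      using LM by (simp add: \<phi>(3) \<theta>(3) unit_vec_inner_rot mult_le_0_iff)
    then have "\<theta> \<le> \<phi>"
      using sin_gt_zero[of "\<theta> - \<phi>"] \<theta>_pi \<phi>_pos by force
    then show "u \<in> unit_vec ` {\<alpha>..\<alpha> + \<phi>}" using \<theta> by auto
  next
    fix u assume "u \<in> unit_vec ` {\<alpha>..\<alpha> + \<phi>}"
    then obtain \<psi> where \<psi>: "\<psi> \<in> {\<alpha>..\<alpha> + \<phi>}" "u = unit_vec \<psi>" by blast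
    define \<theta> where "\<theta> = \<psi> - \<alpha>"
    have \<theta>: "0 \<le> \<theta>" "\<theta> \<le> \<phi>" "u = unit_vec (\<alpha> + \<theta>)" using \<psi> by (auto simp: \<theta>_def)
    \<comment> \<open>Since sin \<phi> > 0, this puts u into the cone spanned by the two normals.\<close>
    have comb: "sin \<phi> *\<^sub>R u = sin (\<phi> - \<theta>) *\<^sub>R um + sin \<theta> *\<^sub>R up"
      by (simp add: plane_eq_iff \<alpha> \<phi>(3) \<theta>(3) sin_add cos_add sin_diff) (simp add: algebra_simps)
    have nonneg: "0 \<le> sin (\<phi> - \<theta>)" "0 \<le> sin \<theta>"
      using \<theta> \<phi>_pi by (auto intro!: sin_ge_zero)
    have "u \<bullet> y \<le> u \<bullet> V" if y: "y \<in> P" for y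
    proof -
      have "sin \<phi> * (u \<bullet> y) = sin (\<phi> - \<theta>) * (um \<bullet> y) + sin \<theta> * (up \<bullet> y)"
        using arg_cong[OF comb, of "\<lambda>w. w \<bullet> y"] by (simp add: inner_add_left)
      also have "\<dots> \<le> sin (\<phi> - \<theta>) * (um \<bullet> V) + sin \<theta> * (up \<bullet> V)"
        using nonneg oriented_edge_le(2)[OF e(1) y] oriented_edge_le(1)[OF e(2) y]
        by (intro add_mono mult_left_mono)
      also have "\<dots> = sin \<phi> * (u \<bullet> V)"
        using arg_cong[OF comb, of "\<lambda>w. w \<bullet> V"] by (simp add: inner_add_left)
      finally show ?thesis using sin by simp
    qed
    then show "u \<in> outer_unit_normals P {V}"
      using \<theta> by (simp add: outer_unit_normals_def)
  qed
  then show ?thesis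
    using that[of \<alpha> "\<alpha> + \<phi>"] \<alpha> \<phi> \<phi>_pi by auto
qed

definition out_normal :: "plane \<Rightarrow> plane" where
  "out_normal V = (SOME u. \<exists>b. oriented_edge P u V b)"

definition next_vertex :: "plane \<Rightarrow> plane" where
  "next_vertex V = (SOME b. oriented_edge P (out_normal V) V b)"

definition in_normal :: "plane \<Rightarrow> plane" where
  "in_normal V = (SOME u. \<exists>a. oriented_edge P u a V)"

definition prev_vertex :: "plane \<Rightarrow> plane" where
  "prev_vertex V = (SOME a. oriented_edge P (in_normal V) a V)"

lemma out_edge: "V \<in> vertices \<Longrightarrow> oriented_edge P (out_normal V) V (next_vertex V)"
  unfolding next_vertex_def out_normal_def by (metis (mono_tags, lifting) outgoing_edge someI_ex)

lemma in_edge: "V \<in> vertices \<Longrightarrow> oriented_edge P (in_normal V) (prev_vertex V) V"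
  unfolding prev_vertex_def in_normal_def by (metis (mono_tags, lifting) incoming_edge someI_ex)

lemma next_in: "V \<in> vertices \<Longrightarrow> next_vertex V \<in> vertices"
  and prev_in: "V \<in> vertices \<Longrightarrow> prev_vertex V \<in> vertices"
  using oriented_edge_vertices out_edge in_edge by blast+

lemma in_normal_next: "V \<in> vertices \<Longrightarrow> in_normal (next_vertex V) = out_normal V"
  and prev_next: "V \<in> vertices \<Longrightarrow> prev_vertex (next_vertex V) = V"
  using oriented_edge_unique[OF in_edge[OF next_in] out_edge, of V V] by simp_all

lemma next_prev: "V \<in> vertices \<Longrightarrow> next_vertex (prev_vertex V) = V"
  using oriented_edge_unique(3)[OF out_edge[OF prev_in] in_edge, of V V] by simp

lemma next_bij: "bij_betw next_vertex vertices vertices"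
  by (rule bij_betw_byWitness[of _ prev_vertex]) (auto simp: next_in prev_in prev_next next_prev)

text \<open>
  Each edge is listed once, by its starting point. This turns sums over edges into sums over vertices.
\<close>

lemma edges_bij: "bij_betw (\<lambda>V. closed_segment V (next_vertex V)) vertices (faces_of_dim 1 P)"
proof (rule bij_betw_imageI)
  show "inj_on (\<lambda>V. closed_segment V (next_vertex V)) vertices"
  proof
    fix V W assume VW: "V \<in> vertices" "W \<in> vertices"
      and eq: "closed_segment V (next_vertex V) = closed_segment W (next_vertex W)"
    note eV = out_edge[OF VW(1)] and eW = out_edge[OF VW(2)]
    have normal: "out_normal V = out_normal W"
      using outer_unit_normals_edge[OF eV] outer_unit_normals_edge[OF eW] eq by simp
    have "{V, next_vertex V} = {W, next_vertex W}"
      using eq by (simp add: closed_segment_eq)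
    then consider "V = W" | "V = next_vertex W" "next_vertex V = W"
      by (auto simp: doubleton_eq_iff)
    then show "V = W"
    proof cases
      case 2
      obtain L M where LM: "0 < L" "next_vertex V = V + L *\<^sub>R rot (out_normal V)"
        "0 < M" "next_vertex W = W + M *\<^sub>R rot (out_normal W)"
        using eV eW unfolding oriented_edge_def by blast
      have "next_vertex V + M *\<^sub>R rot (out_normal V) = V"
        using 2 normal LM(4) by simp
      then have "V + (L + M) *\<^sub>R rot (out_normal V) = V"
        using LM(2) by (simp add: scaleR_add_left add.assoc)
      then have "(L + M) *\<^sub>R rot (out_normal V) = 0" by simp
      then show ?thesis
        using LM eV by (auto simp: oriented_edge_def)
    qed
  qed
  show "(\<lambda>V. closed_segment V (next_vertex V)) ` vertices = faces_of_dim 1 P"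
  proof
    show "(\<lambda>V. closed_segment V (next_vertex V)) ` vertices \<subseteq> faces_of_dim 1 P"
      unfolding faces_of_dim_1 using out_edge by blast
    show "faces_of_dim 1 P \<subseteq> (\<lambda>V. closed_segment V (next_vertex V)) ` vertices"
    proof
      fix F assume "F \<in> faces_of_dim 1 P"
      then obtain u a b where e: "oriented_edge P u a b" "F = closed_segment a b"
        unfolding faces_of_dim_1 by blast
      have a: "a \<in> vertices" by (rule oriented_edge_vertices(1)[OF e(1)])
      then have "b = next_vertex a"
        using oriented_edge_unique(3)[OF e(1) out_edge[OF a]] by simp
      then show "F \<in> (\<lambda>V. closed_segment V (next_vertex V)) ` vertices"
        using a e(2) by blast
    qed
  qed
qed

definition edge_length :: "plane \<Rightarrow> real" where
  "edge_length V = dist V (next_vertex V)"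

lemma next_vertex_eq:
  assumes "V \<in> vertices"
  shows "next_vertex V = V + edge_length V *\<^sub>R rot (out_normal V)" "0 < edge_length V"
    "norm (out_normal V) = 1"
proof -
  obtain L where L: "0 < L" "next_vertex V = V + L *\<^sub>R rot (out_normal V)" and u: "norm (out_normal V) = 1"
    using out_edge[OF assms] unfolding oriented_edge_def by blast
  then have "edge_length V = L" by (simp add: edge_length_def dist_norm)
  then show "next_vertex V = V + edge_length V *\<^sub>R rot (out_normal V)" "0 < edge_length V"
    "norm (out_normal V) = 1"
    using L u by simp_all
qed

lemma edge_eq_image:
  assumes "V \<in> vertices"
  shows "closed_segment V (next_vertex V) = (\<lambda>t. V + t *\<^sub>R rot (out_normal V)) ` {0..edge_length V}"
proof -
  define L w where "L = edge_length V" and "w = rot (out_normal V)"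
  have nv: "next_vertex V = V + L *\<^sub>R w" and L: "0 < L"
    using next_vertex_eq[OF assms] by (simp_all add: L_def w_def)
  have "closed_segment V (next_vertex V) = (\<lambda>t. V + t *\<^sub>R w) ` ((\<lambda>t. t * L) ` {0..1})"
    unfolding closed_segment_image_interval nv image_image
    by (intro image_cong) (simp_all add: algebra_simps)
  also have "(\<lambda>t. t * L) ` {0..1} = {0..L}"
    using L image_mult_atLeastAtMost[of L 0 1] by (simp add: mult.commute)
  finally show ?thesis by (simp add: L_def w_def)
qed

definition arc_bounds :: "plane \<Rightarrow> real \<times> real" where
  "arc_bounds V = (SOME (\<alpha>, \<beta>). \<alpha> \<le> \<beta> \<and> \<beta> \<le> \<alpha> + pi \<and> in_normal V = unit_vec \<alpha> \<and>
     out_normal V = unit_vec \<beta> \<and> outer_unit_normals P {V} = unit_vec ` {\<alpha>..\<beta>})"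

lemma arc_bounds:
  assumes "V \<in> vertices"
  shows "fst (arc_bounds V) \<le> snd (arc_bounds V)" "snd (arc_bounds V) \<le> fst (arc_bounds V) + pi"
    "in_normal V = unit_vec (fst (arc_bounds V))" "out_normal V = unit_vec (snd (arc_bounds V))"
    "outer_unit_normals P {V} = unit_vec ` {fst (arc_bounds V)..snd (arc_bounds V)}"
proof -
  let ?Q = "\<lambda>(\<alpha>, \<beta>). \<alpha> \<le> \<beta> \<and> \<beta> \<le> \<alpha> + pi \<and> in_normal V = unit_vec \<alpha> \<and>
     out_normal V = unit_vec \<beta> \<and> outer_unit_normals P {V} = unit_vec ` {\<alpha>..\<beta>}"
  obtain \<alpha> \<beta> where "\<alpha> \<le> \<beta>" "\<beta> \<le> \<alpha> + pi" "in_normal V = unit_vec \<alpha>"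
     "out_normal V = unit_vec \<beta>" "outer_unit_normals P {V} = unit_vec ` {\<alpha>..\<beta>}"
    by (rule normal_arc[OF in_edge[OF assms] out_edge[OF assms]])
  then have "?Q (\<alpha>, \<beta>)" by simp
  then have "?Q (arc_bounds V)"
    unfolding arc_bounds_def by (rule someI)
  then show "fst (arc_bounds V) \<le> snd (arc_bounds V)" "snd (arc_bounds V) \<le> fst (arc_bounds V) + pi"
    "in_normal V = unit_vec (fst (arc_bounds V))" "out_normal V = unit_vec (snd (arc_bounds V))"
    "outer_unit_normals P {V} = unit_vec ` {fst (arc_bounds V)..snd (arc_bounds V)}"
    by (simp_all add: case_prod_beta)
qed

end

section \<open>Density of polygons\<close>

lemma plane_axis [simp]: "u \<bullet> axis i 1 = u $ i" for u :: plane
  by (simp add: inner_axis)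

lemma polygon_convex_hull:
  fixes p :: plane
  assumes "finite S" "p \<in> S" and c: "\<And>i :: 2. c i \<noteq> 0 \<and> p + c i *\<^sub>R axis i 1 \<in> S"
  shows "polygon (convex hull S)"
proof
  show "polytope (convex hull S)" using assms(1) by (rule polytope_convex_hull)
  fix u :: plane assume "u \<noteq> 0"
  then obtain i :: 2 where i: "u $ i \<noteq> 0" by (auto simp: vec_eq_iff)
  have "p + c i *\<^sub>R axis i 1 \<in> convex hull S" "p \<in> convex hull S"
    using c assms(2) by (auto intro: hull_inc)
  moreover have "u \<bullet> (p + c i *\<^sub>R axis i 1) \<noteq> u \<bullet> p"
    using i c by (simp add: inner_add_right)
  ultimately show "\<exists>x\<in>convex hull S. \<exists>y\<in>convex hull S. u \<bullet> x \<noteq> u \<bullet> y" by blast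
qed

text \<open>
  Take the convex hull of a finite \<open>\<epsilon>\<close>-net of K. Two additional points keep it from lying on a line.
\<close>

lemma polygon_near_convex_body:
  fixes K :: convex_body
  assumes \<epsilon>: "0 < \<epsilon>"
  obtains P where "polygon (points P)" "dist P K \<le> \<epsilon>"
proof -
  let ?K = "points K"
  have K: "?K \<noteq> {}" "compact ?K" "convex ?K" using points[of K] by auto
  obtain C where C: "finite C" "C \<subseteq> ?K" "?K \<subseteq> (\<Union>x\<in>C. ball x \<epsilon>)"
    using seq_compact_imp_totally_bounded[of ?K] K(2) \<epsilon> by (metis compact_imp_seq_compact)
  obtain p where p: "p \<in> ?K" using K by blast
  define S where "S = C \<union> {p, p + \<epsilon> *\<^sub>R axis 1 1, p + \<epsilon> *\<^sub>R axis 2 1}"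
  have S: "finite S" using C by (simp add: S_def)
  let ?Q = "convex hull S"
  have Q: "?Q \<noteq> {}" "compact ?Q" "convex ?Q"
    using S by (auto simp: S_def finite_imp_compact_convex_hull)
  define P where "P = Convex_Body ?Q"
  have P: "points P = ?Q" using Q by (simp add: P_def Convex_Body_inverse)
  have "hausdorff_dist ?Q ?K \<le> \<epsilon>"
  proof (rule hausdorff_dist_le[OF Q(1) K(1)])
    show "infdist y ?Q \<le> \<epsilon>" if "y \<in> ?K" for y
    proof -
      obtain c where c: "c \<in> C" "dist c y < \<epsilon>" using C(3) \<open>y \<in> ?K\<close> by force
      have "c \<in> ?Q" using c(1) by (intro hull_inc) (simp add: S_def)
      then show ?thesis using c(2) by (intro infdist_le2[of c]) (auto simp: dist_commute)
    qed
    show "infdist x ?K \<le> \<epsilon>" if x: "x \<in> ?Q" for x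
    proof -
      \<comment> \<open>The parallel body of K at distance \<open>\<epsilon>\<close>, which is convex.\<close>
      let ?N = "\<Union>a\<in>?K. \<Union>b\<in>cball 0 \<epsilon>. {a + b}"
      have N: "a + b \<in> ?N" if "a \<in> ?K" "norm b \<le> \<epsilon>" for a b
        using that by (intro UN_I[of a] UN_I[of b]) auto
      have "S \<subseteq> ?N"
      proof
        fix z assume "z \<in> S"
        then consider "z \<in> ?K" | i where "z = p + \<epsilon> *\<^sub>R axis i 1"
          using C(2) p unfolding S_def by blast
        then show "z \<in> ?N"
        proof cases
          case 1
          then show ?thesis using N[of z 0] \<epsilon> by simp
        next
          case 2
          have "norm (\<epsilon> *\<^sub>R (axis i 1 :: plane)) \<le> \<epsilon>" using \<epsilon> by simp
          then show ?thesis using N[OF p] 2 by blast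
        qed
      qed
      moreover have "convex ?N" by (intro convex_sums K convex_cball)
      ultimately have "?Q \<subseteq> ?N" by (rule hull_minimal)
      then obtain a b where "a \<in> ?K" "norm b \<le> \<epsilon>" "x = a + b" using x by auto
      then show ?thesis by (intro infdist_le2[of a]) (auto simp: dist_norm)
    qed
  qed
  then have "dist P K \<le> \<epsilon>" by (simp add: dist_convex_body_def P)
  moreover have "polygon (points P)"
    unfolding P
  proof (rule polygon_convex_hull[of S p "\<lambda>_. \<epsilon>"])
    show "\<epsilon> \<noteq> 0 \<and> p + \<epsilon> *\<^sub>R axis i 1 \<in> S" for i :: 2
      using \<epsilon> exhaust_2[of i] by (auto simp: S_def)
  qed (use S in \<open>simp_all add: S_def\<close>)
  ultimately show ?thesis using that by blast
qed

lemma polygons_dense: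
  fixes K :: convex_body
  obtains P where "\<And>n. polygon (points (P n))" "P \<longlonglongrightarrow> K"
proof -
  have "\<exists>P. polygon (points P) \<and> dist P K \<le> inverse (real (Suc n))" for n
    by (rule polygon_near_convex_body[of "inverse (real (Suc n))" K]) auto
  then obtain P where P: "\<And>n. polygon (points (P n))" "\<And>n. dist (P n) K \<le> inverse (real (Suc n))"
    by metis
  have "(\<lambda>n. dist (P n) K) \<longlonglongrightarrow> 0"
    by (rule tendsto_sandwich[OF _ _ tendsto_const LIMSEQ_inverse_real_of_nat])
      (simp_all add: P(2) del: of_nat_Suc)
  then have "P \<longlonglongrightarrow> K" by (rule tendsto_dist_iff[THEN iffD2])
  then show ?thesis using that P by blast
qed

section \<open>Measures carried by finitely many curves\<close>

lemma nn_integral_finite_sum_measure: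
  fixes f :: "'a \<Rightarrow> ennreal"
  assumes sets: "\<And>i. i \<in> I \<Longrightarrow> sets (N i) = sets M"
    and em: "\<And>A. A \<in> sets M \<Longrightarrow> emeasure M A = (\<Sum>i\<in>I. emeasure (N i) A)"
    and f: "f \<in> borel_measurable M"
  shows "(\<integral>\<^sup>+x. f x \<partial>M) = (\<Sum>i\<in>I. \<integral>\<^sup>+x. f x \<partial>N i)"
proof -
  have meas: "g \<in> borel_measurable (N i)" if "g \<in> borel_measurable M" "i \<in> I" for g :: "'a \<Rightarrow> ennreal" and i
    using that measurable_cong_sets[OF sets[OF that(2)] refl] by blast
  have space: "space (N i) = space M" if "i \<in> I" for i
    by (rule sets_eq_imp_space_eq[OF sets[OF that]])
  show ?thesis
    using f
  proof induction
    case (cong f g)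
    have "(\<integral>\<^sup>+x. f x \<partial>M) = (\<integral>\<^sup>+x. g x \<partial>M)"
      by (rule nn_integral_cong) (rule cong)
    moreover have "(\<Sum>i\<in>I. \<integral>\<^sup>+x. f x \<partial>N i) = (\<Sum>i\<in>I. \<integral>\<^sup>+x. g x \<partial>N i)"
      by (intro sum.cong nn_integral_cong cong refl) (simp add: space)
    ultimately show ?case using cong by simp
  next
    case (set A)
    then have "A \<in> sets (N i)" if "i \<in> I" for i using sets that by blast
    then show ?case using set em by simp
  next
    case (mult u c)
    have "(\<integral>\<^sup>+x. c * u x \<partial>M) = c * (\<Sum>i\<in>I. \<integral>\<^sup>+x. u x \<partial>N i)"
      unfolding mult(4)[symmetric] by (rule nn_integral_cmult[OF mult(2)])
    also have "\<dots> = (\<Sum>i\<in>I. \<integral>\<^sup>+x. c * u x \<partial>N i)"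
      unfolding sum_distrib_left
      by (intro sum.cong refl nn_integral_cmult[symmetric] meas mult)
    finally show ?case .
  next
    case (add u v)
    have "(\<integral>\<^sup>+x. v x + u x \<partial>M) = (\<Sum>i\<in>I. \<integral>\<^sup>+x. v x \<partial>N i) + (\<Sum>i\<in>I. \<integral>\<^sup>+x. u x \<partial>N i)"
      unfolding add.IH[symmetric] by (intro nn_integral_add add)
    also have "\<dots> = (\<Sum>i\<in>I. \<integral>\<^sup>+x. v x + u x \<partial>N i)"
      unfolding sum.distrib[symmetric]
      by (intro sum.cong refl nn_integral_add[symmetric] meas add)
    finally show ?case .
  next
    case (seq U)
    have "(\<integral>\<^sup>+x. (SUP j. U j) x \<partial>M) = (SUP j. \<integral>\<^sup>+x. U j x \<partial>M)"
      unfolding SUP_apply by (intro nn_integral_monotone_convergence_SUP seq)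
    also have "\<dots> = (SUP j. \<Sum>i\<in>I. \<integral>\<^sup>+x. U j x \<partial>N i)"
      unfolding seq.IH ..
    also have "\<dots> = (\<Sum>i\<in>I. SUP j. \<integral>\<^sup>+x. U j x \<partial>N i)"
    proof (rule ennreal_SUP_sum)
      show "incseq (\<lambda>j. \<integral>\<^sup>+x. U j x \<partial>N i)" for i
        using \<open>incseq U\<close> by (auto simp: incseq_def le_fun_def intro!: nn_integral_mono)
    qed
    also have "\<dots> = (\<Sum>i\<in>I. \<integral>\<^sup>+x. (SUP j. U j) x \<partial>N i)"
      unfolding SUP_apply
      by (intro sum.cong refl nn_integral_monotone_convergence_SUP[symmetric] meas seq)
    finally show ?case .
  qed
qed

lemma integral_finite_sum_measure:
  fixes g :: "'a \<Rightarrow> real"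
  assumes I: "finite I" and sets: "\<And>i. i \<in> I \<Longrightarrow> sets (N i) = sets M"
    and em: "\<And>A. A \<in> sets M \<Longrightarrow> emeasure M A = (\<Sum>i\<in>I. emeasure (N i) A)"
    and g: "g \<in> borel_measurable M" and int: "\<And>i. i \<in> I \<Longrightarrow> integrable (N i) g"
  shows "integrable M g" "integral\<^sup>L M g = (\<Sum>i\<in>I. integral\<^sup>L (N i) g)"
proof -
  have p: "(\<integral>\<^sup>+x. ennreal (g x) \<partial>M) = (\<Sum>i\<in>I. \<integral>\<^sup>+x. ennreal (g x) \<partial>N i)"
    using g by (intro nn_integral_finite_sum_measure sets em) auto
  have n: "(\<integral>\<^sup>+x. ennreal (- g x) \<partial>M) = (\<Sum>i\<in>I. \<integral>\<^sup>+x. ennreal (- g x) \<partial>N i)"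
    using g by (intro nn_integral_finite_sum_measure sets em) auto
  have fin: "(\<integral>\<^sup>+x. ennreal (g x) \<partial>N i) \<noteq> top" "(\<integral>\<^sup>+x. ennreal (- g x) \<partial>N i) \<noteq> top" if "i \<in> I" for i
    using int[OF that] by (auto simp: real_integrable_def)
  show M: "integrable M g"
    using g I fin by (simp add: real_integrable_def p n)
  have enn2real_sum: "enn2real (\<Sum>i\<in>I. h i) = (\<Sum>i\<in>I. enn2real (h i))"
    if "\<And>i. i \<in> I \<Longrightarrow> h i \<noteq> top" for h
    using I that by (induction I) (simp_all add: enn2real_plus less_top[symmetric])
  show "integral\<^sup>L M g = (\<Sum>i\<in>I. integral\<^sup>L (N i) g)"
    using fin
    by (simp add: real_lebesgue_integral_def[OF M] real_lebesgue_integral_def[OF int] p n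
        enn2real_sum sum_subtractf)
qed

text \<open>
  The measure is a finite sum of images of Lebesgue measures on intervals.
\<close>

lemma integral_finite_curves:
  fixes g :: "'a::{second_countable_topology, t2_space} \<Rightarrow> real" and \<phi> :: "'i \<Rightarrow> real \<Rightarrow> 'a"
  assumes I: "finite I" and sets: "sets M = sets (restrict_space borel S)"
    and \<phi>: "\<And>i. i \<in> I \<Longrightarrow> continuous_on UNIV (\<phi> i)" "\<And>i t. i \<in> I \<Longrightarrow> \<phi> i t \<in> S"
    and em: "\<And>\<eta>. \<eta> \<in> sets M \<Longrightarrow>
      emeasure M \<eta> = (\<Sum>i\<in>I. \<integral>\<^sup>+t\<in>{a i..b i}. indicator \<eta> (\<phi> i t) \<partial>lborel)"
    and g: "continuous_on S g"
  shows "integrable M g"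
    "integral\<^sup>L M g = (\<Sum>i\<in>I. \<integral>t. g (\<phi> i t) * indicator {a i..b i} t \<partial>lborel)"
proof -
  define N where "N i = distr (density lborel (\<lambda>t. ennreal (indicator {a i..b i} t))) M (\<phi> i)" for i
  have \<phi>_meas: "\<phi> i \<in> borel \<rightarrow>\<^sub>M M" if "i \<in> I" for i
  proof -
    have "\<phi> i \<in> borel \<rightarrow>\<^sub>M restrict_space borel S"
      using \<phi>(2)[OF that] borel_measurable_continuous_onI[OF \<phi>(1)[OF that]]
      by (intro measurable_restrict_space2) auto
    then show ?thesis using measurable_cong_sets[OF refl sets] by blast
  qed
  have g_meas: "g \<in> borel_measurable M"
    using borel_measurable_continuous_on_restrict[OF g] measurable_cong_sets[OF sets refl] by blast
  have em': "emeasure M A = (\<Sum>i\<in>I. emeasure (N i) A)" if A: "A \<in> sets M" for A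
    unfolding em[OF A]
  proof (rule sum.cong)
    fix i assume i: "i \<in> I"
    note m = measurable_sets[OF \<phi>_meas[OF i] A]
    have "emeasure (N i) A = emeasure (density lborel (\<lambda>t. ennreal (indicator {a i..b i} t))) (\<phi> i -` A)"
      using A m \<phi>_meas[OF i] by (simp add: N_def emeasure_distr)
    also have "\<dots> = (\<integral>\<^sup>+t. ennreal (indicator {a i..b i} t) * indicator (\<phi> i -` A) t \<partial>lborel)"
      using m by (intro emeasure_density) auto
    finally show "(\<integral>\<^sup>+t\<in>{a i..b i}. indicator A (\<phi> i t) \<partial>lborel) = emeasure (N i) A"
      by (simp add: indicator_vimage mult.commute ennreal_indicator)
  qed simp
  have comp: "continuous_on {a i..b i} (\<lambda>t. g (\<phi> i t))" if "i \<in> I" for i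
    using \<phi>(2)[OF that] by (intro continuous_on_compose2[OF g continuous_on_subset[OF \<phi>(1)[OF that]]]) auto
  have comp_meas: "(\<lambda>t. g (\<phi> i t)) \<in> borel_measurable borel" if "i \<in> I" for i
    by (rule measurable_compose[OF \<phi>_meas[OF that] g_meas])
  have int: "integrable (N i) g" if i: "i \<in> I" for i
  proof -
    have "integrable lborel (\<lambda>t. indicator {a i..b i} t *\<^sub>R g (\<phi> i t))"
      by (rule borel_integrable_compact[OF _ comp[OF i]]) simp
    then show ?thesis
      unfolding N_def using \<phi>_meas[OF i] g_meas comp_meas[OF i]
      by (subst integrable_distr_eq) (simp_all add: integrable_density del: ennreal_indicator)
  qed
  have eq: "integral\<^sup>L (N i) g = (\<integral>t. g (\<phi> i t) * indicator {a i..b i} t \<partial>lborel)" if i: "i \<in> I" for i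
    unfolding N_def using \<phi>_meas[OF i] g_meas comp_meas[OF i]
    by (subst integral_distr) (simp_all add: integral_density mult.commute del: ennreal_indicator)
  have setsN: "sets (N i) = sets M" for i by (simp add: N_def)
  show "integrable M g"
    by (rule integral_finite_sum_measure(1)[OF I setsN em' g_meas int])
  have "integral\<^sup>L M g = (\<Sum>i\<in>I. integral\<^sup>L (N i) g)"
    by (rule integral_finite_sum_measure(2)[OF I setsN em' g_meas int])
  then show "integral\<^sup>L M g = (\<Sum>i\<in>I. \<integral>t. g (\<phi> i t) * indicator {a i..b i} t \<partial>lborel)"
    by (simp add: eq)
qed

section \<open>Support measures of polygons\<close>

lemma Sigma2_closed: "closed Sigma2"
  unfolding Sigma2_def by (intro closed_Times) auto

lemma support_measures_sets:
  assumes "support_measures \<Theta>" "k \<in> {0, 1}"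
  shows "sets (\<Theta> k K) = sets (restrict_space borel Sigma2)"
  using assms unfolding support_measures_def by blast

lemma support_measures_sets_borel:
  assumes "support_measures \<Theta>" "k \<in> {0, 1}" "\<eta> \<in> sets (\<Theta> k K)"
  shows "\<eta> \<in> sets borel"
proof -
  have "\<eta> \<in> sets (restrict_space borel Sigma2)"
    using support_measures_sets[OF assms(1,2)] assms(3) by blast
  then show ?thesis
    using Sigma2_closed by (subst (asm) sets_restrict_space_iff) auto
qed

lemma support_measures_polytope:
  assumes "support_measures \<Theta>" "k \<in> {0, 1}" "polytope (points K)" "\<eta> \<in> sets (\<Theta> k K)"
  shows "emeasure (\<Theta> k K) \<eta> = (\<Sum>F\<in>faces_of_dim k (points K).
     \<integral>\<^sup>+x\<in>F. (\<integral>\<^sup>+u\<in>outer_unit_normals (points K) F. indicator \<eta> (x, u) \<partial>hausdorff_measure (1 - k))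
       \<partial>hausdorff_measure k)"
  using assms unfolding support_measures_def by blast

lemma support_measure_1_polygon:
  fixes g :: "plane \<times> plane \<Rightarrow> real"
  assumes \<Theta>: "support_measures \<Theta>" and P: "polygon (points K)" and g: "continuous_on Sigma2 g"
  shows "integrable (\<Theta> 1 K) g"
    "integral\<^sup>L (\<Theta> 1 K) g = (\<Sum>V\<in>polygon.vertices (points K).
       \<integral>t. g (V + t *\<^sub>R rot (polygon.out_normal (points K) V), polygon.out_normal (points K) V)
         * indicator {0..polygon.edge_length (points K) V} t \<partial>lborel)"
proof -
  interpret polygon "points K" by (rule P)
  let ?\<phi> = "\<lambda>V t. (V + t *\<^sub>R rot (out_normal V), out_normal V)"
  have em: "emeasure (\<Theta> 1 K) \<eta> = (\<Sum>V\<in>vertices. \<integral>\<^sup>+t\<in>{0..edge_length V}. indicator \<eta> (?\<phi> V t) \<partial>lborel)"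
    if \<eta>: "\<eta> \<in> sets (\<Theta> 1 K)" for \<eta>
  proof -
    have borel: "\<eta> \<in> sets borel" using support_measures_sets_borel[OF \<Theta> _ \<eta>] by simp
    let ?I = "\<lambda>F. \<integral>\<^sup>+x\<in>F. (\<integral>\<^sup>+u\<in>outer_unit_normals (points K) F. indicator \<eta> (x, u)
        \<partial>hausdorff_measure 0) \<partial>hausdorff_measure 1"
    have "emeasure (\<Theta> 1 K) \<eta> = (\<Sum>F\<in>faces_of_dim 1 (points K). ?I F)"
      using support_measures_polytope[OF \<Theta> _ polytope \<eta>] by simp
    also have "\<dots> = (\<Sum>V\<in>vertices. ?I (closed_segment V (next_vertex V)))"
      by (rule sum.reindex_bij_betw[OF edges_bij, symmetric])
    also have "\<dots> = (\<Sum>V\<in>vertices. \<integral>\<^sup>+t\<in>{0..edge_length V}. indicator \<eta> (?\<phi> V t) \<partial>lborel)"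
    proof (rule sum.cong)
      fix V assume V: "V \<in> vertices"
      let ?F = "closed_segment V (next_vertex V)" and ?u = "out_normal V"
      have "?I ?F = (\<integral>\<^sup>+x\<in>?F. indicator \<eta> (x, ?u) \<partial>hausdorff_measure 1)"
        unfolding outer_unit_normals_edge[OF out_edge[OF V]]
        by (subst nn_integral_indicator_singleton) (simp_all add: emeasure_hausdorff_measure_0_singleton)
      also have "\<dots> = (\<integral>\<^sup>+t\<in>{0..edge_length V}. indicator \<eta> (?\<phi> V t) \<partial>lborel)"
      proof -
        interpret arc_length_parametrization "\<lambda>t. V + t *\<^sub>R rot ?u" 0 "edge_length V"
          using next_vertex_eq[OF V] by (intro arc_length_parametrization_line) auto
        have "(\<lambda>x. (x, ?u)) \<in> borel_measurable borel"
          by (intro borel_measurable_continuous_onI continuous_intros)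
        then have "(\<lambda>x. indicator \<eta> (x, ?u) :: ennreal) \<in> borel_measurable borel"
          by (rule measurable_compose[OF _ borel_measurable_indicator[OF borel]])
        then show ?thesis
          unfolding edge_eq_image[OF V] by (rule nn_integral_hausdorff_trace)
      qed
      finally show "?I ?F = (\<integral>\<^sup>+t\<in>{0..edge_length V}. indicator \<eta> (?\<phi> V t) \<partial>lborel)" .
    qed simp
    finally show ?thesis .
  qed
  have cont: "continuous_on UNIV (?\<phi> V)" if "V \<in> vertices" for V by (intro continuous_intros)
  have in_Sigma: "?\<phi> V t \<in> Sigma2" if "V \<in> vertices" for V t
    using next_vertex_eq(3)[OF that] by (simp add: Sigma2_def)
  have sets: "sets (\<Theta> 1 K) = sets (restrict_space borel Sigma2)"
    using support_measures_sets[OF \<Theta>] by simp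
  show "integrable (\<Theta> 1 K) g"
    by (rule integral_finite_curves(1)[OF finite_vertices sets, where \<phi> = "?\<phi>"
          and a = "\<lambda>_. 0" and b = "edge_length"]) (erule cont in_Sigma em | rule g)+
  show "integral\<^sup>L (\<Theta> 1 K) g = (\<Sum>V\<in>vertices. \<integral>t. g (?\<phi> V t) * indicator {0..edge_length V} t \<partial>lborel)"
    by (rule integral_finite_curves(2)[OF finite_vertices sets, where \<phi> = "?\<phi>"
          and a = "\<lambda>_. 0" and b = "edge_length"]) (erule cont in_Sigma em | rule g)+
qed

lemma support_measure_0_polygon:
  fixes g :: "plane \<times> plane \<Rightarrow> real"
  assumes \<Theta>: "support_measures \<Theta>" and P: "polygon (points K)" and g: "continuous_on Sigma2 g"
  shows "integrable (\<Theta> 0 K) g"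
    "integral\<^sup>L (\<Theta> 0 K) g = (\<Sum>V\<in>polygon.vertices (points K).
       \<integral>\<theta>. g (V, unit_vec \<theta>) * indicator {fst (polygon.arc_bounds (points K) V)..
         snd (polygon.arc_bounds (points K) V)} \<theta> \<partial>lborel)"
proof -
  interpret polygon "points K" by (rule P)
  let ?\<alpha> = "\<lambda>V. fst (arc_bounds V)" and ?\<beta> = "\<lambda>V. snd (arc_bounds V)"
  have em: "emeasure (\<Theta> 0 K) \<eta> = (\<Sum>V\<in>vertices. \<integral>\<^sup>+\<theta>\<in>{?\<alpha> V..?\<beta> V}. indicator \<eta> (V, unit_vec \<theta>) \<partial>lborel)"
    if \<eta>: "\<eta> \<in> sets (\<Theta> 0 K)" for \<eta>
  proof -
    have borel: "\<eta> \<in> sets borel" using support_measures_sets_borel[OF \<Theta> _ \<eta>] by simp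
    let ?I = "\<lambda>F. \<integral>\<^sup>+x\<in>F. (\<integral>\<^sup>+u\<in>outer_unit_normals (points K) F. indicator \<eta> (x, u)
        \<partial>hausdorff_measure 1) \<partial>hausdorff_measure 0"
    have "emeasure (\<Theta> 0 K) \<eta> = (\<Sum>F\<in>faces_of_dim 0 (points K). ?I F)"
      using support_measures_polytope[OF \<Theta> _ polytope \<eta>] by simp
    also have "\<dots> = (\<Sum>V\<in>vertices. ?I {V})"
      unfolding faces_of_dim_0 by (subst sum.reindex) (auto simp: inj_on_def)
    also have "\<dots> = (\<Sum>V\<in>vertices. \<integral>\<^sup>+\<theta>\<in>{?\<alpha> V..?\<beta> V}. indicator \<eta> (V, unit_vec \<theta>) \<partial>lborel)"
    proof (rule sum.cong)
      fix V assume V: "V \<in> vertices"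
      interpret arc_length_parametrization unit_vec "?\<alpha> V" "?\<beta> V"
        using arc_bounds[OF V] by (intro arc_length_parametrization_circle) auto
      have "?I {V} = (\<integral>\<^sup>+u\<in>unit_vec ` {?\<alpha> V..?\<beta> V}. indicator \<eta> (V, u) \<partial>hausdorff_measure 1)"
        unfolding arc_bounds(5)[OF V, symmetric]
        by (subst nn_integral_indicator_singleton) (simp_all add: emeasure_hausdorff_measure_0_singleton)
      also have "\<dots> = (\<integral>\<^sup>+\<theta>\<in>{?\<alpha> V..?\<beta> V}. indicator \<eta> (V, unit_vec \<theta>) \<partial>lborel)"
      proof -
        have "(\<lambda>u. (V, u)) \<in> borel_measurable borel"
          by (intro borel_measurable_continuous_onI continuous_intros)
        then have "(\<lambda>u. indicator \<eta> (V, u) :: ennreal) \<in> borel_measurable borel"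
          by (rule measurable_compose[OF _ borel_measurable_indicator[OF borel]])
        then show ?thesis by (rule nn_integral_hausdorff_trace)
      qed
      finally show "?I {V} = (\<integral>\<^sup>+\<theta>\<in>{?\<alpha> V..?\<beta> V}. indicator \<eta> (V, unit_vec \<theta>) \<partial>lborel)" .
    qed simp
    finally show ?thesis .
  qed
  have cont: "continuous_on UNIV (\<lambda>\<theta>. (V, unit_vec \<theta>))" if "V \<in> vertices" for V
    by (intro continuous_intros continuous_on_unit_vec)
  have in_Sigma: "(V, unit_vec \<theta>) \<in> Sigma2" if "V \<in> vertices" for V \<theta> by (simp add: Sigma2_def)
  have sets: "sets (\<Theta> 0 K) = sets (restrict_space borel Sigma2)"
    using support_measures_sets[OF \<Theta>] by simp
  show "integrable (\<Theta> 0 K) g"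
    by (rule integral_finite_curves(1)[OF finite_vertices sets, where \<phi> = "\<lambda>V \<theta>. (V, unit_vec \<theta>)"
          and a = "?\<alpha>" and b = "?\<beta>"]) (erule cont in_Sigma em | rule g)+
  show "integral\<^sup>L (\<Theta> 0 K) g
      = (\<Sum>V\<in>vertices. \<integral>\<theta>. g (V, unit_vec \<theta>) * indicator {?\<alpha> V..?\<beta> V} \<theta> \<partial>lborel)"
    by (rule integral_finite_curves(2)[OF finite_vertices sets, where \<phi> = "\<lambda>V \<theta>. (V, unit_vec \<theta>)"
          and a = "?\<alpha>" and b = "?\<beta>"]) (erule cont in_Sigma em | rule g)+
qed

section \<open>The relations between the tensor valuations\<close>

text \<open>
  The integrand \<open>x\<^sup>r u\<^sup>s rot u\<close> of \<open>Phi\<close> at z = (x, u).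
\<close>

definition support_tensor :: "nat \<Rightarrow> nat \<Rightarrow> plane \<times> plane \<Rightarrow> tensor" where
  "support_tensor r s z = sym_prod (r + s) 1
     (sym_prod r s (sym_power 1 (vec_tensor (fst z)) r) (sym_power 1 (vec_tensor (snd z)) s))
     (vec_tensor (rot (snd z)))"

lemma Phi_eq: "Phi \<Theta> k r s K y = (\<integral>z. support_tensor r s z y \<partial>\<Theta> k K)"
  by (simp add: Phi_def support_tensor_def case_prod_beta')

lemma support_tensor_diagonal:
  "support_tensor r s (x, u) (\<lambda>_. v) = (x \<bullet> v) ^ r * (u \<bullet> v) ^ s * (rot u \<bullet> v)"
  by (simp add: support_tensor_def vec_tensor_def)

lemma support_tensor_in_sym_tensors: "support_tensor r s z \<in> sym_tensors (r + s + 1)"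
proof -
  have "sym_power 1 (vec_tensor x) n \<in> sym_tensors n" for x n
    using sym_power_in_sym_tensors[OF vec_tensor_in_sym_tensors, of x n] by simp
  then show ?thesis
    unfolding support_tensor_def by (intro sym_prod_in_sym_tensors vec_tensor_in_sym_tensors)
qed

lemma continuous_on_support_tensor: "continuous_on S (\<lambda>z. support_tensor r s z y)"
  unfolding support_tensor_def
proof (intro continuous_on_sym_prod continuous_on_sym_power)
  show "continuous_on S (\<lambda>z. vec_tensor (fst z) y)" "continuous_on S (\<lambda>z. vec_tensor (snd z) y)"
    "continuous_on S (\<lambda>z. vec_tensor (rot (snd z)) y)" for y
    unfolding vec_tensor_def by (intro continuous_intros continuous_on_rot)+
qed

text \<open>
  On an edge, r times the integrand is the derivative of \<open>(x \<bullet> v)\<^sup>r (u \<bullet> v)\<^sup>s\<close>, as x moves with velocity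
  \<open>rot u\<close>. For r = 0 both sides vanish.
\<close>

lemma Phi_1_polygon_diagonal:
  assumes \<Theta>: "support_measures \<Theta>" and P: "polygon (points K)"
  shows "real r * Phi \<Theta> 1 (r - 1) s K (\<lambda>_. v) =
    (\<Sum>V\<in>polygon.vertices (points K). (polygon.out_normal (points K) V \<bullet> v) ^ s *
      ((polygon.next_vertex (points K) V \<bullet> v) ^ r - (V \<bullet> v) ^ r))"
proof -
  interpret polygon "points K" by (rule P)
  have "real r * (\<integral>t. support_tensor (r - 1) s (V + t *\<^sub>R rot (out_normal V), out_normal V) (\<lambda>_. v)
      * indicator {0..edge_length V} t \<partial>lborel)
    = (out_normal V \<bullet> v) ^ s * ((next_vertex V \<bullet> v) ^ r - (V \<bullet> v) ^ r)" if V: "V \<in> vertices" for V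
  proof -
    define u w L where "u = out_normal V" and "w = rot u" and "L = edge_length V"
    let ?f = "\<lambda>t. real r * ((V + t *\<^sub>R w) \<bullet> v) ^ (r - 1) * (w \<bullet> v) * (u \<bullet> v) ^ s"
    let ?F = "\<lambda>t. ((V + t *\<^sub>R w) \<bullet> v) ^ r * (u \<bullet> v) ^ s"
    have "real r * (\<integral>t. support_tensor (r - 1) s (V + t *\<^sub>R w, u) (\<lambda>_. v) * indicator {0..L} t \<partial>lborel)
        = (\<integral>t. ?f t * indicator {0..L} t \<partial>lborel)"
      unfolding integral_mult_right_zero[symmetric]
      by (intro Bochner_Integration.integral_cong refl) (simp add: support_tensor_diagonal w_def ac_simps)
    also have "\<dots> = ?F L - ?F 0"
    proof (rule integral_FTC_Icc_real)
      show "0 \<le> L" using next_vertex_eq[OF V] by (simp add: L_def)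
      show "(?F has_real_derivative ?f t) (at t)" for t
        by (auto intro!: derivative_eq_intros simp: inner_add_left)
      show "isCont ?f t" for t by (intro continuous_intros)
    qed
    also have "\<dots> = (u \<bullet> v) ^ s * ((next_vertex V \<bullet> v) ^ r - (V \<bullet> v) ^ r)"
      using next_vertex_eq(1)[OF V] by (simp add: u_def w_def L_def algebra_simps)
    finally show ?thesis by (simp add: u_def w_def L_def)
  qed
  then show ?thesis
    unfolding Phi_eq support_measure_1_polygon(2)[OF \<Theta> P continuous_on_support_tensor] sum_distrib_left
    by (intro sum.cong) auto
qed

text \<open>
  On an arc of normals, s times the integrand is the derivative of \<open>(x \<bullet> v)\<^sup>r (u \<bullet> v)\<^sup>s\<close>, as u moves with
  velocity \<open>rot u\<close>. For s = 0 both sides vanish.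
\<close>

lemma Phi_0_polygon_diagonal:
  assumes \<Theta>: "support_measures \<Theta>" and P: "polygon (points K)"
  shows "real s * Phi \<Theta> 0 r (s - 1) K (\<lambda>_. v) =
    (\<Sum>V\<in>polygon.vertices (points K). (V \<bullet> v) ^ r *
      ((polygon.out_normal (points K) V \<bullet> v) ^ s - (polygon.in_normal (points K) V \<bullet> v) ^ s))"
proof -
  interpret polygon "points K" by (rule P)
  have "real s * (\<integral>\<theta>. support_tensor r (s - 1) (V, unit_vec \<theta>) (\<lambda>_. v)
      * indicator {fst (arc_bounds V)..snd (arc_bounds V)} \<theta> \<partial>lborel)
    = (V \<bullet> v) ^ r * ((out_normal V \<bullet> v) ^ s - (in_normal V \<bullet> v) ^ s)" if V: "V \<in> vertices" for V
  proof -
    define \<alpha> \<beta> where "\<alpha> = fst (arc_bounds V)" and "\<beta> = snd (arc_bounds V)"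
    let ?f = "\<lambda>\<theta>. real s * (V \<bullet> v) ^ r * (unit_vec \<theta> \<bullet> v) ^ (s - 1) * (rot (unit_vec \<theta>) \<bullet> v)"
    let ?F = "\<lambda>\<theta>. (V \<bullet> v) ^ r * (unit_vec \<theta> \<bullet> v) ^ s"
    have "real s * (\<integral>\<theta>. support_tensor r (s - 1) (V, unit_vec \<theta>) (\<lambda>_. v) * indicator {\<alpha>..\<beta>} \<theta> \<partial>lborel)
        = (\<integral>\<theta>. ?f \<theta> * indicator {\<alpha>..\<beta>} \<theta> \<partial>lborel)"
      unfolding integral_mult_right_zero[symmetric]
      by (intro Bochner_Integration.integral_cong refl) (simp add: support_tensor_diagonal ac_simps)
    also have "\<dots> = ?F \<beta> - ?F \<alpha>"
    proof (rule integral_FTC_Icc_real)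
      show "\<alpha> \<le> \<beta>" using arc_bounds[OF V] by (simp add: \<alpha>_def \<beta>_def)
      show "(?F has_real_derivative ?f \<theta>) (at \<theta>)" for \<theta>
        unfolding inner_plane rot_nth unit_vec_nth
        by (auto intro!: derivative_eq_intros simp: algebra_simps)
      show "isCont ?f \<theta>" for \<theta>
        unfolding inner_plane rot_nth unit_vec_nth by (intro continuous_intros)
    qed
    also have "\<dots> = (V \<bullet> v) ^ r * ((out_normal V \<bullet> v) ^ s - (in_normal V \<bullet> v) ^ s)"
      using arc_bounds(3,4)[OF V] by (simp add: \<alpha>_def \<beta>_def algebra_simps)
    finally show ?thesis by (simp add: \<alpha>_def \<beta>_def)
  qed
  then show ?thesis
    unfolding Phi_eq support_measure_0_polygon(2)[OF \<Theta> P continuous_on_support_tensor] sum_distrib_left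
    by (intro sum.cong) auto
qed

text \<open>
  Going once around the normal bundle: the arc at the end of an edge starts with the normal of that edge,
  so the boundary terms of edges and arcs cancel.
\<close>

lemma polygon_diagonal_relation:
  assumes \<Theta>: "support_measures \<Theta>" and P: "polygon (points K)"
  shows "real r * Phi \<Theta> 1 (r - 1) s K (\<lambda>_. v) + real s * Phi \<Theta> 0 r (s - 1) K (\<lambda>_. v) = 0"
proof -
  interpret polygon "points K" by (rule P)
  have "(\<Sum>V\<in>vertices. (next_vertex V \<bullet> v) ^ r * (out_normal V \<bullet> v) ^ s)
      = (\<Sum>V\<in>vertices. (next_vertex V \<bullet> v) ^ r * (in_normal (next_vertex V) \<bullet> v) ^ s)"
    by (intro sum.cong refl) (simp add: in_normal_next)
  also have "\<dots> = (\<Sum>V\<in>vertices. (V \<bullet> v) ^ r * (in_normal V \<bullet> v) ^ s)"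
    by (rule sum.reindex_bij_betw[OF next_bij])
  finally show ?thesis
    unfolding Phi_1_polygon_diagonal[OF assms] Phi_0_polygon_diagonal[OF assms]
    by (simp add: algebra_simps sum_subtractf sum.distrib)
qed

lemma Phi_polygon_in_sym_tensors:
  assumes \<Theta>: "support_measures \<Theta>" and P: "polygon (points K)" and k: "k \<in> {0, 1}"
  shows "Phi \<Theta> k r s K \<in> sym_tensors (r + s + 1)"
proof -
  have "integrable (\<Theta> k K) (\<lambda>z. support_tensor r s z y)" for y
    using k support_measure_0_polygon(1)[OF \<Theta> P continuous_on_support_tensor]
      support_measure_1_polygon(1)[OF \<Theta> P continuous_on_support_tensor] by auto
  then have "(\<lambda>y. \<integral>z. support_tensor r s z y \<partial>\<Theta> k K) \<in> sym_tensors (r + s + 1)"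
    by (intro integral_in_sym_tensors support_tensor_in_sym_tensors)
  then show ?thesis
    unfolding Phi_eq[symmetric] by simp
qed

lemma polygon_relation:
  assumes \<Theta>: "support_measures \<Theta>" and P: "polygon (points K)"
  shows "real r *\<^sub>R Phi \<Theta> 1 (r - 1) s K + real s *\<^sub>R Phi \<Theta> 0 r (s - 1) K = 0"
proof (rule sym_tensor_eq_0_if_diagonal_0)
  have "real r *\<^sub>R Phi \<Theta> 1 (r - 1) s K \<in> sym_tensors (r + s)"
    using sym_tensors_scaleR[OF Phi_polygon_in_sym_tensors[OF \<Theta> P, of 1 "r - 1" s], of "real r"]
    by (cases r) (simp_all add: sym_tensors_0)
  moreover have "real s *\<^sub>R Phi \<Theta> 0 r (s - 1) K \<in> sym_tensors (r + s)"
    using sym_tensors_scaleR[OF Phi_polygon_in_sym_tensors[OF \<Theta> P, of 0 r "s - 1"], of "real s"]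
    by (cases s) (simp_all add: sym_tensors_0)
  ultimately show "real r *\<^sub>R Phi \<Theta> 1 (r - 1) s K + real s *\<^sub>R Phi \<Theta> 0 r (s - 1) K \<in> sym_tensors (r + s)"
    by (rule sym_tensors_add)
  show "(real r *\<^sub>R Phi \<Theta> 1 (r - 1) s K + real s *\<^sub>R Phi \<Theta> 0 r (s - 1) K) (\<lambda>_. v) = 0" for v
    using polygon_diagonal_relation[OF \<Theta> P, of r s v] by (simp add: scaleR_fun_def)
qed

lemma Phi_tendsto:
  assumes "support_measures \<Theta>" "k \<in> {0, 1}" "X \<longlonglongrightarrow> K"
  shows "(\<lambda>n. Phi \<Theta> k r s (X n) y) \<longlonglongrightarrow> Phi \<Theta> k r s K y"
  using assms continuous_on_support_tensor[of Sigma2 r s y]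
  unfolding support_measures_def Phi_eq by blast

text \<open>
  Weak convergence applies to the integrands at each argument y, which are continuous on \<open>Sigma2\<close>,
  and so carries the relation from approximating polygons to K.
\<close>

lemma Phi_relation:
  assumes \<Theta>: "support_measures \<Theta>"
  shows "real r *\<^sub>R Phi \<Theta> 1 (r - 1) s + real s *\<^sub>R Phi \<Theta> 0 r (s - 1) = 0"
proof (intro ext)
  fix K :: convex_body and y
  obtain X where X: "\<And>n. polygon (points (X n))" "X \<longlonglongrightarrow> K"
    using polygons_dense[of K] by blast
  have "(\<lambda>n. real r * Phi \<Theta> 1 (r - 1) s (X n) y + real s * Phi \<Theta> 0 r (s - 1) (X n) y)
      \<longlonglongrightarrow> real r * Phi \<Theta> 1 (r - 1) s K y + real s * Phi \<Theta> 0 r (s - 1) K y"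
    by (intro tendsto_intros Phi_tendsto[OF \<Theta> _ X(2)]) auto
  moreover have "real r * Phi \<Theta> 1 (r - 1) s (X n) y + real s * Phi \<Theta> 0 r (s - 1) (X n) y = 0" for n
    using fun_cong[OF polygon_relation[OF \<Theta> X(1)[of n], of r s], of y] by (simp add: scaleR_fun_def)
  ultimately have "(\<lambda>n. 0 :: real) \<longlonglongrightarrow> real r * Phi \<Theta> 1 (r - 1) s K y + real s * Phi \<Theta> 0 r (s - 1) K y"
    by simp
  then have "real r * Phi \<Theta> 1 (r - 1) s K y + real s * Phi \<Theta> 0 r (s - 1) K y = 0"
    by (rule LIMSEQ_unique[OF _ tendsto_const])
  then show "(real r *\<^sub>R Phi \<Theta> 1 (r - 1) s + real s *\<^sub>R Phi \<Theta> 0 r (s - 1)) K y = 0 K y"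
    by (simp add: scaleR_fun_def)
qed

lemma Phi_1_0: "support_measures \<Theta> \<Longrightarrow> Phi \<Theta> 1 r 0 = 0"
  using Phi_relation[of \<Theta> "r + 1" 0] by simp

lemma Phi_0_0: "support_measures \<Theta> \<Longrightarrow> Phi \<Theta> 0 0 s = 0"
  using Phi_relation[of \<Theta> 0 "s + 1"] by simp

lemma Phi_0_eq:
  assumes "support_measures \<Theta>"
  shows "Phi \<Theta> 0 (Suc r) s = (- (real (Suc r) / real (Suc s))) *\<^sub>R Phi \<Theta> 1 r (Suc s)"
proof -
  have "real (Suc r) *\<^sub>R Phi \<Theta> 1 r (Suc s) + real (Suc s) *\<^sub>R Phi \<Theta> 0 (Suc r) s = 0"
    using Phi_relation[OF assms, of "Suc r" "Suc s"] by simp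
  then have "real (Suc s) *\<^sub>R Phi \<Theta> 0 (Suc r) s = - (real (Suc r) *\<^sub>R Phi \<Theta> 1 r (Suc s))"
    by (simp add: eq_neg_iff_add_eq_0 add.commute)
  then have "(1 / real (Suc s)) *\<^sub>R (real (Suc s) *\<^sub>R Phi \<Theta> 0 (Suc r) s)
      = (1 / real (Suc s)) *\<^sub>R (- (real (Suc r) *\<^sub>R Phi \<Theta> 1 r (Suc s)))"
    by simp
  then show ?thesis by simp
qed

section \<open>Linear independence\<close>

lemma univariate_coeffs_0:
  fixes d :: "'i \<Rightarrow> real"
  assumes I: "finite I" and zero: "\<And>x. 0 < x \<Longrightarrow> x < 1 \<Longrightarrow> (\<Sum>i\<in>I. d i * x ^ e i) = 0"
  shows "(\<Sum>i\<in>{i\<in>I. e i = k}. d i) = 0"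
proof -
  define p where "p = (\<Sum>i\<in>I. monom (d i) (e i))"
  have poly: "poly p x = (\<Sum>i\<in>I. d i * x ^ e i)" for x
    by (simp add: p_def poly_sum poly_monom)
  have "p = 0"
  proof (rule ccontr)
    assume "p \<noteq> 0"
    then have "finite {x. poly p x = 0}" by (rule poly_roots_finite)
    moreover have "{0<..<1} \<subseteq> {x. poly p x = 0}" by (auto simp: poly zero)
    ultimately have "finite {0<..<1::real}" by (rule rev_finite_subset)
    then show False using infinite_Ioo[of 0 "1 :: real"] by simp
  qed
  then have "0 = coeff p k" by simp
  also have "\<dots> = (\<Sum>i\<in>I. if e i = k then d i else 0)"
    by (simp add: p_def coeff_sum)
  also have "\<dots> = (\<Sum>i\<in>{i\<in>I. e i = k}. d i)"
    using I by (simp add: sum.inter_filter)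
  finally show ?thesis by simp
qed

text \<open>
  Compare the coefficients first in y for fixed x, and then in x.
\<close>

lemma bivariate_coeffs_0:
  fixes d :: "'i \<Rightarrow> real"
  assumes I: "finite I" and inj: "inj_on (\<lambda>i. (e i, f i)) I"
    and zero: "\<And>x y. 0 < x \<Longrightarrow> x < 1 \<Longrightarrow> 0 < y \<Longrightarrow> y < 1 \<Longrightarrow> (\<Sum>i\<in>I. d i * x ^ e i * y ^ f i) = 0"
    and j: "j \<in> I"
  shows "d j = 0"
proof -
  let ?J = "{i\<in>I. f i = f j}"
  have "(\<Sum>i\<in>?J. d i * x ^ e i) = 0" if "0 < x" "x < 1" for x
    using I zero[OF that] by (intro univariate_coeffs_0) auto
  then have "(\<Sum>i\<in>{i\<in>?J. e i = e j}. d i) = 0"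
    using I by (intro univariate_coeffs_0[where I = ?J]) auto
  moreover have "{i\<in>?J. e i = e j} = {j}"
    using inj j by (auto simp: inj_on_def)
  ultimately show ?thesis by simp
qed

text \<open>
  The injectivity that \<open>basis_family\<close> demands comes from a linear combination with the coefficients
  1 and - 1: if two members of the family agreed, then it would vanish.
\<close>

lemma basis_familyI:
  fixes b :: "'i \<Rightarrow> 'v::real_vector"
  assumes I: "finite I" and indep: "\<And>c j. (\<Sum>i\<in>I. c i *\<^sub>R b i) = 0 \<Longrightarrow> j \<in> I \<Longrightarrow> c j = 0"
    and span: "span (b ` I) = V"
  shows "basis_family b I V"
proof -
  have inj: "inj_on b I"
  proof (rule inj_onI, rule ccontr)
    fix i j assume ij: "i \<in> I" "j \<in> I" "b i = b j" "i \<noteq> j"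
    let ?c = "\<lambda>k. if k = i then 1 else if k = j then - 1 else 0 :: real"
    have "(\<Sum>k\<in>I. ?c k *\<^sub>R b k) = (\<Sum>k\<in>I. (if k = i then b i else 0) - (if k = j then b j else 0))"
      using ij by (intro sum.cong) auto
    also have "\<dots> = 0" using I ij by (simp add: sum_subtractf)
    finally have "?c i = 0" using indep[of ?c i] ij by blast
    then show False by simp
  qed
  moreover have "independent (b ` I)"
  proof
    assume "dependent (b ` I)"
    then obtain u v where u: "v \<in> b ` I" "u v \<noteq> 0" "(\<Sum>v\<in>b ` I. u v *\<^sub>R v) = 0"
      using dependent_finite[of "b ` I"] I by auto
    then have "(\<Sum>i\<in>I. u (b i) *\<^sub>R b i) = 0" using inj by (simp add: sum.reindex)
    then show False using indep[of "\<lambda>i. u (b i)"] u by auto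
  qed
  ultimately show ?thesis using span by (simp add: basis_family_def)
qed

text \<open>
  By the first assumptions BC is orthogonal to u and runs in the direction \<open>rot u\<close>, and by the last one the
  third vertex lies on its inner side.
\<close>

lemma triangle_oriented_edge:
  assumes "norm u = 1" "0 < L" "C = B + L *\<^sub>R rot u" "u \<bullet> A < u \<bullet> B"
  shows "oriented_edge (convex hull {A, B, C}) u B C"
  unfolding assms(3)
proof (rule oriented_edgeI[OF assms(1,2)])
  let ?C = "B + L *\<^sub>R rot u" and ?P = "convex hull {A, B, B + L *\<^sub>R rot u}"
  have uC: "u \<bullet> ?C = u \<bullet> B" by (simp add: inner_add_right)
  have u_at: "u \<bullet> x = u \<bullet> B - \<alpha> * (u \<bullet> B - u \<bullet> A)"
    if "x = \<alpha> *\<^sub>R A + \<beta> *\<^sub>R B + \<gamma> *\<^sub>R ?C" "\<alpha> + \<beta> + \<gamma> = 1" for x \<alpha> \<beta> \<gamma>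
  proof -
    have "u \<bullet> x = \<alpha> * (u \<bullet> A) + \<beta> * (u \<bullet> B) + \<gamma> * (u \<bullet> B)"
      unfolding that(1) by (simp only: inner_add_right inner_scaleR_right uC[unfolded inner_add_right inner_scaleR_right])
    moreover have "\<beta> = 1 - \<alpha> - \<gamma>" using that(2) by simp
    ultimately show ?thesis by (simp add: algebra_simps)
  qed
  have coords: "\<exists>\<alpha> \<beta> \<gamma>. 0 \<le> \<alpha> \<and> 0 \<le> \<beta> \<and> 0 \<le> \<gamma> \<and> \<alpha> + \<beta> + \<gamma> = 1 \<and>
      x = \<alpha> *\<^sub>R A + \<beta> *\<^sub>R B + \<gamma> *\<^sub>R ?C" if "x \<in> ?P" for x
    using that unfolding convex_hull_3 by blast
  show "\<forall>x\<in>?P. u \<bullet> x \<le> u \<bullet> B"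
  proof
    fix x assume "x \<in> ?P"
    then obtain \<alpha> \<beta> \<gamma> where "0 \<le> \<alpha>" "\<alpha> + \<beta> + \<gamma> = 1" "x = \<alpha> *\<^sub>R A + \<beta> *\<^sub>R B + \<gamma> *\<^sub>R ?C"
      using coords by blast
    then show "u \<bullet> x \<le> u \<bullet> B"
      using u_at[of x \<alpha> \<beta> \<gamma>] assms(4) by simp
  qed
  show "?P \<inter> {x. u \<bullet> x = u \<bullet> B} = closed_segment B ?C"
  proof (intro equalityI subsetI)
    fix x assume x: "x \<in> ?P \<inter> {x. u \<bullet> x = u \<bullet> B}"
    then obtain \<alpha> \<beta> \<gamma> where *: "0 \<le> \<beta>" "0 \<le> \<gamma>" "\<alpha> + \<beta> + \<gamma> = 1"
        "x = \<alpha> *\<^sub>R A + \<beta> *\<^sub>R B + \<gamma> *\<^sub>R ?C"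
      using coords by blast
    have "\<alpha> = 0"
      using u_at[OF *(4,3)] x assms(4) by simp
    moreover from this have "\<beta> = 1 - \<gamma>" using *(3) by simp
    ultimately show "x \<in> closed_segment B ?C"
      unfolding in_segment using * by (intro exI[of _ \<gamma>]) simp
  next
    fix x assume x: "x \<in> closed_segment B ?C"
    then have "x \<in> convex hull {B, ?C}" by (simp only: segment_convex_hull)
    also have "\<dots> \<subseteq> ?P" by (rule hull_mono) blast
    finally have "x \<in> ?P" .
    moreover obtain t where "x = (1 - t) *\<^sub>R B + t *\<^sub>R ?C" using x unfolding in_segment by blast
    then have "u \<bullet> x = u \<bullet> B"
      using u_at[of x 0 "1 - t" t] by simp
    ultimately show "x \<in> ?P \<inter> {x. u \<bullet> x = u \<bullet> B}" by simp
  qed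
qed

text \<open>
  The triangle has the vertices A = 0, B on the first and C on the second coordinate axis. Since A
  and C have first coordinate 0 and \<open>r \<ge> 1\<close>, only the arc of normals at B contributes. It ends at the normal
  \<open>(\<xi>, \<eta>)\<close> of the hypotenuse and starts at the normal \<open>(0, - 1)\<close> of the other edge at B, which contributes 0
  because of \<open>s \<ge> 1\<close>.
\<close>

lemma right_triangle:
  fixes a \<xi> \<eta> :: real
  assumes pos: "0 < a" "0 < \<xi>" "0 < \<eta>" and unit: "\<xi>\<^sup>2 + \<eta>\<^sup>2 = 1"
  obtains K where "\<And>\<Theta> r s. support_measures \<Theta> \<Longrightarrow> 1 \<le> r \<Longrightarrow> 1 \<le> s \<Longrightarrow>
    real s * Phi \<Theta> 0 r (s - 1) K (\<lambda>_. axis 1 1) = a ^ r * \<xi> ^ s"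
proof -
  \<comment> \<open>The position of C makes u the outer normal of the edge from B to C.\<close>
  define A B C :: plane where "A = 0" and "B = a *\<^sub>R axis 1 1" and "C = (a * \<xi> / \<eta>) *\<^sub>R axis 2 1"
  define u v :: plane where "u = vector [\<xi>, \<eta>]" and "v = vector [0, - 1]"
  have axis_nth: "(axis 1 1 :: plane) $ 1 = 1" "(axis 1 1 :: plane) $ 2 = 0"
    "(axis 2 1 :: plane) $ 1 = 0" "(axis 2 1 :: plane) $ 2 = 1"
    by (simp_all add: axis_def)
  have nth: "A $ 1 = 0" "A $ 2 = 0" "B $ 1 = a" "B $ 2 = 0" "C $ 1 = 0" "C $ 2 = a * \<xi> / \<eta>"
    "u $ 1 = \<xi>" "u $ 2 = \<eta>" "v $ 1 = 0" "v $ 2 = - 1"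
    by (simp_all add: A_def B_def C_def u_def v_def axis_nth)
  let ?T = "convex hull {A, B, C}"
  define K where "K = Convex_Body ?T"
  have "?T \<noteq> {}" "compact ?T" "convex ?T"
    by (auto simp: finite_imp_compact_convex_hull)
  then have K: "points K = ?T" by (simp add: K_def Convex_Body_inverse)
  have poly: "polygon (points K)"
    unfolding K
  proof (rule polygon_convex_hull[of _ A "\<lambda>i. if i = 1 then a else a * \<xi> / \<eta>"])
    show "(if i = 1 then a else a * \<xi> / \<eta>) \<noteq> 0 \<and>
        A + (if i = 1 then a else a * \<xi> / \<eta>) *\<^sub>R axis i 1 \<in> {A, B, C}" for i :: 2
      using pos exhaust_2[of i] by (auto simp: A_def B_def C_def)
  qed auto
  interpret polygon "points K" by (rule poly)
  have out: "oriented_edge (points K) u B C"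
    unfolding K
  proof (rule triangle_oriented_edge)
    show "norm u = 1" using unit by (simp add: norm_1_plane nth)
    show "0 < a / \<eta>" using pos by simp
    show "C = B + (a / \<eta>) *\<^sub>R rot u" using pos by (simp add: plane_eq_iff nth)
    show "u \<bullet> A < u \<bullet> B" using pos by (simp add: inner_plane nth)
  qed
  have "oriented_edge (convex hull {C, A, B}) v A B"
  proof (rule triangle_oriented_edge)
    show "norm v = 1" by (simp add: norm_1_plane nth)
    show "0 < a" by (rule pos(1))
    show "B = A + a *\<^sub>R rot v" by (simp add: plane_eq_iff nth)
    show "v \<bullet> C < v \<bullet> A" using pos by (simp add: inner_plane nth)
  qed
  then have in_e: "oriented_edge (points K) v A B"
    unfolding K by (simp add: insert_commute)
  have B: "B \<in> vertices" by (rule oriented_edge_vertices(1)[OF out])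
  have out_B: "out_normal B = u" using oriented_edge_unique(1)[OF out_edge[OF B] out] by simp
  have in_B: "in_normal B = v" using oriented_edge_unique(1)[OF in_edge[OF B] in_e] by simp
  have "vertices \<subseteq> {A, B, C}"
  proof
    fix V assume "V \<in> vertices"
    then have "{V} face_of points K" by (simp add: vertices_def)
    then have "V extreme_point_of ?T" unfolding K by (simp add: face_of_singleton)
    then show "V \<in> {A, B, C}" by (rule extreme_point_of_convex_hull)
  qed
  then have others: "V $ 1 = 0" if "V \<in> vertices - {B}" for V
    using that nth by auto
  have "real s * Phi \<Theta> 0 r (s - 1) K (\<lambda>_. axis 1 1) = a ^ r * \<xi> ^ s"
    if \<Theta>: "support_measures \<Theta>" and r: "1 \<le> r" and s: "1 \<le> s" for \<Theta> r s
  proof -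
    have "real s * Phi \<Theta> 0 r (s - 1) K (\<lambda>_. axis 1 1)
        = (\<Sum>V\<in>vertices. (V $ 1) ^ r * ((out_normal V $ 1) ^ s - (in_normal V $ 1) ^ s))"
      unfolding Phi_0_polygon_diagonal[OF \<Theta> poly] by simp
    also have "\<dots> = (\<Sum>V\<in>{B}. (V $ 1) ^ r * ((out_normal V $ 1) ^ s - (in_normal V $ 1) ^ s))"
      using B others r finite_vertices by (intro sum.mono_neutral_right) auto
    also have "\<dots> = a ^ r * \<xi> ^ s"
      using s by (simp add: out_B in_B nth)
    finally show ?thesis .
  qed
  then show ?thesis using that by blast
qed

lemma scaleR_fun_apply: "(c *\<^sub>R f) x = c *\<^sub>R f x"
  by (simp add: scaleR_fun_def)

lemma sum_fun_apply: "(\<Sum>i\<in>I. f i) x = (\<Sum>i\<in>I. f i x)"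
  by (induction I rule: infinite_finite_induct) simp_all

definition basis_index :: "nat \<Rightarrow> (nat \<times> nat \<times> nat) set" where
  "basis_index p = {(m, r, s). s \<ge> 1 \<and> 2 * m + r + s + 1 = p}"

lemma finite_basis_index: "finite (basis_index p)"
  by (rule finite_subset[of _ "{..p} \<times> {..p} \<times> {..p}"]) (auto simp: basis_index_def)

lemma Q_Phi_linearly_independent:
  assumes \<Theta>: "support_measures \<Theta>"
    and zero: "(\<Sum>(m, r, s)\<in>basis_index p. c (m, r, s) *\<^sub>R Q_Phi \<Theta> m 1 r s) = 0"
    and j: "j \<in> basis_index p"
  shows "c j = 0"
proof -
  let ?e = "\<lambda>(m, r, s). r + 1" and ?f = "\<lambda>(m, r, s). s"
  \<comment> \<open>A basis element with index (m, r, s) has the value - a ^ (r + 1) * \<xi> ^ s / (r + 1) on the triangle.\<close>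
  let ?d = "\<lambda>i. - (c i / real (?e i))"
  have "?d j = 0"
  proof (rule bivariate_coeffs_0[OF finite_basis_index _ _ j])
    show "inj_on (\<lambda>i. (?e i, ?f i)) (basis_index p)"
      by (auto simp: inj_on_def basis_index_def)
    fix a \<xi> :: real assume a: "0 < a" "a < 1" and \<xi>: "0 < \<xi>" "\<xi> < 1"
    \<comment> \<open>Completes the prescribed first coordinate to a unit vector, the normal of the hypotenuse.\<close>
    define \<eta> where "\<eta> = sqrt (1 - \<xi>\<^sup>2)"
    have "\<xi>\<^sup>2 < 1" using \<xi> by (simp add: abs_square_less_1)
    then have "0 < \<eta>" "\<xi>\<^sup>2 + \<eta>\<^sup>2 = 1" by (simp_all add: \<eta>_def)
    then obtain K where K: "\<And>r s. 1 \<le> r \<Longrightarrow> 1 \<le> s \<Longrightarrow>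
        real s * Phi \<Theta> 0 r (s - 1) K (\<lambda>_. axis 1 1) = a ^ r * \<xi> ^ s"
      using right_triangle[OF a(1) \<xi>(1)] \<Theta> by metis
    have "0 = (\<Sum>(m, r, s)\<in>basis_index p. c (m, r, s) *\<^sub>R Q_Phi \<Theta> m 1 r s) K (\<lambda>_. axis 1 1)"
      unfolding zero by simp
    also have "\<dots> = (\<Sum>i\<in>basis_index p. ?d i * a ^ ?e i * \<xi> ^ ?f i)"
      unfolding sum_fun_apply
    proof (rule sum.cong)
      fix i assume "i \<in> basis_index p"
      then obtain m r s where i: "i = (m, r, s)" and s: "1 \<le> s" by (auto simp: basis_index_def)
      have "real (Suc r) * Phi \<Theta> 1 r s K (\<lambda>_. axis 1 1) + real s * Phi \<Theta> 0 (Suc r) (s - 1) K (\<lambda>_. axis 1 1) = 0"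
        using fun_cong[OF fun_cong[OF Phi_relation[OF \<Theta>, of "Suc r" s]], of K "\<lambda>_. axis 1 1"]
        by (simp add: scaleR_fun_def)
      then have "Phi \<Theta> 1 r s K (\<lambda>_. axis 1 1) = - (a ^ Suc r * \<xi> ^ s) / real (Suc r)"
        using K[of "Suc r" s] s by (simp add: field_simps)
      then show "(case i of (m, r, s) \<Rightarrow> c (m, r, s) *\<^sub>R Q_Phi \<Theta> m 1 r s) K (\<lambda>_. axis 1 1)
          = ?d i * a ^ ?e i * \<xi> ^ ?f i"
        by (simp add: i scaleR_fun_def Q_Phi_def metric_tensor_def)
    qed simp
    finally show "(\<Sum>i\<in>basis_index p. ?d i * a ^ ?e i * \<xi> ^ ?f i) = 0" by simp
  qed
  then show ?thesis by (cases j) (simp add: divide_eq_0_iff)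
qed

text \<open>
  By the relations, each generator with k = 0 or s = 0 is 0 or a multiple of one with k = 1 and \<open>s \<ge> 1\<close>.
\<close>

lemma span_Q_Phi_1:
  assumes \<Theta>: "support_measures \<Theta>"
  shows "span ((\<lambda>(m, r, s). Q_Phi \<Theta> m 1 r s) ` basis_index p) = T_minus \<Theta> p"
proof
  let ?b = "\<lambda>(m, r, s). Q_Phi \<Theta> m 1 r s"
  let ?G = "{Q_Phi \<Theta> m k r s | m k r s. k \<in> {0, 1} \<and> 2 * m + r + s + 1 = p}"
  show "span (?b ` basis_index p) \<subseteq> T_minus \<Theta> p"
    unfolding T_minus_def by (rule span_mono) (force simp: basis_index_def)
  have b: "Q_Phi \<Theta> m 1 r s \<in> span (?b ` basis_index p)" if "1 \<le> s" "2 * m + r + s + 1 = p" for m r s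
    using that by (intro span_base) (force simp: basis_index_def)
  have "Q_Phi \<Theta> m k r s \<in> span (?b ` basis_index p)" if k: "k \<in> {0, 1}" and p: "2 * m + r + s + 1 = p" for m k r s
  proof -
    consider "k = 1" "s = 0" | "k = 1" "1 \<le> s" | "k = 0" "r = 0" | r' where "k = 0" "r = Suc r'"
      using k by (cases r; cases s) auto
    then show ?thesis
    proof cases
      case 1
      then have "Q_Phi \<Theta> m k r s = 0"
        by (simp add: Q_Phi_def Phi_1_0[OF \<Theta>, simplified] sym_prod_zero_right fun_eq_iff)
      then show ?thesis by (simp add: span_zero)
    next
      case 2
      then show ?thesis using b p by simp
    next
      case 3
      then have "Q_Phi \<Theta> m k r s = 0"
        by (simp add: Q_Phi_def Phi_0_0[OF \<Theta>] sym_prod_zero_right fun_eq_iff)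
      then show ?thesis by (simp add: span_zero)
    next
      case 4
      let ?c = "- (real (Suc r') / real (Suc s))"
      have "Q_Phi \<Theta> m k r s = ?c *\<^sub>R Q_Phi \<Theta> m 1 r' (Suc s)"
      proof
        fix K
        have "Phi \<Theta> 0 (Suc r') s K = ?c *\<^sub>R Phi \<Theta> 1 r' (Suc s) K"
          by (simp only: Phi_0_eq[OF \<Theta>] scaleR_fun_apply)
        moreover have "Suc r' + s + 1 = r' + Suc s + 1" by simp
        ultimately show "Q_Phi \<Theta> m k r s K = (?c *\<^sub>R Q_Phi \<Theta> m 1 r' (Suc s)) K"
          by (simp only: 4 Q_Phi_def scaleR_fun_apply sym_prod_scaleR_right)
      qed
      moreover have "Q_Phi \<Theta> m 1 r' (Suc s) \<in> span (?b ` basis_index p)"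
        using p 4 by (intro b) auto
      ultimately show ?thesis by (simp only: span_scale)
    qed
  qed
  then have "?G \<subseteq> span (?b ` basis_index p)" by blast
  then show "T_minus \<Theta> p \<subseteq> span (?b ` basis_index p)"
    unfolding T_minus_def by (rule span_minimal) (rule subspace_span)
qed

theorem theorem6:
  fixes \<Theta> :: "nat \<Rightarrow> convex_body \<Rightarrow> (plane \<times> plane) measure"
  assumes "support_measures \<Theta>"
  shows "(\<forall>r. Phi \<Theta> 1 r 0 = 0) \<and>
    (\<forall>s. Phi \<Theta> 0 0 s = 0) \<and>
    (\<forall>r\<ge>1. \<forall>s\<ge>1. real r *\<^sub>R Phi \<Theta> 1 (r - 1) s + real s *\<^sub>R Phi \<Theta> 0 r (s - 1) = 0) \<and>
    (\<forall>p. basis_family (\<lambda>(m, r, s). Q_Phi \<Theta> m 1 r s)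
       {(m, r, s). s \<ge> 1 \<and> 2 * m + r + s + 1 = p} (T_minus \<Theta> p))"
proof (intro conjI allI impI)
  show "Phi \<Theta> 1 r 0 = 0" for r by (rule Phi_1_0[OF assms])
  show "Phi \<Theta> 0 0 s = 0" for s by (rule Phi_0_0[OF assms])
  show "real r *\<^sub>R Phi \<Theta> 1 (r - 1) s + real s *\<^sub>R Phi \<Theta> 0 r (s - 1) = 0" for r s
    by (rule Phi_relation[OF assms])
  show "basis_family (\<lambda>(m, r, s). Q_Phi \<Theta> m 1 r s)
       {(m, r, s). s \<ge> 1 \<and> 2 * m + r + s + 1 = p} (T_minus \<Theta> p)" for p
    unfolding basis_index_def[symmetric]
  proof (rule basis_familyI[OF finite_basis_index _ span_Q_Phi_1[OF assms]])
    fix c j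
    assume "(\<Sum>i\<in>basis_index p. c i *\<^sub>R (case i of (m, r, s) \<Rightarrow> Q_Phi \<Theta> m 1 r s)) = 0" "j \<in> basis_index p"
    then show "c j = 0"
      using Q_Phi_linearly_independent[OF assms, of c p j] by (simp add: case_prod_beta)
  qed
qed

end
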